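(* Let $\theta\in(0,1)$ and let $\mathcal{H}_1,\mathcal{H}_2$ be Banach spaces with $\mathcal{D}(\mathcal{A}_d)\subset\mathcal{H}_1\subset\mathcal{H}\subset\mathcal{H}_2$, $\|\cdot\|_{\mathcal{D}(\mathcal{A}_d)}\sim\|\cdot\|_{\mathcal{H}_1}$, and $[\mathcal{H}_1;\mathcal{H}_2]_\theta=\mathcal{H}$. Let $G:\mathbb{R}_+\to\mathbb{R}_+$ be continuous, invertible, increasing on $\mathbb{R}_+$, and such that $x\mapsto x^{-\frac{\theta}{1-\theta}}G(x)$ is increasing on $(0,1)$. Assume that at least one of the following two conditions holds. (H) For $\lambda\in\mathbb{C}_+=\{\lambda\in\mathbb{C}:\Re\lambda>0\}$ the map $\lambda\mapsto H(\lambda)=-D^*(\lambda I+C+\lambda B^*(\lambda^2+A)^{-1}B)^{-1}D\in\mathcal{L}(W)$ is bounded on the line $C_\beta=\{\lambda\in\mathbb{C}:\Re\lambda=\beta\}$, where $\beta$ is a positive constant. (B) $D\in\mathcal{L}(U)$ (that is, $W=U$ and $D$ is a bounded operator on $U$). For $z_0\in\mathcal{D}(\mathcal{A}_d)$ let $z_1(t)=(x_1(t),y_1(t),u_1(t))$ be the solution of $z_1'=\mathcal{A}_cz_1$, $z_1(0)=z_0$, let $z$ be the solution of $z'=\mathcal{A}_dz$, $z(0)=z_0$, and let $E(t)=\frac12\|z(t)\|_{\mathcal{H}}^2$. Then: 1. If there exist $T>0$ and $c(T)>0$ such that for all nonzero $z_0\in\mathcal{D}(\mathcal{A}_d)$ $$\int_0^T\|D^*u_1(s)\|_W^2\,ds\ge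 c(T)\,\|z_0\|_{\mathcal{H}}^2\,G\!\left(\frac{\|z_0\|_{\mathcal{H}_2}^2}{\|z_0\|_{\mathcal{H}}^2}\right),$$ then there is a constant $K>0$ such that for all $z_0\in\mathcal{D}(\mathcal{A}_d)$ and all $t\ge0$ $$E(t)\le K\left[G^{-1}\!\left(\frac1{1+t}\right)\right]^{\frac{\theta}{1-\theta}}\|z_0\|_{\mathcal{D}(\mathcal{A}_d)}^2.$$ 2. If there exist $T>0$ and $c(T)>0$ such that for all nonzero $z_0\in\mathcal{D}(\mathcal{A}_d)$ $$\int_0^T\|D^*u_1(s)\|_W^2\,ds\ge c(T)\,\|z_0\|_{\mathcal{H}_2}^2,$$ then there is a constant $K>0$ such that for all $z_0\in\mathcal{D}(\mathcal{A}_d)$ and all $t\ge0$ $$E(t)\le \frac{K}{(1+t)^{\frac{\theta}{1-\theta}}}\,\|z_0\|_{\mathcal{D}(\mathcal{A}_d)}^2.$$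
   Context: Let $X$ be a complex Hilbert space and let $A$ be an unbounded positive self-adjoint operator on $X$ which is the Friedrichs extension of a triple $(X,V,a)$, where $a$ is a closed quadratic form with domain $V$ dense in $X$; $V$ is a Hilbert space with scalar product $a(\cdot,\cdot)$, $V'$ is the dual of $V$ obtained by means of the inner product of $X$, and $A$ also denotes the extension $A\in\mathcal{L}(V,V')$, $\langle Ax,\varphi\rangle_{V',V}=a(x,\varphi)$. Let $U$ be a complex Hilbert space identified with its dual, $B\in\mathcal{L}(U,V')$, with adjoint $B^*\in\mathcal{L}(V,U)$. Let $\widehat C$ be an m-dissipative operator on $U$ that can be written $\widehat C=-C-DD^*$, where $C$ is a skew-adjoint operator on $U$, $W$ is a Hilbert subspace of $U$ identified with its dual, $D\in\mathcal{L}(W,(D(C))')$, and hence $D^*\in\mathcal{L}(D(C),W)$. $\mathcal{H}=V\times X\times U$ has the scalar product $\langle (x,y,u),(\tilde x,\tilde y,\tilde u)\rangle=a(x,\tilde x)+\langle y,\tilde y\rangle_X+\langle u,\tilde u\rangle_U$. The operators are $$\mathcal{A}_d(x,y,u)=(y,-Ax-Bu,B^*y+\widehat Cu),\quad \mathcal{D}(\mathcal{A}_d)=\{(x,y,u)\in V\times V\times D(\widehat C):Ax+Bu\in X\},$$ $$\mathcal{A}_c(x,y,u)=(y,-Ax-Bu,B^*y-Cu),\quad \mathcal{D}(\mathcal{A}_c)=\{(x,y,u)\in V\times V\times D(C):Ax+Bu\in X\}.$$ $\mathcal{A}_d$ is m-dissipative (generating a $C_0$-semigroup) and $\mathcal{A}_c$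 is skew-adjoint (generating a unitary group) on $\mathcal{H}$. $\|\cdot\|_{\mathcal{D}(\mathcal{A}_d)}$ is the graph norm; $\sim$ denotes equivalence of norms; $[\,\cdot\,;\,\cdot\,]_\theta$ denotes the interpolation space of exponent $\theta$ (complex interpolation, as in Triebel's book), for which $\|z\|_{\mathcal{H}}\le\|z\|_{\mathcal{H}_1}^{1-\theta}\|z\|_{\mathcal{H}_2}^{\theta}$. *)

theory Defs
  imports "HOL-Analysis.Analysis"
begin

section \<open>Complex Banach and Hilbert spaces\<close>

text \<open>
  The topology and the norm of a complex space are those of the underlying
  real normed space.  Inner products are linear in the first argument and
  antilinear in the second one.
\<close>

class complex_normed_vector = real_normed_vector +
  fixes scaleC :: "complex \<Rightarrow> 'a \<Rightarrow> 'a"  (infixr "*\<^sub>C" 75)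
  assumes scaleC_add_right: "c *\<^sub>C (x + y) = c *\<^sub>C x + c *\<^sub>C y"
    and scaleC_add_left: "(c + d) *\<^sub>C x = c *\<^sub>C x + d *\<^sub>C x"
    and scaleC_scaleC: "c *\<^sub>C d *\<^sub>C x = (c * d) *\<^sub>C x"
    and scaleC_of_real: "complex_of_real r *\<^sub>C x = r *\<^sub>R x"
    and norm_scaleC: "norm (c *\<^sub>C x) = cmod c * norm x"

class complex_inner = complex_normed_vector +
  fixes cinner :: "'a \<Rightarrow> 'a \<Rightarrow> complex"
  assumes cinner_commute: "cinner x y = cnj (cinner y x)"
    and cinner_add_left: "cinner (x + y) z = cinner x z + cinner y z"
    and cinner_scaleC_left: "cinner (c *\<^sub>C x) y = c * cinner x y"
    and cinner_self: "cinner x x = complex_of_real ((norm x)\<^sup>2)"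

class complex_banach = complex_normed_vector + complete_space

class complex_hilbert = complex_inner + complete_space

subclass (in complex_hilbert) complex_banach ..

text \<open>
  The library norm on a product is \<open>sqrt ((norm x)\<^sup>2 + (norm y)\<^sup>2)\<close>, that is,
  the norm of the Hilbert direct sum.
\<close>

instantiation prod :: (complex_normed_vector, complex_normed_vector) complex_normed_vector
begin

definition scaleC_prod :: "complex \<Rightarrow> 'a \<times> 'b \<Rightarrow> 'a \<times> 'b"
  where "scaleC_prod c z = (c *\<^sub>C fst z, c *\<^sub>C snd z)"

instance
proof
  fix c d :: complex and x y :: "'a \<times> 'b" and r :: real
  show "c *\<^sub>C (x + y) = c *\<^sub>C x + c *\<^sub>C y"
    by (simp add: scaleC_prod_def scaleC_add_right)
  show "(c + d) *\<^sub>C x = c *\<^sub>C x + d *\<^sub>C x"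
    by (simp add: scaleC_prod_def scaleC_add_left)
  show "c *\<^sub>C d *\<^sub>C x = (c * d) *\<^sub>C x"
    by (simp add: scaleC_prod_def scaleC_scaleC)
  show "complex_of_real r *\<^sub>C x = r *\<^sub>R x"
    by (simp add: scaleC_prod_def scaleC_of_real scaleR_prod_def)
  have "(cmod c * norm (fst x))\<^sup>2 + (cmod c * norm (snd x))\<^sup>2
      = (cmod c)\<^sup>2 * ((norm (fst x))\<^sup>2 + (norm (snd x))\<^sup>2)"
    by (simp add: power_mult_distrib distrib_left)
  then show "norm (c *\<^sub>C x) = cmod c * norm x"
    by (simp add: scaleC_prod_def norm_prod_def norm_scaleC real_sqrt_mult)
qed

end

instantiation prod :: (complex_inner, complex_inner) complex_inner
begin

definition cinner_prod :: "'a \<times> 'b \<Rightarrow> 'a \<times> 'b \<Rightarrow> complex"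
  where "cinner_prod z w = cinner (fst z) (fst w) + cinner (snd z) (snd w)"

instance
proof
  fix x y z :: "'a \<times> 'b" and c :: complex
  show "cinner x y = cnj (cinner y x)"
    by (simp add: cinner_prod_def cinner_commute[of "fst y"] cinner_commute[of "snd y"])
  show "cinner (x + y) z = cinner x z + cinner y z"
    by (simp add: cinner_prod_def cinner_add_left)
  show "cinner (c *\<^sub>C x) y = c * cinner x y"
    by (simp add: cinner_prod_def scaleC_prod_def cinner_scaleC_left distrib_left)
  show "cinner x x = complex_of_real ((norm x)\<^sup>2)"
    by (simp add: cinner_prod_def norm_prod_def cinner_self)
qed

end

instance prod :: (complex_banach, complex_banach) complex_banach ..

instance prod :: (complex_hilbert, complex_hilbert) complex_hilbert ..

definition bounded_clinear :: "('a::complex_normed_vector \<Rightarrow> 'b::complex_normed_vector) \<Rightarrow> bool"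
  where "bounded_clinear f \<longleftrightarrow> bounded_linear f \<and> (\<forall>c x. f (c *\<^sub>C x) = c *\<^sub>C f x)"

text \<open>A continuous inclusion \<open>E \<subseteq> F\<close> of spaces given as types.\<close>

definition inclusion :: "('a::complex_normed_vector \<Rightarrow> 'b::complex_normed_vector) \<Rightarrow> bool"
  where "inclusion i \<longleftrightarrow> bounded_clinear i \<and> inj i"

definition equivalent_norms_on :: "'a set \<Rightarrow> ('a \<Rightarrow> real) \<Rightarrow> ('a \<Rightarrow> real) \<Rightarrow> bool"
  where "equivalent_norms_on S p q \<longleftrightarrow> (\<exists>c>0. \<exists>K>0. \<forall>x\<in>S. c * p x \<le> q x \<and> q x \<le> K * p x)"

section \<open>Unbounded operators and semigroups\<close>

text \<open>An unbounded operator is a domain together with a function, of which only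
  the values on the domain matter.\<close>

definition linear_operator :: "'a::complex_normed_vector set \<Rightarrow> ('a \<Rightarrow> 'a) \<Rightarrow> bool"
  where "linear_operator S A \<longleftrightarrow>
    0 \<in> S \<and>
    (\<forall>x\<in>S. \<forall>y\<in>S. x + y \<in> S \<and> A (x + y) = A x + A y) \<and>
    (\<forall>c. \<forall>x\<in>S. c *\<^sub>C x \<in> S \<and> A (c *\<^sub>C x) = c *\<^sub>C A x)"

definition graph_norm :: "('a::complex_normed_vector \<Rightarrow> 'a) \<Rightarrow> 'a \<Rightarrow> real"
  where "graph_norm A x = sqrt ((norm x)\<^sup>2 + (norm (A x))\<^sup>2)"

definition m_dissipative :: "'a::complex_hilbert set \<Rightarrow> ('a \<Rightarrow> 'a) \<Rightarrow> bool"
  where "m_dissipative S A \<longleftrightarrow>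
    linear_operator S A \<and> (\<forall>x\<in>S. Re (cinner (A x) x) \<le> 0) \<and> (\<forall>f. \<exists>x\<in>S. x - A x = f)"

text \<open>The last conjunct says that the graph of the adjoint of \<open>A\<close> is the graph of \<open>- A\<close>.\<close>

definition skew_adjoint :: "'a::complex_hilbert set \<Rightarrow> ('a \<Rightarrow> 'a) \<Rightarrow> bool"
  where "skew_adjoint S A \<longleftrightarrow>
    linear_operator S A \<and> closure S = UNIV \<and>
    (\<forall>y w. (\<forall>x\<in>S. cinner (A x) y = cinner x w) \<longleftrightarrow> y \<in> S \<and> w = - A y)"

definition generates_C0_semigroup :: "'a::complex_banach set \<Rightarrow> ('a \<Rightarrow> 'a) \<Rightarrow> bool"
  where "generates_C0_semigroup S A \<longleftrightarrow> (\<exists>T :: real \<Rightarrow> 'a \<Rightarrow> 'a.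
    (\<forall>t\<ge>0. bounded_clinear (T t)) \<and> T 0 = id \<and>
    (\<forall>s\<ge>0. \<forall>t\<ge>0. T (s + t) = T s \<circ> T t) \<and>
    (\<forall>x. ((\<lambda>t. T t x) \<longlongrightarrow> x) (at_right 0)) \<and>
    (\<forall>x y. ((\<lambda>h. (T h x - x) /\<^sub>R h) \<longlongrightarrow> y) (at_right 0) \<longleftrightarrow> x \<in> S \<and> y = A x))"

definition generates_unitary_group :: "'a::complex_hilbert set \<Rightarrow> ('a \<Rightarrow> 'a) \<Rightarrow> bool"
  where "generates_unitary_group S A \<longleftrightarrow> (\<exists>T :: real \<Rightarrow> 'a \<Rightarrow> 'a.
    (\<forall>t. bounded_clinear (T t) \<and> surj (T t) \<and> (\<forall>x y. cinner (T t x) (T t y) = cinner x y)) \<and>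
    T 0 = id \<and> (\<forall>s t. T (s + t) = T s \<circ> T t) \<and>
    (\<forall>x. ((\<lambda>t. T t x) \<longlongrightarrow> x) (at 0)) \<and>
    (\<forall>x y. ((\<lambda>h. (T h x - x) /\<^sub>R h) \<longlongrightarrow> y) (at 0) \<longleftrightarrow> x \<in> S \<and> y = A x))"

text \<open>Classical solutions on \<open>{0..}\<close> of \<open>z' = A z\<close>, \<open>z 0 = z0\<close>.\<close>

definition cauchy_solution ::
    "'a::complex_normed_vector set \<Rightarrow> ('a \<Rightarrow> 'a) \<Rightarrow> 'a \<Rightarrow> (real \<Rightarrow> 'a) \<Rightarrow> bool"
  where "cauchy_solution S A z0 z \<longleftrightarrow>
    z 0 = z0 \<and> continuous_on {0..} (\<lambda>t. A (z t)) \<and>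
    (\<forall>t\<ge>0. z t \<in> S \<and> (z has_vector_derivative A (z t)) (at t within {0..}))"

section \<open>Duality\<close>

text \<open>
  \<open>T\<close> is a bounded linear map into the dual \<open>E'\<close> of the space \<open>E = S\<close> with norm \<open>n\<close>.
  Elements of \<open>E'\<close> are antilinear functionals, \<open>T x \<phi>\<close> being the duality bracket
  of \<open>T x\<close> and \<open>\<phi>\<close>; in this way a pivot space is contained in \<open>E'\<close>
  through \<open>f \<mapsto> cinner f\<close>.
\<close>

definition bounded_into_dual ::
    "'b::complex_normed_vector set \<Rightarrow> ('b \<Rightarrow> real) \<Rightarrow> ('a::complex_normed_vector \<Rightarrow> 'b \<Rightarrow> complex) \<Rightarrow> bool"
  where "bounded_into_dual S n T \<longleftrightarrow>
    (\<forall>x y. \<forall>\<phi>\<in>S. T (x + y) \<phi> = T x \<phi> + T y \<phi>) \<and>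
    (\<forall>c x. \<forall>\<phi>\<in>S. T (c *\<^sub>C x) \<phi> = c * T x \<phi>) \<and>
    (\<forall>x. \<forall>\<phi>\<in>S. \<forall>\<psi>\<in>S. T x (\<phi> + \<psi>) = T x \<phi> + T x \<psi>) \<and>
    (\<forall>c x. \<forall>\<phi>\<in>S. T x (c *\<^sub>C \<phi>) = cnj c * T x \<phi>) \<and>
    (\<exists>K. \<forall>x. \<forall>\<phi>\<in>S. cmod (T x \<phi>) \<le> K * norm x * n \<phi>)"

definition adjoint_on ::
    "'b set \<Rightarrow> ('a::complex_inner \<Rightarrow> 'b \<Rightarrow> complex) \<Rightarrow> ('b \<Rightarrow> 'a) \<Rightarrow> bool"
  where "adjoint_on S T Ts \<longleftrightarrow> (\<forall>x. \<forall>\<phi>\<in>S. T x \<phi> = cinner x (Ts \<phi>))"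

section \<open>Complex interpolation\<close>

definition cstrip :: "complex set"
  where "cstrip = {\<zeta>. 0 \<le> Re \<zeta> \<and> Re \<zeta> \<le> 1}"

text \<open>
  Calderon's function space for a couple with a continuous inclusion \<open>j\<close> of the
  first space into the second one, so that the sum of the two spaces is the second
  space: \<open>calderon_bound j M f\<close> says that \<open>f\<close> belongs to it, with norm at most \<open>M\<close>.
\<close>

definition calderon_bound ::
    "('a::complex_banach \<Rightarrow> 'b::complex_banach) \<Rightarrow> real \<Rightarrow> (complex \<Rightarrow> 'b) \<Rightarrow> bool"
  where "calderon_bound j M f \<longleftrightarrow>
    continuous_on cstrip f \<and> bounded (f ` cstrip) \<and>
    (\<forall>\<zeta>\<in>interior cstrip. \<exists>d. ((\<lambda>h. inverse h *\<^sub>C (f (\<zeta> + h) - f \<zeta>)) \<longlongrightarrow> d) (at 0)) \<and>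
    (\<exists>g :: real \<Rightarrow> 'a. continuous_on UNIV g \<and>
      (\<forall>t. f (Complex 0 t) = j (g t) \<and> norm (g t) \<le> M)) \<and>
    (\<forall>t. norm (f (Complex 1 t)) \<le> M)"

definition interpolation_space ::
    "('a::complex_banach \<Rightarrow> 'b::complex_banach) \<Rightarrow> real \<Rightarrow> 'b set"
  where "interpolation_space j \<theta> = {f (complex_of_real \<theta>) | f M. calderon_bound j M f}"

definition interpolation_norm ::
    "('a::complex_banach \<Rightarrow> 'b::complex_banach) \<Rightarrow> real \<Rightarrow> 'b \<Rightarrow> real"
  where "interpolation_norm j \<theta> b = Inf {M. \<exists>f. calderon_bound j M f \<and> f (complex_of_real \<theta>) = b}"

section \<open>The coupled system\<close>

text \<open>
  The form domain \<open>V\<close> is a Hilbert space type \<open>'v\<close> with dense continuous inclusion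
  \<open>iV :: 'v \<Rightarrow> 'x\<close> into \<open>X\<close>; its inner product is the closed form \<open>a\<close>.
  The energy space \<open>V \<times> X \<times> U\<close> is the type \<open>'v \<times> 'x \<times> 'u\<close> with the product inner product.
\<close>

definition form_operator :: "'v::complex_hilbert \<Rightarrow> 'v \<Rightarrow> complex"
  where "form_operator x \<phi> = cinner x \<phi>"

definition in_pivot :: "('v::complex_hilbert \<Rightarrow> 'x::complex_hilbert) \<Rightarrow> ('v \<Rightarrow> complex) \<Rightarrow> bool"
  where "in_pivot iV l \<longleftrightarrow> (\<exists>f. \<forall>\<phi>. l \<phi> = cinner f (iV \<phi>))"

definition to_pivot :: "('v::complex_hilbert \<Rightarrow> 'x::complex_hilbert) \<Rightarrow> ('v \<Rightarrow> complex) \<Rightarrow> 'x"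
  where "to_pivot iV l = (THE f. \<forall>\<phi>. l \<phi> = cinner f (iV \<phi>))"

text \<open>
  The operator \<open>(x, y, u) \<mapsto> (y, - A x - B u, B\<^sup>* y + K u)\<close>, where \<open>K\<close> has domain \<open>S\<close>.
  It is the dissipative operator for \<open>K = Chat\<close> and the conservative one for \<open>K = - C\<close>.
\<close>

definition coupled_dom ::
    "('v::complex_hilbert \<Rightarrow> 'x::complex_hilbert) \<Rightarrow> ('u::complex_hilbert \<Rightarrow> 'v \<Rightarrow> complex) \<Rightarrow>
     'u set \<Rightarrow> ('v \<times> 'x \<times> 'u) set"
  where "coupled_dom iV B S =
    {(x, y, u). y \<in> range iV \<and> u \<in> S \<and> in_pivot iV (\<lambda>\<phi>. form_operator x \<phi> + B u \<phi>)}"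

definition coupled_op ::
    "('v::complex_hilbert \<Rightarrow> 'x::complex_hilbert) \<Rightarrow> ('u::complex_hilbert \<Rightarrow> 'v \<Rightarrow> complex) \<Rightarrow>
     ('v \<Rightarrow> 'u) \<Rightarrow> ('u \<Rightarrow> 'u) \<Rightarrow> 'v \<times> 'x \<times> 'u \<Rightarrow> 'v \<times> 'x \<times> 'u"
  where "coupled_op iV B Bs K = (\<lambda>(x, y, u).
    (inv iV y,
     - to_pivot iV (\<lambda>\<phi>. form_operator x \<phi> + B u \<phi>),
     Bs (inv iV y) + K u))"

text \<open>
  Here \<open>B \<in> L(U, V')\<close> and \<open>D \<in> L(W, D(C)')\<close>, with adjoints \<open>Bs\<close> and \<open>Ds\<close>, where \<open>D(C)\<close>
  carries the graph norm.  Since \<open>Ds\<close> is defined on \<open>D(C)\<close>, the identity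
  \<open>Chat = - C - D Ds\<close> holds in \<open>D(C)'\<close>, and the domain of \<open>Chat\<close> consists of
  those \<open>u \<in> D(C)\<close> for which the right-hand side belongs to \<open>U\<close>.
\<close>

locale coupled_system =
  fixes iV :: "'v::complex_hilbert \<Rightarrow> 'x::complex_hilbert"
    and B :: "'u::complex_hilbert \<Rightarrow> 'v \<Rightarrow> complex"
    and Bs :: "'v \<Rightarrow> 'u"
    and domC :: "'u set"
    and C :: "'u \<Rightarrow> 'u"
    and domChat :: "'u set"
    and Chat :: "'u \<Rightarrow> 'u"
    and iW :: "'w::complex_hilbert \<Rightarrow> 'u"
    and D :: "'w \<Rightarrow> 'u \<Rightarrow> complex"
    and Ds :: "'u \<Rightarrow> 'w"
  assumes V_inclusion: "inclusion iV"
    and V_dense: "closure (range iV) = UNIV"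
    and B_bounded: "bounded_into_dual UNIV norm B"
    and B_adjoint: "adjoint_on UNIV B Bs"
    and C_skew_adjoint: "skew_adjoint domC C"
    and W_inclusion: "inclusion iW"
    and D_bounded: "bounded_into_dual domC (graph_norm C) D"
    and D_adjoint: "adjoint_on domC D Ds"
    and Chat_m_dissipative: "m_dissipative domChat Chat"
    and domChat_eq: "domChat =
      {u \<in> domC. \<exists>f. \<forall>\<phi>\<in>domC. - cinner (C u) \<phi> - D (Ds u) \<phi> = cinner f \<phi>}"
    and Chat_eq: "\<And>u \<phi>. u \<in> domChat \<Longrightarrow> \<phi> \<in> domC \<Longrightarrow>
      cinner (Chat u) \<phi> = - cinner (C u) \<phi> - D (Ds u) \<phi>"
    and Ad_m_dissipative:
      "m_dissipative (coupled_dom iV B domChat) (coupled_op iV B Bs Chat)"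
    and Ad_generates:
      "generates_C0_semigroup (coupled_dom iV B domChat) (coupled_op iV B Bs Chat)"
    and Ac_skew_adjoint:
      "skew_adjoint (coupled_dom iV B domC) (coupled_op iV B Bs (\<lambda>u. - C u))"
    and Ac_generates:
      "generates_unitary_group (coupled_dom iV B domC) (coupled_op iV B Bs (\<lambda>u. - C u))"

section \<open>The two conditions on the damping\<close>

text \<open>\<open>form_resolvent iV \<mu> l\<close> is \<open>(\<mu> + A)\<^sup>-\<^sup>1 l\<close> for \<open>l \<in> V'\<close>.\<close>

definition form_resolvent ::
    "('v::complex_hilbert \<Rightarrow> 'x::complex_hilbert) \<Rightarrow> complex \<Rightarrow> ('v \<Rightarrow> complex) \<Rightarrow> 'v"
  where "form_resolvent iV \<mu> l =
    (THE x. \<forall>\<phi>. \<mu> * cinner (iV x) (iV \<phi>) + form_operator x \<phi> = l \<phi>)"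

definition transfer_denominator ::
    "('v::complex_hilbert \<Rightarrow> 'x::complex_hilbert) \<Rightarrow> ('u::complex_hilbert \<Rightarrow> 'v \<Rightarrow> complex) \<Rightarrow>
     ('v \<Rightarrow> 'u) \<Rightarrow> ('u \<Rightarrow> 'u) \<Rightarrow> complex \<Rightarrow> 'u \<Rightarrow> 'u"
  where "transfer_denominator iV B Bs C l u =
    l *\<^sub>C u + C u + l *\<^sub>C Bs (form_resolvent iV (l\<^sup>2) (B u))"

text \<open>
  \<open>transfer_value \<dots> l w v\<close> is \<open>v = - D\<^sup>* (l + C + l B\<^sup>* (l\<^sup>2 + A)\<^sup>-\<^sup>1 B)\<^sup>-\<^sup>1 D w\<close>, for those
  \<open>w\<close> for which the inverse of \<open>D w \<in> D(C)'\<close> lies in the domain \<open>D(C)\<close> of \<open>D\<^sup>*\<close>.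
\<close>

definition transfer_value ::
    "('v::complex_hilbert \<Rightarrow> 'x::complex_hilbert) \<Rightarrow> ('u::complex_hilbert \<Rightarrow> 'v \<Rightarrow> complex) \<Rightarrow>
     ('v \<Rightarrow> 'u) \<Rightarrow> 'u set \<Rightarrow> ('u \<Rightarrow> 'u) \<Rightarrow> ('w::complex_hilbert \<Rightarrow> 'u \<Rightarrow> complex) \<Rightarrow> ('u \<Rightarrow> 'w) \<Rightarrow>
     complex \<Rightarrow> 'w \<Rightarrow> 'w \<Rightarrow> bool"
  where "transfer_value iV B Bs domC C D Ds l w v \<longleftrightarrow> (\<exists>u\<in>domC.
    (\<forall>\<phi>\<in>domC. cinner (transfer_denominator iV B Bs C l u) \<phi> = D w \<phi>) \<and> v = - Ds u)"

text \<open>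
  For unbounded \<open>D\<close> the formula for \<open>H l\<close> makes sense a priori only on a subspace of \<open>W\<close>;
  \<open>H l \<in> L(W)\<close> means that it is the restriction of a bounded operator on \<open>W\<close>.
\<close>

definition transfer_bounded_on_line ::
    "('v::complex_hilbert \<Rightarrow> 'x::complex_hilbert) \<Rightarrow> ('u::complex_hilbert \<Rightarrow> 'v \<Rightarrow> complex) \<Rightarrow>
     ('v \<Rightarrow> 'u) \<Rightarrow> 'u set \<Rightarrow> ('u \<Rightarrow> 'u) \<Rightarrow> ('w::complex_hilbert \<Rightarrow> 'u \<Rightarrow> complex) \<Rightarrow> ('u \<Rightarrow> 'w) \<Rightarrow> bool"
  where "transfer_bounded_on_line iV B Bs domC C D Ds \<longleftrightarrow> (\<exists>H :: complex \<Rightarrow> 'w \<Rightarrow> 'w.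
    (\<forall>l. 0 < Re l \<longrightarrow> bounded_clinear (H l) \<and>
      (\<forall>w v. transfer_value iV B Bs domC C D Ds l w v \<longrightarrow> H l w = v)) \<and>
    (\<exists>\<beta>>0. \<exists>M. \<forall>l. Re l = \<beta> \<longrightarrow> (\<forall>w. norm (H l w) \<le> M * norm w)))"

text \<open>\<open>W = U\<close> as Hilbert spaces, and \<open>D\<close> takes its values in \<open>U\<close> and is bounded on \<open>U\<close>.\<close>

definition damping_bounded ::
    "'u::complex_hilbert set \<Rightarrow> ('w::complex_hilbert \<Rightarrow> 'u) \<Rightarrow> ('w \<Rightarrow> 'u \<Rightarrow> complex) \<Rightarrow> bool"
  where "damping_bounded domC iW D \<longleftrightarrow>
    surj iW \<and> (\<forall>w. norm (iW w) = norm w) \<and>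
    (\<exists>D0 :: 'u \<Rightarrow> 'u. bounded_clinear D0 \<and> (\<forall>w. \<forall>\<phi>\<in>domC. D w \<phi> = cinner (D0 (iW w)) \<phi>))"

end

theory Submission
  imports Defs
begin

text \<open>
  The energy of a damped solution \<open>z\<close> drops by \<open>\<integral> \<parallel>D\<^sup>* u\<parallel>\<^sup>2\<close>, so the observability assumption on the
  conservative solution \<open>z\<^sub>1\<close> must be transferred to \<open>z\<close>.  The difference \<open>w = z\<^sub>1 - z\<close> starts at \<open>0\<close> and
  is driven by \<open>(0, 0, D D\<^sup>* u)\<close>; its output \<open>D\<^sup>* w\<^sub>u\<close> depends on the input \<open>D\<^sup>* u\<close> through the transfer
  function \<open>- H\<close>.  Instead of Laplace transforms and the Plancherel theorem we use long periods \<open>L\<close>: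
  after a cutoff, \<open>exp (- \<beta> t) u(t)\<close> is uniformly close, in the graph norm of \<open>Chat\<close>, to a trigonometric
  polynomial with coefficients in the domain of \<open>Chat\<close>, and for such an input the solution with multiplier
  \<open>exp (\<beta> L)\<close> over a period is a finite sum of resolvents at points \<open>\<beta> + 2 \<pi> i n / L\<close>, to which the bound
  on \<open>H\<close> applies termwise by orthogonality.  Since \<open>exp (\<beta> L)\<close> is large, this solution is small at time \<open>0\<close>,
  hence close to \<open>w\<close> in the energy norm.

  Interpolation between the graph norm, which does not increase along \<open>z\<close>, and the weak norm turns the
  observability inequality into a recursion \<open>\<delta>\<^sub>k\<^sub>+\<^sub>1 \<le> \<delta>\<^sub>k (1 - c G (\<delta>\<^sub>k powr ((1 - \<theta>) / \<theta>)))\<close>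
  for the energies at multiples of a fixed time.
\<close>

section \<open>Complex inner products\<close>

\<comment> \<open>Condition (H) constrains \<open>H l\<close> only on inputs for which its formula
  makes sense, and its bound concerns a single vertical line. The Fourier coefficients are therefore
  built from values in the domain of \<open>Chat\<close>: there \<open>D (Ds c)\<close> is an
  element of U, the resolvent of the skew-adjoint operator applies to it, and the control component
  of the result lies in \<open>domC\<close>, where \<open>Ds\<close> is defined.

  The order of the choices shapes the proof. The size of the forcing does not depend on L, so L is
  fixed first, long enough for L to be negligible against exp (\<beta> L). This works because the
  norm of a forced conservative solution grows at most linearly in time. Undoing the weight exp (-
  \<beta> t) magnifies the approximation error by up to exp (\<beta> L), so the tolerance is fixed
  after L. The damped output is observed on [0, T + 2]: one extra unit of time is the averaging
  window, the other the ramp of the cutoff.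

  Condition (B) needs none of this: \<open>Ds\<close> is then continuous in the energy norm, and a
  Gronwall argument suffices.\<close>
subclass (in complex_banach) banach ..

lemma bounded_bilinear_scaleC:
  "bounded_bilinear (scaleC :: complex \<Rightarrow> 'a \<Rightarrow> 'a::complex_normed_vector)"
proof
  fix a a' c :: complex and b b' x :: 'a and r :: real
  show "(a + a') *\<^sub>C b = a *\<^sub>C b + a' *\<^sub>C b" by (rule scaleC_add_left)
  show "a *\<^sub>C (b + b') = a *\<^sub>C b + a *\<^sub>C b'" by (rule scaleC_add_right)
  show "(r *\<^sub>R a) *\<^sub>C b = r *\<^sub>R (a *\<^sub>C b)"
    by (simp add: scaleR_conv_of_real flip: scaleC_of_real scaleC_scaleC)
  show "a *\<^sub>C (r *\<^sub>R b) = r *\<^sub>R (a *\<^sub>C b)"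
    by (simp add: scaleC_scaleC mult.commute flip: scaleC_of_real)
  show "\<exists>K. \<forall>(a::complex) (b::'a). norm (a *\<^sub>C b) \<le> norm a * norm b * K"
    by (intro exI[of _ 1]) (simp add: norm_scaleC)
qed

lemma scaleC_one [simp]: "1 *\<^sub>C (x::'a::complex_normed_vector) = x"
  using scaleC_of_real[of 1 x] by simp

lemma scaleC_minus_one: "(-1) *\<^sub>C (x::'a::complex_normed_vector) = - x"
  using scaleC_of_real[of "-1" x] by simp

lemmas scaleC_zero_left [simp] = bounded_bilinear.zero_left[OF bounded_bilinear_scaleC]
  and scaleC_zero_right [simp] = bounded_bilinear.zero_right[OF bounded_bilinear_scaleC]
  and scaleC_minus_right [simp] = bounded_bilinear.minus_right[OF bounded_bilinear_scaleC]
  and scaleC_diff_left = bounded_bilinear.diff_left[OF bounded_bilinear_scaleC]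
  and scaleC_diff_right = bounded_bilinear.diff_right[OF bounded_bilinear_scaleC]
  and scaleC_sum_left = bounded_bilinear.sum_left[OF bounded_bilinear_scaleC]
  and scaleC_sum_right = bounded_bilinear.sum_right[OF bounded_bilinear_scaleC]
  and continuous_on_scaleC [continuous_intros] =
    bounded_bilinear.continuous_on[OF bounded_bilinear_scaleC]

lemma cinner_add_right: "cinner x (y + z) = cinner x y + cinner (x::'a::complex_inner) z"
  by (metis cinner_add_left cinner_commute complex_cnj_add)

lemma cinner_scaleC_right: "cinner x (c *\<^sub>C y) = cnj c * cinner (x::'a::complex_inner) y"
  by (metis cinner_commute cinner_scaleC_left complex_cnj_mult)

lemma cinner_scaleR_left: "cinner (r *\<^sub>R x) y = of_real r * cinner (x::'a::complex_inner) y"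
  by (metis cinner_scaleC_left scaleC_of_real)

lemma cinner_scaleR_right: "cinner x (r *\<^sub>R y) = of_real r * cinner (x::'a::complex_inner) y"
  by (metis cinner_scaleC_right complex_cnj_complex_of_real scaleC_of_real)

lemma cinner_minus_left [simp]: "cinner (- x) y = - cinner (x::'a::complex_inner) y"
  using cinner_scaleR_left[of "-1" x y] by simp

lemma cinner_minus_right [simp]: "cinner x (- y) = - cinner (x::'a::complex_inner) y"
  using cinner_scaleR_right[of x "-1" y] by simp

lemma cinner_zero_left [simp]: "cinner 0 (y::'a::complex_inner) = 0"
  using cinner_scaleR_left[of 0 0 y] by simp

lemma cinner_zero_right [simp]: "cinner (y::'a::complex_inner) 0 = 0"
  using cinner_scaleR_right[of y 0 0] by simp

lemma cinner_diff_left: "cinner (x - y) z = cinner x z - cinner (y::'a::complex_inner) z"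
  using cinner_add_left[of x "- y" z] by simp

lemma cinner_diff_right: "cinner z (x - y) = cinner z x - cinner (z::'a::complex_inner) y"
  using cinner_add_right[of z x "- y"] by simp

lemma cinner_eqI:
  assumes "\<And>x. cinner x a = cinner x b"
  shows "a = (b::'a::complex_inner)"
proof -
  have "cinner (a - b) (a - b) = 0" using assms[of "a - b"] by (simp add: cinner_diff_right)
  then show ?thesis by (simp add: cinner_self)
qed

lemma Re_cinner_commute: "Re (cinner x y) = Re (cinner (y::'a::complex_inner) x)"
  by (subst cinner_commute) simp

lemma Re_cinner_self: "Re (cinner x x) = (norm (x::'a::complex_inner))\<^sup>2"
  by (simp add: cinner_self)

lemma norm_add_sq:
  "(norm (x + y))\<^sup>2 = (norm x)\<^sup>2 + 2 * Re (cinner x y) + (norm (y::'a::complex_inner))\<^sup>2"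
  using Re_cinner_commute[of y x]
  by (simp add: cinner_add_left cinner_add_right flip: Re_cinner_self)

lemma norm_diff_sq:
  "(norm (x - y))\<^sup>2 = (norm x)\<^sup>2 - 2 * Re (cinner x y) + (norm (y::'a::complex_inner))\<^sup>2"
  using norm_add_sq[of x "- y"] by simp

lemma norm_cinner_le: "cmod (cinner x y) \<le> norm x * norm (y::'a::complex_inner)"
proof (cases "y = 0")
  case False
  \<comment> \<open>\<open>c *\<^sub>C y\<close> is the orthogonal projection of x onto the line
    through y. Cauchy-Schwarz expresses that the remainder has a nonnegative squared norm.\<close>
  define c where "c = cinner x y / of_real ((norm y)\<^sup>2)"
  have "cinner x (c *\<^sub>C y) = of_real ((cmod (cinner x y))\<^sup>2 / (norm y)\<^sup>2)"
    using complex_norm_square[of "cinner x y"]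
    by (simp add: c_def cinner_scaleC_right mult.commute)
  moreover have "(norm (c *\<^sub>C y))\<^sup>2 = (cmod (cinner x y))\<^sup>2 / (norm y)\<^sup>2"
    using False by (simp add: c_def norm_scaleC norm_divide norm_mult power2_eq_square)
  ultimately have "0 \<le> (norm x)\<^sup>2 - (cmod (cinner x y))\<^sup>2 / (norm y)\<^sup>2"
    using norm_diff_sq[of x "c *\<^sub>C y"] zero_le_power2[of "norm (x - c *\<^sub>C y)"] by simp
  then have "(cmod (cinner x y))\<^sup>2 \<le> (norm x * norm y)\<^sup>2"
    using False by (simp add: divide_simps power_mult_distrib)
  then show ?thesis by (simp add: power2_le_iff_abs_le)
qed simp

lemma bounded_bilinear_cinner:
  "bounded_bilinear (cinner :: 'a::complex_inner \<Rightarrow> 'a \<Rightarrow> complex)"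
proof
  show "\<exists>K. \<forall>a b::'a. norm (cinner a b) \<le> norm a * norm b * K"
    by (intro exI[of _ 1]) (simp add: norm_cinner_le)
qed (simp_all add: cinner_add_left cinner_add_right cinner_scaleR_left cinner_scaleR_right
    scaleR_conv_of_real)

lemma bounded_bilinear_Re_cinner:
  "bounded_bilinear (\<lambda>x y. Re (cinner x (y::'a::complex_inner)))"
proof
  show "\<exists>K. \<forall>a b::'a. norm (Re (cinner a b)) \<le> norm a * norm b * K"
    using norm_cinner_le abs_Re_le_cmod order_trans by (intro exI[of _ 1]) fastforce
qed (simp_all add: cinner_add_left cinner_add_right cinner_scaleR_left cinner_scaleR_right)

lemmas cinner_sum_left = bounded_bilinear.sum_left[OF bounded_bilinear_cinner]
  and cinner_sum_right = bounded_bilinear.sum_right[OF bounded_bilinear_cinner]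
  and continuous_on_cinner [continuous_intros] =
    bounded_bilinear.continuous_on[OF bounded_bilinear_cinner]
  and tendsto_cinner [tendsto_intros] = bounded_bilinear.tendsto[OF bounded_bilinear_cinner]

lemma Re_cinner_le: "Re (cinner x y) \<le> norm x * norm (y::'a::complex_inner)"
  by (meson abs_Re_le_cmod abs_le_D1 norm_cinner_le order_trans)

lemma cinner_dense_eq:
  assumes "closure S = UNIV" "\<And>\<phi>. \<phi> \<in> S \<Longrightarrow> cinner x \<phi> = cinner y \<phi>"
  shows "x = (y::'a::complex_inner)"
proof -
  have "closed {\<phi>. cinner x \<phi> = cinner y \<phi>}"
    by (intro closed_Collect_eq continuous_intros)
  then have "closure S \<subseteq> {\<phi>. cinner x \<phi> = cinner y \<phi>}"
    using assms(2) by (intro closure_minimal) auto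
  then have "cinner x (x - y) = cinner y (x - y)" using assms(1) by auto
  then have "cinner (x - y) (x - y) = 0" by (simp add: cinner_diff_left)
  then show ?thesis by (simp add: cinner_self)
qed

text \<open>The test vector \<phi> = x would give the bound at once, but x need not belong to S. The
  inequality is closed in \<phi>, so it extends to the closure, where this choice is
  allowed.\<close>

lemma norm_le_dense:
  assumes "closure S = UNIV" "\<And>\<phi>. \<phi> \<in> S \<Longrightarrow> cmod (cinner x \<phi>) \<le> K * norm \<phi>" "0 \<le> K"
  shows "norm (x::'a::complex_inner) \<le> K"
proof -
  have "closed {\<phi>. cmod (cinner x \<phi>) \<le> K * norm \<phi>}"
    by (intro closed_Collect_le continuous_intros)
  then have "closure S \<subseteq> {\<phi>. cmod (cinner x \<phi>) \<le> K * norm \<phi>}"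
    using assms(2) by (intro closure_minimal) auto
  then have "cmod (cinner x x) \<le> K * norm x" using assms(1) by auto
  then show ?thesis using \<open>0 \<le> K\<close> by (cases "x = 0") (auto simp: cinner_self norm_mult power2_eq_square)
qed

text \<open>The point of \<open>M\<close> nearest to \<open>b \<notin> M\<close> exists by the parallelogram law; the difference is
  orthogonal to \<open>M\<close>.\<close>

lemma exists_orthogonal:
  fixes M :: "'a::complex_hilbert set"
  assumes "closed M" "0 \<in> M" and add: "\<And>x y. x \<in> M \<Longrightarrow> y \<in> M \<Longrightarrow> x + y \<in> M"
    and scale: "\<And>c x. x \<in> M \<Longrightarrow> c *\<^sub>C x \<in> M" and "b \<notin> M"
  obtains y where "y \<noteq> 0" "\<And>x. x \<in> M \<Longrightarrow> cinner x y = 0"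
proof -
  define d where "d = (INF x\<in>M. (norm (b - x))\<^sup>2)"
  have bdd: "bdd_below ((\<lambda>x. (norm (b - x))\<^sup>2) ` M)" by (intro bdd_belowI[of _ 0]) auto
  have d_le: "d \<le> (norm (b - x))\<^sup>2" if "x \<in> M" for x
    unfolding d_def using bdd that by (rule cINF_lower)
  have "\<exists>x\<in>M. (norm (b - x))\<^sup>2 < d + 1 / real (Suc n)" for n
  proof -
    have "Inf ((\<lambda>x. (norm (b - x))\<^sup>2) ` M) < d + 1 / real (Suc n)" by (simp add: d_def)
    then show ?thesis using \<open>0 \<in> M\<close> bdd by (subst (asm) cInf_less_iff) auto
  qed
  then obtain x where xM: "\<And>n. x n \<in> M"
    and x: "\<And>n. (norm (b - x n))\<^sup>2 < d + 1 / real (Suc n)" by metis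
  have minus: "- u \<in> M" if "u \<in> M" for u using scale[OF that, of "-1"] by (simp add: scaleC_minus_one)
  have cau: "(norm (x m - x n))\<^sup>2 \<le> 2 / real (Suc m) + 2 / real (Suc n)" for m n
  proof -
    \<comment> \<open>The midpoint stays in \<open>M\<close>, so its squared distance from b is at
      least d. This bounds the term that the parallelogram law subtracts.\<close>
    define h where "h = complex_of_real (1/2) *\<^sub>C (x m + x n)"
    have "h \<in> M" using xM add scale by (simp add: h_def)
    have h: "(b - x m) + (b - x n) = 2 *\<^sub>R (b - h)"
      unfolding h_def scaleC_of_real by (simp add: scaleR_right_distrib scaleR_right_diff_distrib scaleR_2)
    have "(norm (x m - x n))\<^sup>2 = 2 * (norm (b - x m))\<^sup>2 + 2 * (norm (b - x n))\<^sup>2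
        - (norm ((b - x m) + (b - x n)))\<^sup>2"
      using norm_add_sq[of "b - x m" "b - x n"] norm_diff_sq[of "b - x m" "b - x n"]
      by (simp add: norm_minus_commute)
    also have "\<dots> \<le> 2 * (norm (b - x m))\<^sup>2 + 2 * (norm (b - x n))\<^sup>2 - 4 * d"
      unfolding h using d_le[OF \<open>h \<in> M\<close>] by (simp add: power_mult_distrib)
    also have "\<dots> \<le> 2 / real (Suc m) + 2 / real (Suc n)" using x[of m] x[of n] by simp
    finally show ?thesis .
  qed
  have "Cauchy x"
  proof (rule CauchyI)
    fix e :: real assume "0 < e"
    obtain N where N: "4 / e\<^sup>2 < real N" using reals_Archimedean2 by blast
    show "\<exists>M. \<forall>m\<ge>M. \<forall>n\<ge>M. norm (x m - x n) < e"
    proof (intro exI allI impI)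
      fix m n assume "N \<le> m" "N \<le> n"
      have N0: "0 < real N" using N \<open>0 < e\<close> by (smt (verit) divide_nonneg_nonneg zero_le_power2)
      have "2 / real (Suc m) + 2 / real (Suc n) \<le> 2 / real N + 2 / real N"
        using \<open>N \<le> m\<close> \<open>N \<le> n\<close> N0 by (intro add_mono divide_left_mono) auto
      also have "\<dots> < e\<^sup>2" using N N0 \<open>0 < e\<close> by (simp add: field_simps)
      finally have "(norm (x m - x n))\<^sup>2 < e\<^sup>2" using cau[of m n] by simp
      then show "norm (x m - x n) < e" using \<open>0 < e\<close> by (simp add: power2_less_imp_less)
    qed
  qed
  then obtain p where p: "x \<longlonglongrightarrow> p" using Cauchy_convergent_iff convergent_def by blast
  then have "p \<in> M" using \<open>closed M\<close> xM closed_sequentially by blast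
  have "(\<lambda>n. (norm (b - x n))\<^sup>2) \<longlonglongrightarrow> (norm (b - p))\<^sup>2" using p by (intro tendsto_intros)
  moreover have "(\<lambda>n. d + 1 / real (Suc n)) \<longlonglongrightarrow> d + 0"
    by (intro tendsto_intros LIMSEQ_Suc[OF lim_1_over_n])
  ultimately have pd: "(norm (b - p))\<^sup>2 \<le> d"
    using x less_imp_le by (intro LIMSEQ_le[where X = "\<lambda>n. (norm (b - x n))\<^sup>2"
        and Y = "\<lambda>n. d + 1 / real (Suc n)"]) (auto intro: less_imp_le)
  have re: "Re (cinner u (b - p)) = 0" if "u \<in> M" for u
  proof (rule ccontr)
    assume ne: "Re (cinner u (b - p)) \<noteq> 0"
    have le: "0 \<le> - 2 * r * Re (cinner u (b - p)) + r\<^sup>2 * (norm u)\<^sup>2" for r :: real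
    proof -
      have "p + r *\<^sub>R u \<in> M" using \<open>p \<in> M\<close> that add scale by (metis scaleC_of_real)
      from order_trans[OF pd d_le[OF this]]
      have "(norm (b - p))\<^sup>2 \<le> (norm ((b - p) - r *\<^sub>R u))\<^sup>2"
        by (simp only: diff_diff_add)
      then show ?thesis
        by (simp add: norm_diff_sq[of "b - p"] cinner_scaleR_right Re_cinner_commute[of u]
            power_mult_distrib)
    qed
    have "u \<noteq> 0" using ne by auto
    \<comment> \<open>This r minimises the quadratic, whose minimum is negative unless the real part
      vanishes.\<close>
    from le[of "Re (cinner u (b - p)) / (norm u)\<^sup>2"] \<open>u \<noteq> 0\<close>
    have "0 \<le> - (Re (cinner u (b - p)))\<^sup>2 / (norm u)\<^sup>2"
      by (simp add: field_simps power2_eq_square)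
    with ne \<open>u \<noteq> 0\<close> show False by (simp add: divide_le_0_iff)
  qed
  \<comment> \<open>Applying the real statement to i u removes the imaginary part.\<close>
  have "cinner u (b - p) = 0" if "u \<in> M" for u
    using re[OF that] re[OF scale[OF that, of \<i>]] by (simp add: cinner_scaleC_left complex_eq_iff)
  moreover have "b - p \<noteq> 0" using \<open>b \<notin> M\<close> \<open>p \<in> M\<close> by auto
  ultimately show ?thesis using that by blast
qed

section \<open>Skew-adjoint and dissipative operators\<close>

lemma linear_operator_add:
  assumes "linear_operator S A" "x \<in> S" "y \<in> S"
  shows "x + y \<in> S" "A (x + y) = A x + A y"
  using assms by (auto simp: linear_operator_def)

lemma linear_operator_scaleC:
  assumes "linear_operator S A" "x \<in> S"
  shows "c *\<^sub>C x \<in> S" "A (c *\<^sub>C x) = c *\<^sub>C A x"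
  using assms by (auto simp: linear_operator_def)

lemma linear_operator_scaleR:
  assumes "linear_operator S A" "x \<in> S"
  shows "r *\<^sub>R x \<in> S" "A (r *\<^sub>R x) = r *\<^sub>R A x"
  using linear_operator_scaleC[OF assms, of "complex_of_real r"] by (simp_all add: scaleC_of_real)

lemma linear_operator_zero:
  assumes "linear_operator S A"
  shows "0 \<in> S" "A 0 = 0"
proof -
  show "0 \<in> S" using assms by (simp add: linear_operator_def)
  from linear_operator_scaleC(2)[OF assms this, of 0] show "A 0 = 0" by simp
qed

lemma linear_operator_diff:
  assumes "linear_operator S A" "x \<in> S" "y \<in> S"
  shows "x - y \<in> S" "A (x - y) = A x - A y"
proof -
  have y: "- y \<in> S" "A (- y) = - A y"
    using linear_operator_scaleR[OF assms(1,3), of "-1"] by simp_all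
  show "x - y \<in> S" "A (x - y) = A x - A y"
    using linear_operator_add[OF assms(1,2) y(1)] y(2) by simp_all
qed

lemma linear_operator_sum:
  assumes "linear_operator S A" "\<And>i. i \<in> I \<Longrightarrow> f i \<in> S"
  shows "sum f I \<in> S \<and> A (sum f I) = (\<Sum>i\<in>I. A (f i))"
  using assms(2)
  by (induction I rule: infinite_finite_induct)
    (auto simp: linear_operator_zero[OF assms(1)] linear_operator_add[OF assms(1)])

lemma linear_operator_combination:
  assumes A: "linear_operator S A" and f: "\<And>i. f i \<in> S"
  shows "(\<Sum>i\<in>I. a i *\<^sub>C f i) \<in> S" "A (\<Sum>i\<in>I. a i *\<^sub>C f i) = (\<Sum>i\<in>I. a i *\<^sub>C A (f i))"
proof -
  have "(\<Sum>i\<in>I. a i *\<^sub>C f i) \<in> S \<and> A (\<Sum>i\<in>I. a i *\<^sub>C f i) = (\<Sum>i\<in>I. A (a i *\<^sub>C f i))"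
    by (intro linear_operator_sum[OF A] linear_operator_scaleC(1)[OF A f])
  then show "(\<Sum>i\<in>I. a i *\<^sub>C f i) \<in> S" "A (\<Sum>i\<in>I. a i *\<^sub>C f i) = (\<Sum>i\<in>I. a i *\<^sub>C A (f i))"
    by (simp_all add: linear_operator_scaleC(2)[OF A f])
qed

text \<open>The fourth fact is the way to prove membership in the domain: test against S and read
  off the value. Closedness, surjectivity of the resolvent equation and commutation with integrals
  all come from it.\<close>

lemma skew_adjointD:
  assumes "skew_adjoint S A"
  shows "linear_operator S A" "closure S = UNIV"
    "\<And>x y. x \<in> S \<Longrightarrow> y \<in> S \<Longrightarrow> cinner (A x) y = - cinner x (A y)"
    "\<And>y w. (\<And>x. x \<in> S \<Longrightarrow> cinner (A x) y = cinner x w) \<Longrightarrow> y \<in> S \<and> A y = - w"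
proof -
  show "cinner (A x) y = - cinner x (A y)" if "x \<in> S" "y \<in> S" for x y
  proof -
    have "\<forall>x\<in>S. cinner (A x) y = cinner x (- A y)"
      using assms that(2) unfolding skew_adjoint_def by blast
    then show ?thesis using that(1) by simp
  qed
  show "y \<in> S \<and> A y = - w" if "\<And>x. x \<in> S \<Longrightarrow> cinner (A x) y = cinner x w" for y w
    using assms that unfolding skew_adjoint_def by (metis minus_minus)
qed (use assms in \<open>auto simp: skew_adjoint_def\<close>)

lemma skew_adjoint_Re_zero:
  assumes "skew_adjoint S A" "x \<in> S"
  shows "Re (cinner (A x) x) = 0"
  using skew_adjointD(3)[OF assms(1,2,2)] Re_cinner_commute[of "A x" x] by simp

text \<open>Adjoints are closed: the test identity against a fixed z in S passes to the
  limit.\<close>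

lemma skew_adjoint_closed:
  assumes A: "skew_adjoint S A" and "\<And>n. f n \<in> S" "f \<longlonglongrightarrow> x" "(\<lambda>n. A (f n)) \<longlonglongrightarrow> y"
  shows "x \<in> S \<and> A x = y"
proof -
  have "cinner (A z) x = cinner z (- y)" if "z \<in> S" for z
  proof (rule LIMSEQ_unique)
    show "(\<lambda>n. cinner (A z) (f n)) \<longlonglongrightarrow> cinner (A z) x" by (intro tendsto_intros assms)
    have "(\<lambda>n. cinner z (- A (f n))) \<longlonglongrightarrow> cinner z (- y)" by (intro tendsto_intros assms)
    then show "(\<lambda>n. cinner (A z) (f n)) \<longlonglongrightarrow> cinner z (- y)"
      using skew_adjointD(3)[OF A that assms(2)] by simp
  qed
  from skew_adjointD(4)[OF A this] show ?thesis by simp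
qed

text \<open>The range of l - A is closed because \<open>Re l * norm x\<close> is at most the norm of
  the image. If it were not everything, a nonzero vector orthogonal to it would be an eigenvector of
  A for - \<open>cnj l\<close>, which is impossible since the quadratic form of A has no real
  part.\<close>

lemma skew_adjoint_surj:
  assumes A: "skew_adjoint S A" and l: "0 < Re l"
  obtains x where "x \<in> S" "l *\<^sub>C x - A x = f"
proof -
  note lin = skew_adjointD(1)[OF A]
  define M where "M = {l *\<^sub>C x - A x | x. x \<in> S}"
  have bnd: "Re l * norm x \<le> norm (l *\<^sub>C x - A x)" if "x \<in> S" for x
  proof (cases "x = 0")
    case False
    have "Re l * (norm x)\<^sup>2 = Re (cinner (l *\<^sub>C x - A x) x)"
      using skew_adjoint_Re_zero[OF A that]
      by (simp add: cinner_diff_left cinner_scaleC_left cinner_self)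
    also have "\<dots> \<le> norm (l *\<^sub>C x - A x) * norm x" by (rule Re_cinner_le)
    finally show ?thesis using False by (simp add: power2_eq_square)
  qed simp
  have "closed M"
    unfolding closed_sequential_limits
  proof (intro allI impI, elim conjE)
    fix g y assume g: "\<forall>n. g n \<in> M" and lim: "g \<longlonglongrightarrow> y"
    obtain x where x: "\<And>n. x n \<in> S" "\<And>n. g n = l *\<^sub>C x n - A (x n)"
      using g unfolding M_def by simp metis
    have xd: "Re l * norm (x m - x n) \<le> norm (g m - g n)" for m n
    proof -
      have "g m - g n = l *\<^sub>C (x m - x n) - A (x m - x n)"
        by (simp add: x linear_operator_diff[OF lin] scaleC_diff_right algebra_simps)
      then show ?thesis using bnd linear_operator_diff(1)[OF lin x(1) x(1)] by simp
    qed
    have "Cauchy x"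
    proof (rule CauchyI)
      fix e :: real assume "0 < e"
      then obtain N where N: "\<And>m n. m \<ge> N \<Longrightarrow> n \<ge> N \<Longrightarrow> norm (g m - g n) < Re l * e"
        using LIMSEQ_imp_Cauchy[OF lim] l unfolding Cauchy_iff by (metis mult_pos_pos)
      show "\<exists>M. \<forall>m\<ge>M. \<forall>n\<ge>M. norm (x m - x n) < e"
        using N xd l by (intro exI[of _ N]) (metis le_less_trans mult_less_cancel_left_pos)
    qed
    then obtain p where p: "x \<longlonglongrightarrow> p" using Cauchy_convergent_iff convergent_def by blast
    have "(\<lambda>n. l *\<^sub>C x n - g n) \<longlonglongrightarrow> l *\<^sub>C p - y"
      by (intro tendsto_intros lim bounded_bilinear.tendsto[OF bounded_bilinear_scaleC] p)
    then have "(\<lambda>n. A (x n)) \<longlonglongrightarrow> l *\<^sub>C p - y" by (simp add: x)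
    from skew_adjoint_closed[OF A x(1) p this] show "y \<in> M" unfolding M_def by force
  qed
  have "f \<in> M"
  proof (rule ccontr)
    assume "f \<notin> M"
    have zero: "0 \<in> M"
      using linear_operator_zero[OF lin] unfolding M_def by (auto intro!: exI[of _ 0])
    have add: "u + v \<in> M" if uv: "u \<in> M" "v \<in> M" for u v
    proof -
      obtain x y where "x \<in> S" "u = l *\<^sub>C x - A x" "y \<in> S" "v = l *\<^sub>C y - A y"
        using uv unfolding M_def by blast
      then show ?thesis using linear_operator_add[OF lin, of x y]
        unfolding M_def by (auto intro!: exI[of _ "x + y"] simp: scaleC_add_right)
    qed
    have scale: "c *\<^sub>C u \<in> M" if u: "u \<in> M" for c u
    proof -
      obtain x where "x \<in> S" "u = l *\<^sub>C x - A x" using u unfolding M_def by blast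
      then show ?thesis using linear_operator_scaleC[OF lin, of x c]
        unfolding M_def
        by (auto intro!: exI[of _ "c *\<^sub>C x"] simp: scaleC_diff_right scaleC_scaleC mult.commute)
    qed
    obtain y where y: "y \<noteq> 0" "\<And>x. x \<in> M \<Longrightarrow> cinner x y = 0"
      using exists_orthogonal[OF \<open>closed M\<close> zero add scale \<open>f \<notin> M\<close>] by metis
    have "cinner (A x) y = cinner x (cnj l *\<^sub>C y)" if "x \<in> S" for x
    proof -
      have "cinner (l *\<^sub>C x - A x) y = 0" using y(2) that unfolding M_def by blast
      then show ?thesis by (simp add: cinner_diff_left cinner_scaleC_left cinner_scaleC_right)
    qed
    from skew_adjointD(4)[OF A this] have "y \<in> S" "A y = - (cnj l *\<^sub>C y)" by auto
    with skew_adjoint_Re_zero[OF A, of y] have "Re l * (norm y)\<^sup>2 = 0"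
      by (simp add: cinner_scaleC_left cinner_self)
    then show False using l y(1) by simp
  qed
  then show ?thesis using that unfolding M_def by blast
qed

text \<open>No Riemann sums are needed: the adjoint description of the domain reduces the claim to
  integrals of scalar functions.\<close>

lemma skew_adjoint_integral:
  fixes f :: "real \<Rightarrow> 'a::complex_hilbert"
  assumes A: "skew_adjoint S A" and f: "continuous_on {a..b} f" "\<And>t. t \<in> {a..b} \<Longrightarrow> f t \<in> S"
    and Af: "continuous_on {a..b} (\<lambda>t. A (f t))"
  shows "integral {a..b} f \<in> S \<and> A (integral {a..b} f) = integral {a..b} (\<lambda>t. A (f t))"
proof -
  have lin: "cinner x (integral {a..b} g) = integral {a..b} (\<lambda>t. cinner x (g t))"
    if "continuous_on {a..b} g" for g and x :: 'a
    using integral_linear[OF integrable_continuous_real[OF that]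
        bounded_bilinear.bounded_linear_right[OF bounded_bilinear_cinner], of x]
    by (simp add: o_def)
  have "cinner (A x) (integral {a..b} f) = cinner x (- integral {a..b} (\<lambda>t. A (f t)))"
    if "x \<in> S" for x
  proof -
    have "cinner (A x) (integral {a..b} f) = integral {a..b} (\<lambda>t. cinner (A x) (f t))"
      by (rule lin[OF f(1)])
    also have "\<dots> = integral {a..b} (\<lambda>t. - cinner x (A (f t)))"
      using skew_adjointD(3)[OF A that f(2)] by (intro integral_cong) simp
    finally show ?thesis by (simp add: lin[OF Af])
  qed
  from skew_adjointD(4)[OF A this] show ?thesis by simp
qed

text \<open>The closed graph theorem for \<open>C (1 - A)\<^sup>-\<^sup>1\<close>: the sets where this everywhere defined operator is
  bounded by \<open>n\<close> are closed because \<open>C\<close> is skew-adjoint.\<close>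

lemma m_dissipative_relative_bound:
  fixes A C :: "'a::complex_hilbert \<Rightarrow> 'a"
  assumes A: "m_dissipative S A" and C: "skew_adjoint S' C" and sub: "S \<subseteq> S'"
  obtains K where "0 \<le> K" "\<And>x. x \<in> S \<Longrightarrow> norm (C x) \<le> K * (norm x + norm (A x))"
proof -
  have lin: "linear_operator S A" and diss: "\<And>x. x \<in> S \<Longrightarrow> Re (cinner (A x) x) \<le> 0"
    and surj: "\<And>f. \<exists>x\<in>S. x - A x = f"
    using A by (auto simp: m_dissipative_def)
  note linC = skew_adjointD(1)[OF C]
  have bnd: "norm x \<le> norm (x - A x)" if "x \<in> S" for x
  proof (cases "x = 0")
    case False
    have "(norm x)\<^sup>2 \<le> Re (cinner (x - A x) x)"
      using diss[OF that] by (simp add: cinner_diff_left cinner_self)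
    also have "\<dots> \<le> norm (x - A x) * norm x" by (rule Re_cinner_le)
    finally show ?thesis using False by (simp add: power2_eq_square)
  qed simp
  obtain R where R: "\<And>f. R f \<in> S" "\<And>f. R f - A (R f) = f" using surj by metis
  have inj: "x = y" if "x \<in> S" "y \<in> S" "x - A x = y - A y" for x y
  proof -
    have "(x - y) - A (x - y) = (x - A x) - (y - A y)"
      by (simp add: linear_operator_diff(2)[OF lin that(1,2)])
    then show ?thesis using bnd[OF linear_operator_diff(1)[OF lin that(1,2)]] that(3) by simp
  qed
  have Rdiff: "R (f - g) = R f - R g" for f g
  proof (rule inj)
    have "(R f - R g) - A (R f - R g) = (R f - A (R f)) - (R g - A (R g))"
      by (simp add: linear_operator_diff(2)[OF lin R(1) R(1)])
    then show "R (f - g) - A (R (f - g)) = R f - R g - A (R f - R g)" by (simp add: R(2))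
  qed (simp_all add: R(1) linear_operator_diff(1)[OF lin])
  have Rscale: "R (r *\<^sub>R f) = r *\<^sub>R R f" for r f
  proof (rule inj)
    have "r *\<^sub>R R f - A (r *\<^sub>R R f) = r *\<^sub>R (R f - A (R f))"
      by (simp only: linear_operator_scaleR(2)[OF lin R(1)] scaleR_right_diff_distrib)
    then show "R (r *\<^sub>R f) - A (R (r *\<^sub>R f)) = r *\<^sub>R R f - A (r *\<^sub>R R f)" by (simp only: R(2))
  qed (simp_all add: R(1) linear_operator_scaleR(1)[OF lin])
  have "1-lipschitz_on UNIV R"
  proof (rule lipschitz_onI)
    fix f g
    have "norm (R (f - g)) \<le> norm (R (f - g) - A (R (f - g)))" by (rule bnd[OF R(1)])
    then show "dist (R f) (R g) \<le> 1 * dist f g" by (simp only: R(2)) (simp add: Rdiff dist_norm)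
  qed simp
  then have contR: "continuous_on UNIV R" by (rule lipschitz_on_continuous_on)
  define F where "F n = {f. norm (C (R f)) \<le> real n}" for n
  \<comment> \<open>Moving C onto the test vector leaves only \<open>R f\<close>, which is
    continuous in f. This is what makes the sets closed.\<close>
  have F_eq: "F n = (\<Inter>\<phi>\<in>S'. {f. cmod (cinner (R f) (C \<phi>)) \<le> real n * norm \<phi>})" for n
  proof -
    have "f \<in> F n \<longleftrightarrow> (\<forall>\<phi>\<in>S'. cmod (cinner (R f) (C \<phi>)) \<le> real n * norm \<phi>)" for f
    proof -
      have eq: "cmod (cinner (R f) (C \<phi>)) = cmod (cinner (C (R f)) \<phi>)" if "\<phi> \<in> S'" for \<phi>
        using skew_adjointD(3)[OF C _ that] R(1) sub by (simp add: subset_iff)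
      have "cmod (cinner (C (R f)) \<phi>) \<le> real n * norm \<phi>" if "norm (C (R f)) \<le> real n" for \<phi>
        using norm_cinner_le mult_right_mono[OF that norm_ge_zero] by (rule order_trans)
      then show ?thesis
        using norm_le_dense[OF skew_adjointD(2)[OF C], of "C (R f)" "real n"] eq
        by (auto simp: F_def)
    qed
    then show ?thesis by blast
  qed
  have closedF: "closed (F n)" for n
    unfolding F_eq
    by (intro closed_INT ballI closed_Collect_le continuous_intros contR)
  have "\<exists>n. interior (F n) \<noteq> {}"
  proof (rule ccontr)
    assume "\<not> ?thesis"
    then have "euclidean interior_of (\<Union>(range F)) = {}"
      using closedF by (intro Baire_category_alt)
        (auto simp: completely_metrizable_space_euclidean simp flip: closed_closedin)
    moreover have "\<Union>(range F) = UNIV"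
      unfolding F_def using real_arch_simple by auto
    ultimately show False by simp
  qed
  then obtain n f0 where "f0 \<in> interior (F n)" by blast
  then obtain r where r: "0 < r" "ball f0 r \<subseteq> F n" using mem_interior by blast
  \<comment> \<open>Both \<open>f0\<close> and \<open>f0 + g\<close> lie in \<open>F n\<close>;
    their difference moves the estimate from the ball around \<open>f0\<close> to a ball around 0 at
    the price of a factor 2.\<close>
  have small: "norm (C (R g)) \<le> 2 * real n" if "norm g < r" for g
  proof -
    have mem: "f0 + g \<in> F n" "f0 \<in> F n" using r that by (auto simp: subset_iff dist_norm)
    have "R g = R (f0 + g) - R f0" by (simp flip: Rdiff)
    then have "C (R g) = C (R (f0 + g)) - C (R f0)"
      using R(1) sub by (simp add: linear_operator_diff(2)[OF linC] subset_iff)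
    then show ?thesis
      using mem norm_triangle_ineq4[of "C (R (f0 + g))" "C (R f0)"] by (simp add: F_def)
  qed
  have CR: "norm (C (R g)) \<le> 4 * real n / r * norm g" for g
  proof (cases "g = 0")
    case True
    then show ?thesis using Rscale[of 0 0] by (simp add: linear_operator_zero[OF linC])
  next
    case False
    define s where "s = r / (2 * norm g)"
    have "0 < s" using False r by (simp add: s_def)
    have "norm (C (R (s *\<^sub>R g))) \<le> 2 * real n"
      using False r by (intro small) (simp add: s_def)
    then have "s * norm (C (R g)) \<le> 2 * real n"
      using \<open>0 < s\<close> R(1)[of g] sub by (simp add: Rscale linear_operator_scaleR[OF linC] subset_iff)
    then show ?thesis using False r by (simp add: s_def field_simps)
  qed
  show ?thesis
  proof (rule that)
    show "0 \<le> 4 * real n / r" using r by simp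
    fix x assume "x \<in> S"
    have "R (x - A x) = x" by (rule inj[OF R(1) \<open>x \<in> S\<close> R(2)])
    with CR[of "x - A x"] have "norm (C x) \<le> 4 * real n / r * norm (x - A x)" by simp
    also have "\<dots> \<le> 4 * real n / r * (norm x + norm (A x))"
      using r by (intro mult_left_mono norm_triangle_ineq4) simp
    finally show "norm (C x) \<le> 4 * real n / r * (norm x + norm (A x))" .
  qed
qed

section \<open>Growth estimates\<close>

lemma nonincreasing_of_deriv_within:
  fixes f :: "real \<Rightarrow> real"
  assumes "a \<le> b" and deriv: "\<And>t. t \<in> {a..b} \<Longrightarrow> (f has_real_derivative f' t) (at t within {a..b})"
    and "\<And>t. t \<in> {a..b} \<Longrightarrow> f' t \<le> 0"
  shows "f b \<le> f a"
proof (rule DERIV_nonpos_imp_decreasing_open[OF \<open>a \<le> b\<close>])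
  show "continuous_on {a..b} f"
    using deriv by (meson DERIV_continuous_on)
  fix t assume "a < t" "t < b"
  with deriv[of t] have "(f has_real_derivative f' t) (at t)" by (simp add: at_within_Icc_at)
  with \<open>a < t\<close> \<open>t < b\<close> assms(3) show "\<exists>y. DERIV f t :> y \<and> y \<le> 0" by (intro exI[of _ "f' t"]) auto
qed

lemma has_real_derivative_norm_sq:
  fixes d :: "real \<Rightarrow> 'a::complex_inner"
  assumes "(d has_vector_derivative d') (at t within X)"
  shows "((\<lambda>t. (norm (d t))\<^sup>2) has_real_derivative 2 * Re (cinner d' (d t))) (at t within X)"
proof -
  have "((\<lambda>t. Re (cinner (d t) (d t))) has_vector_derivative
      Re (cinner (d t) d') + Re (cinner d' (d t))) (at t within X)"
    by (rule bounded_bilinear.has_vector_derivative[OF bounded_bilinear_Re_cinner assms assms])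
  then show ?thesis
    using Re_cinner_commute[of d' "d t"]
    by (simp add: Re_cinner_self has_real_derivative_iff_has_vector_derivative)
qed

text \<open>The norm is not differentiable at 0, hence the regularisation
  \<open>sqrt ((norm (d t))\<^sup>2 + e\<^sup>2)\<close>, which costs e. The growth is additive,
  without the exponential factor of a Gronwall estimate. This matters below, where the growth over a
  period must lose against exp (\<beta> L).\<close>

lemma norm_growth_le:
  fixes d :: "real \<Rightarrow> 'a::complex_inner"
  assumes "a \<le> b"
    and d: "\<And>t. t \<in> {a..b} \<Longrightarrow> (d has_vector_derivative d' t) (at t within {a..b})"
    and \<beta>: "\<And>t. t \<in> {a..b} \<Longrightarrow> (\<beta> has_real_derivative \<beta>' t) (at t within {a..b})"
    and nonneg: "\<And>t. t \<in> {a..b} \<Longrightarrow> 0 \<le> \<beta>' t"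
    and le: "\<And>t. t \<in> {a..b} \<Longrightarrow> Re (cinner (d' t) (d t)) \<le> \<beta>' t * norm (d t)"
  shows "norm (d b) \<le> norm (d a) + (\<beta> b - \<beta> a)"
proof (rule field_le_epsilon)
  fix e :: real assume "0 < e"
  define f where "f t = sqrt ((norm (d t))\<^sup>2 + e\<^sup>2) - \<beta> t" for t
  have pos: "0 < (norm (d t))\<^sup>2 + e\<^sup>2" for t using \<open>0 < e\<close> by (simp add: add_nonneg_pos)
  have "f b \<le> f a"
  proof (rule nonincreasing_of_deriv_within[OF \<open>a \<le> b\<close>])
    fix t assume t: "t \<in> {a..b}"
    have "((\<lambda>t. (norm (d t))\<^sup>2 + e\<^sup>2) has_real_derivative 2 * Re (cinner (d' t) (d t)))
        (at t within {a..b})"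
      using DERIV_add[OF has_real_derivative_norm_sq[OF d[OF t]] DERIV_const[of "e\<^sup>2"]] by simp
    from DERIV_diff[OF DERIV_chain'[OF this DERIV_real_sqrt[OF pos]] \<beta>[OF t]]
    show "(f has_real_derivative
        Re (cinner (d' t) (d t)) / sqrt ((norm (d t))\<^sup>2 + e\<^sup>2) - \<beta>' t) (at t within {a..b})"
      unfolding f_def by (rule DERIV_cong) (simp add: field_simps)
    have "Re (cinner (d' t) (d t)) \<le> \<beta>' t * norm (d t)" by (rule le[OF t])
    also have "\<dots> \<le> \<beta>' t * sqrt ((norm (d t))\<^sup>2 + e\<^sup>2)"
      using nonneg[OF t] by (intro mult_left_mono) (simp_all add: real_le_rsqrt)
    finally show "Re (cinner (d' t) (d t)) / sqrt ((norm (d t))\<^sup>2 + e\<^sup>2) - \<beta>' t \<le> 0"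
      using pos[of t] by (simp add: pos_divide_le_eq)
  qed
  moreover have "norm (d b) \<le> sqrt ((norm (d b))\<^sup>2 + e\<^sup>2)" by (simp add: real_le_rsqrt)
  moreover have "sqrt ((norm (d a))\<^sup>2 + e\<^sup>2) \<le> norm (d a) + e"
    using sqrt_add_le_add_sqrt[of "(norm (d a))\<^sup>2" "e\<^sup>2"] \<open>0 < e\<close> by simp
  ultimately show "norm (d b) \<le> norm (d a) + (\<beta> b - \<beta> a) + e"
    unfolding f_def by linarith
qed

section \<open>Trigonometric polynomials\<close>

lemma sum_cis_roots_of_unity:
  assumes "0 < N" "\<bar>k\<bar> < int N"
  shows "(\<Sum>j<N. cis (2 * pi * k * real j / real N)) = (if k = 0 then of_nat N else 0)"
proof (cases "k = 0")
  case False
  define z where "z = cis (2 * pi * k / real N)"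
  have pow: "cis (2 * pi * k * real j / real N) = z ^ j" for j
    by (simp add: z_def Complex.DeMoivre mult_ac)
  have "z ^ N = cis (2 * pi * k)" using \<open>0 < N\<close> by (simp flip: pow)
  also have "\<dots> = 1" by (simp add: cis_multiple_2pi)
  finally have zN: "z ^ N = 1" .
  \<comment> \<open>Otherwise N would divide k, which is impossible for 0 < |k| < N. The geometric
    sum then vanishes.\<close>
  have "z \<noteq> 1"
  proof
    assume "z = 1"
    then have "cos (2 * pi * k / real N) = 1" by (simp add: z_def complex_eq_iff)
    then obtain i :: int where "2 * pi * k / real N = real_of_int i * 2 * pi" using cos_one_2pi_int by blast
    then have "real_of_int k = real_of_int (i * int N)" using \<open>0 < N\<close> by (simp add: field_simps)
    then have "k = i * int N" by (simp only: of_int_eq_iff)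
    then have "int N dvd k" by simp
    then show False using assms(2) False zdvd_not_zless[of "\<bar>k\<bar>" "int N"] by simp
  qed
  moreover have "(1 - z) * (\<Sum>j<N. z ^ j) = 0" using one_diff_power_eq[of z N] zN by simp
  ultimately show ?thesis using False by (simp add: pow)
qed simp

text \<open>The squared modulus makes the kernel nonnegative. The normalisation by the square of N
  is the discrete one: the values at N equally spaced shifts add up to 1.\<close>

definition fejer_kernel :: "nat \<Rightarrow> real \<Rightarrow> real"
  where "fejer_kernel N x = (cmod (\<Sum>m<N. cis (real m * x)))\<^sup>2 / (real N)\<^sup>2"

lemma fejer_kernel_nonneg: "0 \<le> fejer_kernel N x"
  by (simp add: fejer_kernel_def)

lemma fejer_kernel_expand:
  fixes x :: real
  shows "complex_of_real (fejer_kernel N x)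
    = (\<Sum>(m, k)\<in>{..<N} \<times> {..<N}. cis ((real m - real k) * x)) / (of_nat N)\<^sup>2"
proof -
  have "complex_of_real ((cmod (\<Sum>m<N. cis (real m * x)))\<^sup>2)
      = (\<Sum>m<N. cis (real m * x)) * (\<Sum>k<N. cis (- (real k * x)))"
    by (simp only: complex_norm_square cnj_sum cis_cnj)
  also have "\<dots> = (\<Sum>m<N. \<Sum>k<N. cis ((real m - real k) * x))"
    by (simp add: sum_product cis_mult left_diff_distrib)
  finally show ?thesis by (simp add: fejer_kernel_def sum.cartesian_product)
qed

text \<open>Expand into pairs of frequencies. Summing over the nodes annihilates every pair with
  different entries, and each of the N equal pairs contributes N.\<close>

lemma sum_fejer_kernel:
  assumes "0 < N"
  shows "(\<Sum>j<N. fejer_kernel N (x - 2 * pi * real j / real N)) = 1"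
proof -
  have "complex_of_real (\<Sum>j<N. fejer_kernel N (x - 2 * pi * real j / real N))
      = (\<Sum>j<N. \<Sum>(m, k)\<in>{..<N} \<times> {..<N}.
          cis ((real m - real k) * x) * cis (2 * pi * (real k - real m) * real j / real N)) / (of_nat N)\<^sup>2"
  proof -
    have "cis ((real m - real k) * (x - 2 * pi * real j / real N))
        = cis ((real m - real k) * x) * cis (2 * pi * (real k - real m) * real j / real N)" for m k j
      unfolding cis_mult using \<open>0 < N\<close> by (intro arg_cong[where f = cis]) (simp add: field_simps)
    then show ?thesis by (simp only: of_real_sum fejer_kernel_expand sum_divide_distrib)
  qed
  also have "\<dots> = (\<Sum>(m, k)\<in>{..<N} \<times> {..<N}.
      cis ((real m - real k) * x) * (\<Sum>j<N. cis (2 * pi * (real k - real m) * real j / real N))) / (of_nat N)\<^sup>2"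
    by (subst sum.swap) (simp add: sum_distrib_left case_prod_unfold)
  also have "\<dots> = (\<Sum>(m, k)\<in>{..<N} \<times> {..<N}. if m = k then of_nat N else 0) / (of_nat N)\<^sup>2"
  proof -
    have eq: "cis ((real m - real k) * x) * (\<Sum>j<N. cis (2 * pi * (real k - real m) * real j / real N))
        = (if m = k then of_nat N else 0)" if "m < N" "k < N" for m k
      using sum_cis_roots_of_unity[OF \<open>0 < N\<close>, of "int k - int m"] that by auto
    have "(\<Sum>(m, k)\<in>{..<N} \<times> {..<N}.
        cis ((real m - real k) * x) * (\<Sum>j<N. cis (2 * pi * (real k - real m) * real j / real N)))
      = (\<Sum>(m, k)\<in>{..<N} \<times> {..<N}. if m = k then of_nat N else 0)"
      by (rule sum.cong) (auto simp only: eq lessThan_iff mem_Sigma_iff prod.case split_paired_all)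
    then show ?thesis by (rule arg_cong)
  qed
  also have "\<dots> = 1"
    using \<open>0 < N\<close> by (simp add: power2_eq_square flip: sum.cartesian_product)
  finally show ?thesis by (simp only: of_real_eq_1_iff)
qed

text \<open>The sum is geometric, and |1 - z| times a geometric sum with |z| = 1 is at most
  2.\<close>

lemma fejer_kernel_le:
  assumes "0 < \<rho>" "\<rho> \<le> cmod (1 - cis x)"
  shows "fejer_kernel N x \<le> 4 / ((real N)\<^sup>2 * \<rho>\<^sup>2)"
proof -
  define S where "S = (\<Sum>m<N. cis (real m * x))"
  have "S = (\<Sum>m<N. cis x ^ m)" by (simp add: S_def Complex.DeMoivre)
  then have "cmod (1 - cis x) * cmod S = cmod (1 - cis x ^ N)"
    using one_diff_power_eq[of "cis x" N] by (simp flip: norm_mult)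
  also have "\<dots> \<le> cmod 1 + cmod (cis x ^ N)" by (rule norm_triangle_ineq4)
  finally have "cmod (1 - cis x) * cmod S \<le> 2" by (simp add: norm_power)
  then have "\<rho> * cmod S \<le> 2"
    using mult_right_mono[OF assms(2), of "cmod S"] by simp
  then have "(\<rho> * cmod S)\<^sup>2 \<le> 2\<^sup>2" using assms(1) by (intro power_mono) simp_all
  then have "(cmod S)\<^sup>2 \<le> 4 / \<rho>\<^sup>2" using assms(1) by (simp add: field_simps power_mult_distrib)
  then have "(cmod S)\<^sup>2 / (real N)\<^sup>2 \<le> 4 / \<rho>\<^sup>2 / (real N)\<^sup>2" by (rule divide_right_mono) simp
  then show ?thesis by (simp add: fejer_kernel_def S_def mult.commute)
qed

text \<open>Uniform continuity on the circle of length L, measured by the chord so that 0 and L are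
  not separated. The pairs with distant values form a compact set on which the chord length is
  positive; its minimum is the required \<rho>.\<close>

lemma circle_uniformly_continuous:
  fixes f :: "real \<Rightarrow> 'a::metric_space"
  assumes "0 < L" "continuous_on {0..L} f" "f 0 = f L" "0 < e"
  obtains \<rho> where "0 < \<rho>" "\<And>s t. s \<in> {0..L} \<Longrightarrow> t \<in> {0..L} \<Longrightarrow>
    cmod (1 - cis (2 * pi * (t - s) / L)) < \<rho> \<Longrightarrow> dist (f s) (f t) < e"
proof -
  let ?g = "\<lambda>z. cmod (1 - cis (2 * pi * (snd z - fst z) / L))"
  define Q where "Q = {z \<in> {0..L} \<times> {0..L}. e \<le> dist (f (fst z)) (f (snd z))}"
  have cont: "continuous_on ({0..L} \<times> {0..L}) (\<lambda>z. dist (f (fst z)) (f (snd z)))"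
    by (intro continuous_intros continuous_on_compose2[OF assms(2)]) auto
  have "closed Q"
    unfolding Q_def
    by (intro continuous_closed_preimage_constant closed_Times cont
      continuous_on_closed_Collect_le[OF continuous_on_const cont]) auto
  moreover have sub: "Q \<subseteq> {0..L} \<times> {0..L}" by (auto simp: Q_def)
  ultimately have "compact Q"
    using compact_Times[of "{0..L}" "{0..L}"] compact_Int_closed[of "{0..L} \<times> {0..L}" Q]
    by (simp add: Int_absorb1)
  have pos: "0 < ?g z" if "z \<in> Q" for z
  proof (rule ccontr)
    assume "\<not> 0 < ?g z"
    then have "cos (2 * pi * (snd z - fst z) / L) = 1" by (simp add: complex_eq_iff)
    then obtain i :: int where "2 * pi * (snd z - fst z) / L = real_of_int i * 2 * pi"
      using cos_one_2pi_int by blast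
    then have "(2 * pi) * ((snd z - fst z) / L) = (2 * pi) * real_of_int i" by (simp add: mult_ac)
    then have "(snd z - fst z) / L = real_of_int i" by (simp only: mult_cancel_left) simp
    then have i: "snd z - fst z = real_of_int i * L" using \<open>0 < L\<close> by (simp add: field_simps)
    have z: "fst z \<in> {0..L}" "snd z \<in> {0..L}" using sub that by auto
    then have "real_of_int i * L \<le> 1 * L" "(-1) * L \<le> real_of_int i * L" using i by simp_all
    then have "i \<le> 1" "-1 \<le> i"
      using \<open>0 < L\<close> by (simp_all only: mult_le_cancel_right_pos)
    \<comment> \<open>The cases i = 1 and i = -1 force the two points to be the endpoints 0 and L,
      where f takes the same value.\<close>
    then consider "i = 0" | "i = 1" | "i = -1" by linarith
    then have "f (fst z) = f (snd z)" using i z assms(3) by cases (auto dest: antisym)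
    then show False using that \<open>0 < e\<close> by (simp add: Q_def)
  qed
  show ?thesis
  proof (cases "Q = {}")
    case True
    then show ?thesis using that[of 1] by (force simp: Q_def)
  next
    case False
    have "continuous_on Q ?g"
      unfolding cis_conv_exp by (intro continuous_intros) (use \<open>0 < L\<close> in auto)
    from continuous_attains_inf[OF \<open>compact Q\<close> False this]
    obtain z where z: "z \<in> Q" "\<And>w. w \<in> Q \<Longrightarrow> ?g z \<le> ?g w" by blast
    show ?thesis
    proof (rule that[OF pos[OF z(1)]])
      fix s t assume "s \<in> {0..L}" "t \<in> {0..L}" "cmod (1 - cis (2 * pi * (t - s) / L)) < ?g z"
      then show "dist (f s) (f t) < e" using z(2)[of "(s, t)"] by (force simp: Q_def)
    qed
  qed
qed

text \<open>Interpolation by the Fejer kernel at the nodes \<open>j L / N\<close>: the weights are nonnegative and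
  sum up to 1, and only those of nearby nodes matter.\<close>

lemma trigonometric_approximation:
  fixes f :: "real \<Rightarrow> 'a::complex_normed_vector"
  assumes "0 < L" and f: "continuous_on {0..L} f" "f 0 = f L" and "0 < \<epsilon>"
    and G: "0 \<in> G" "\<And>x y. x \<in> G \<Longrightarrow> y \<in> G \<Longrightarrow> x + y \<in> G" "\<And>c x. x \<in> G \<Longrightarrow> c *\<^sub>C x \<in> G"
    and fG: "\<And>t. t \<in> {0..L} \<Longrightarrow> f t \<in> G"
  obtains I :: "int set" and c where "finite I" "\<And>n. c n \<in> G"
    "\<And>t. t \<in> {0..L} \<Longrightarrow> norm (f t - (\<Sum>n\<in>I. cis (2 * pi * n * t / L) *\<^sub>C c n)) \<le> \<epsilon>"
proof -
  obtain \<rho> where \<rho>: "0 < \<rho>" "\<And>s t. s \<in> {0..L} \<Longrightarrow> t \<in> {0..L} \<Longrightarrow>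
    cmod (1 - cis (2 * pi * (t - s) / L)) < \<rho> \<Longrightarrow> dist (f s) (f t) < \<epsilon> / 2"
    using circle_uniformly_continuous[OF \<open>0 < L\<close> f, of "\<epsilon> / 2"] \<open>0 < \<epsilon>\<close> by auto
  have "bounded (f ` {0..L})"
    using compact_continuous_image[OF f(1)] compact_imp_bounded by blast
  then obtain M where M: "0 < M" "\<And>t. t \<in> {0..L} \<Longrightarrow> norm (f t) \<le> M"
    unfolding bounded_pos by auto
  \<comment> \<open>Each of the at most N distant nodes contributes at most 8 M / (N\<rho>)^2. The
    choice of N makes their total at most \<epsilon> / 2.\<close>
  obtain N where N: "16 * M / (\<rho>\<^sup>2 * \<epsilon>) < real N" using reals_Archimedean2 by blast
  have "0 < 16 * M / (\<rho>\<^sup>2 * \<epsilon>)" using M(1) \<rho>(1) \<open>0 < \<epsilon>\<close> by simp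
  then have "0 < N" using N by linarith
  define \<tau> where "\<tau> j = j * L / N" for j :: nat
  have \<tau>: "\<tau> j \<in> {0..L}" if "j < N" for j
    using that \<open>0 < L\<close> by (simp add: \<tau>_def field_simps)
  define k where "k t j = fejer_kernel N (2 * pi * (t - \<tau> j) / L)" for t j
  have k_nonneg: "0 \<le> k t j" for t j by (simp add: k_def fejer_kernel_nonneg)
  have "2 * pi * (t - \<tau> j) / L = 2 * pi * t / L - 2 * pi * real j / real N" for t j
    using \<open>0 < L\<close> by (simp add: \<tau>_def diff_divide_distrib right_diff_distrib)
  then have k_sum: "(\<Sum>j<N. k t j) = 1" for t
    using sum_fejer_kernel[OF \<open>0 < N\<close>] by (simp add: k_def)
  have approx: "norm (f t - (\<Sum>j<N. k t j *\<^sub>R f (\<tau> j))) \<le> \<epsilon>" if t: "t \<in> {0..L}" for t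
  proof -
    have each: "k t j * norm (f t - f (\<tau> j)) \<le> k t j * (\<epsilon> / 2) + 8 * M / ((real N)\<^sup>2 * \<rho>\<^sup>2)"
      if "j < N" for j
    proof (cases "cmod (1 - cis (2 * pi * (t - \<tau> j) / L)) < \<rho>")
      case True
      from \<rho>(2)[OF \<tau>[OF that] t this] have "norm (f t - f (\<tau> j)) \<le> \<epsilon> / 2"
        by (simp add: dist_norm norm_minus_commute)
      then have "k t j * norm (f t - f (\<tau> j)) \<le> k t j * (\<epsilon> / 2)"
        using k_nonneg by (rule mult_left_mono)
      moreover have "0 \<le> 8 * M / ((real N)\<^sup>2 * \<rho>\<^sup>2)" using M(1) by simp
      ultimately show ?thesis by linarith
    next
      case False
      then have "k t j \<le> 4 / ((real N)\<^sup>2 * \<rho>\<^sup>2)"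
        unfolding k_def by (intro fejer_kernel_le \<rho>(1)) simp
      moreover have "norm (f t - f (\<tau> j)) \<le> 2 * M"
        using norm_triangle_ineq4[of "f t" "f (\<tau> j)"] M(2)[OF t] M(2)[OF \<tau>[OF that]] by simp
      ultimately have "k t j * norm (f t - f (\<tau> j)) \<le> 4 / ((real N)\<^sup>2 * \<rho>\<^sup>2) * (2 * M)"
        by (intro mult_mono) simp_all
      moreover have "0 \<le> k t j * (\<epsilon> / 2)" using k_nonneg \<open>0 < \<epsilon>\<close> by simp
      ultimately show ?thesis by simp
    qed
    have "f t - (\<Sum>j<N. k t j *\<^sub>R f (\<tau> j)) = (\<Sum>j<N. k t j *\<^sub>R (f t - f (\<tau> j)))"
      using k_sum[of t]
      by (simp add: scaleR_right_diff_distrib sum_subtractf flip: scaleR_sum_left)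
    also have "norm \<dots> \<le> (\<Sum>j<N. norm (k t j *\<^sub>R (f t - f (\<tau> j))))" by (rule norm_sum)
    also have "\<dots> \<le> (\<Sum>j<N. k t j * (\<epsilon> / 2) + 8 * M / ((real N)\<^sup>2 * \<rho>\<^sup>2))"
      using each k_nonneg by (intro sum_mono) simp
    also have "\<dots> = \<epsilon> / 2 + 8 * M / (real N * \<rho>\<^sup>2)"
      using \<open>0 < N\<close> unfolding sum.distrib sum_distrib_right[symmetric] k_sum
      by (simp add: power2_eq_square)
    also have "8 * M / (real N * \<rho>\<^sup>2) \<le> \<epsilon> / 2"
      using N \<open>0 < N\<close> \<rho>(1) \<open>0 < \<epsilon>\<close> by (simp add: field_simps)
    finally show ?thesis by simp
  qed
  define J where "J = {..<N} \<times> {..<N} \<times> {..<N}"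
  define I where "I = {- int N..int N}"
  \<comment> \<open>Collects the terms of frequency n = m - l of the expanded kernels. The
    coefficients are finite combinations of sampled values of f, so the algebraic closure properties
    of \<open>G\<close> suffice; Fourier integrals would also require closedness.\<close>
  define c where "c n = (\<Sum>(j, m, l)\<in>J. (if n = int m - int l
      then cis (- (2 * pi * n * \<tau> j / L)) / (of_nat N)\<^sup>2 else 0) *\<^sub>C f (\<tau> j))" for n
  have sumG: "(\<Sum>i\<in>A. h i) \<in> G" if "\<And>i. i \<in> A \<Longrightarrow> h i \<in> G" for A and h :: "nat \<times> nat \<times> nat \<Rightarrow> 'a"
    using that by (induction A rule: infinite_finite_induct) (auto simp: G)
  have cG: "c n \<in> G" for n
    unfolding c_def by (rule sumG) (auto simp: J_def intro!: G(3) fG \<tau>)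
  have "(\<Sum>n\<in>I. cis (2 * pi * n * t / L) *\<^sub>C c n) = (\<Sum>j<N. k t j *\<^sub>R f (\<tau> j))" for t
  proof -
    have trm: "(\<Sum>n\<in>I. cis (2 * pi * n * t / L) *\<^sub>C ((if n = int m - int l
          then cis (- (2 * pi * n * \<tau> j / L)) / (of_nat N)\<^sup>2 else 0) *\<^sub>C f (\<tau> j)))
        = (cis ((real m - real l) * (2 * pi * (t - \<tau> j) / L)) / (of_nat N)\<^sup>2) *\<^sub>C f (\<tau> j)"
      if "m < N" "l < N" for j m l
    proof -
      define n0 where "n0 = int m - int l"
      have "n0 \<in> I" using that by (auto simp: I_def n0_def)
      have "cis (2 * pi * n0 * t / L) * cis (- (2 * pi * n0 * \<tau> j / L))
          = cis (n0 * (2 * pi * (t - \<tau> j) / L))"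
        by (simp add: cis_mult algebra_simps diff_divide_distrib)
      then have eq: "cis (2 * pi * n0 * t / L) *\<^sub>C ((cis (- (2 * pi * n0 * \<tau> j / L)) / (of_nat N)\<^sup>2) *\<^sub>C f (\<tau> j))
          = (cis (n0 * (2 * pi * (t - \<tau> j) / L)) / (of_nat N)\<^sup>2) *\<^sub>C f (\<tau> j)"
        by (simp add: scaleC_scaleC)
      have "(\<Sum>n\<in>I. cis (2 * pi * n * t / L) *\<^sub>C ((if n = n0
          then cis (- (2 * pi * n * \<tau> j / L)) / (of_nat N)\<^sup>2 else 0) *\<^sub>C f (\<tau> j)))
        = (\<Sum>n\<in>I. if n = n0 then cis (2 * pi * n0 * t / L) *\<^sub>C
            ((cis (- (2 * pi * n0 * \<tau> j / L)) / (of_nat N)\<^sup>2) *\<^sub>C f (\<tau> j)) else 0)"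
        by (intro sum.cong) auto
      also have "\<dots> = (cis (n0 * (2 * pi * (t - \<tau> j) / L)) / (of_nat N)\<^sup>2) *\<^sub>C f (\<tau> j)"
        using \<open>n0 \<in> I\<close> by (simp add: I_def eq)
      finally show ?thesis by (simp add: n0_def)
    qed
    have "(\<Sum>n\<in>I. cis (2 * pi * n * t / L) *\<^sub>C c n)
        = (\<Sum>(j, m, l)\<in>J. \<Sum>n\<in>I. cis (2 * pi * n * t / L) *\<^sub>C ((if n = int m - int l
          then cis (- (2 * pi * n * \<tau> j / L)) / (of_nat N)\<^sup>2 else 0) *\<^sub>C f (\<tau> j)))"
      unfolding c_def scaleC_sum_right by (subst sum.swap) (simp add: case_prod_unfold)
    also have "\<dots> = (\<Sum>(j, m, l)\<in>J.
        (cis ((real m - real l) * (2 * pi * (t - \<tau> j) / L)) / (of_nat N)\<^sup>2) *\<^sub>C f (\<tau> j))"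
      by (intro sum.cong refl) (auto simp: J_def trm)
    also have "\<dots> = (\<Sum>j<N. complex_of_real (k t j) *\<^sub>C f (\<tau> j))"
      unfolding J_def k_def fejer_kernel_expand sum.cartesian_product[symmetric]
      by (simp add: sum_divide_distrib scaleC_sum_left sum.cartesian_product case_prod_unfold)
    finally show ?thesis by (simp add: scaleC_of_real)
  qed
  then show ?thesis using that[of I c] approx cG by (simp add: I_def)
qed

lemma has_integral_cis_period:
  fixes k :: int
  assumes "0 < L"
  shows "((\<lambda>t. cis (2 * pi * k * t / L)) has_integral (if k = 0 then of_real L else 0)) {0..L}"
proof (cases "k = 0")
  case True
  then show ?thesis using has_integral_const_real[of "1::complex" 0 L] \<open>0 < L\<close> by (simp add: scaleR_conv_of_real)
next
  case False
  define w where "w = \<i> * of_real (2 * pi * k / L)"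
  have "w \<noteq> 0" using False \<open>0 < L\<close> by (simp add: w_def)
  have cis_eq: "cis (2 * pi * k * t / L) = exp (t *\<^sub>R w)" for t
    by (simp add: cis_conv_exp w_def scaleR_conv_of_real mult_ac)
  have "((\<lambda>t. exp (t *\<^sub>R w) / w) has_vector_derivative exp (t *\<^sub>R w) * w / w) (at t within {0..L})" for t
    by (intro has_vector_derivative_divide exp_scaleR_has_vector_derivative_right)
  then have "((\<lambda>t. exp (t *\<^sub>R w)) has_integral exp (L *\<^sub>R w) / w - exp (0 *\<^sub>R w) / w) {0..L}"
    using \<open>0 < L\<close> \<open>w \<noteq> 0\<close> by (intro fundamental_theorem_of_calculus) simp_all
  moreover have "exp (L *\<^sub>R w) = 1"
    using \<open>0 < L\<close> cis_multiple_2pi[of "of_int k"] by (simp flip: cis_eq)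
  ultimately show ?thesis using False by (simp add: cis_eq)
qed

lemma cinner_sum_sum:
  fixes f :: "_ \<Rightarrow> 'a::complex_inner"
  shows "cinner (sum f I) (sum g J) = (\<Sum>n\<in>I. \<Sum>m\<in>J. cinner (f n) (g m))"
  by (subst cinner_sum_left) (simp add: cinner_sum_right)

text \<open>Parseval's identity: over a full period only the diagonal products survive. It lets a
  bound on individual coefficients pass to the square integral of the output.\<close>

lemma has_integral_norm_sq_trigonometric:
  fixes a :: "int \<Rightarrow> 'a::complex_inner"
  assumes "0 < L" "finite I"
  shows "((\<lambda>t. (norm (\<Sum>n\<in>I. cis (2 * pi * n * t / L) *\<^sub>C a n))\<^sup>2)
    has_integral L * (\<Sum>n\<in>I. (norm (a n))\<^sup>2)) {0..L}"
proof -
  have expand: "complex_of_real ((norm (\<Sum>n\<in>I. cis (2 * pi * n * t / L) *\<^sub>C a n))\<^sup>2)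
      = (\<Sum>n\<in>I. \<Sum>m\<in>I. cis (2 * pi * (n - m) * t / L) * cinner (a n) (a m))" for t
  proof -
    have "cis (- (2 * pi * m * t / L)) * (cis (2 * pi * n * t / L) * c)
        = cis (2 * pi * (n - m) * t / L) * c" for n m :: int and c
      by (simp add: cis_mult algebra_simps diff_divide_distrib)
    then show ?thesis
      unfolding cinner_self[symmetric] cinner_sum_sum cinner_scaleC_left cinner_scaleC_right cis_cnj
      by (simp only: of_int_diff)
  qed
  have "((\<lambda>t. \<Sum>n\<in>I. \<Sum>m\<in>I. cis (2 * pi * (n - m) * t / L) * cinner (a n) (a m)) has_integral
      (\<Sum>n\<in>I. \<Sum>m\<in>I. (if n - m = 0 then of_real L else 0) * cinner (a n) (a m))) {0..L}"
    using has_integral_cis_period[OF \<open>0 < L\<close>, of "_ - _"]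
    by (intro has_integral_sum \<open>finite I\<close> has_integral_mult_left) simp
  also have "(\<Sum>n\<in>I. \<Sum>m\<in>I. (if n - m = 0 then of_real L else 0) * cinner (a n) (a m))
      = complex_of_real (L * (\<Sum>n\<in>I. (norm (a n))\<^sup>2))"
  proof -
    have "(\<Sum>m\<in>I. (if n - m = 0 then of_real L else 0) * cinner (a n) (a m))
        = (\<Sum>m\<in>I. if n = m then complex_of_real (L * (norm (a n))\<^sup>2) else 0)" for n
      by (intro sum.cong) (auto simp: cinner_self)
    then show ?thesis using \<open>finite I\<close> by (simp add: sum_distrib_left)
  qed
  finally have "((\<lambda>t. complex_of_real ((norm (\<Sum>n\<in>I. cis (2 * pi * n * t / L) *\<^sub>C a n))\<^sup>2))
      has_integral complex_of_real (L * (\<Sum>n\<in>I. (norm (a n))\<^sup>2))) {0..L}"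
    by (simp only: expand)
  from has_integral_linear[OF this bounded_linear_Re] show ?thesis by (simp add: o_def)
qed

section \<open>The coupled system\<close>

lemma graph_norm_eq: "graph_norm A x = norm (x, A x)"
  by (simp add: graph_norm_def norm_Pair)

lemma norm_snd_pair_le: "norm (snd z) \<le> norm z"
  by (metis norm_snd_le prod.collapse)

text \<open>With g t = (w t, A (w t)) this carries continuity in a graph norm over to every operator
  bounded by that norm.\<close>

lemma continuous_on_dist_le:
  fixes f :: "'a::metric_space \<Rightarrow> 'b::metric_space" and g :: "'a \<Rightarrow> 'c::metric_space"
  assumes g: "continuous_on X g" and "\<And>s t. s \<in> X \<Longrightarrow> t \<in> X \<Longrightarrow> dist (f s) (f t) \<le> K * dist (g s) (g t)"
  shows "continuous_on X f"
  unfolding continuous_on_iff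
proof (intro ballI allI impI)
  fix x and e :: real assume "x \<in> X" "0 < e"
  \<comment> \<open>\<open>K\<close> may be zero or negative.\<close>
  define K' where "K' = max K 1"
  have "0 < K'" by (simp add: K'_def)
  obtain d where "0 < d" and d: "\<And>y. y \<in> X \<Longrightarrow> dist y x < d \<Longrightarrow> dist (g y) (g x) < e / K'"
    using g \<open>x \<in> X\<close> \<open>0 < e\<close> \<open>0 < K'\<close> unfolding continuous_on_iff by (metis divide_pos_pos)
  have "dist (f y) (f x) < e" if "y \<in> X" "dist y x < d" for y
  proof -
    have "dist (f y) (f x) \<le> K' * dist (g y) (g x)"
      using assms(2)[OF that(1) \<open>x \<in> X\<close>] mult_right_mono[of K K' "dist (g y) (g x)"]
      by (simp add: K'_def)
    also have "\<dots> < K' * (e / K')" using d[OF that] \<open>0 < K'\<close> by (rule mult_strict_left_mono)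
    finally show ?thesis using \<open>0 < K'\<close> by simp
  qed
  with \<open>0 < d\<close> show "\<exists>d>0. \<forall>y\<in>X. dist y x < d \<longrightarrow> dist (f y) (f x) < e" by blast
qed

context coupled_system
begin

abbreviation "domAd \<equiv> coupled_dom iV B domChat"
abbreviation "Ad \<equiv> coupled_op iV B Bs Chat"
abbreviation "domAc \<equiv> coupled_dom iV B domC"
abbreviation "Ac \<equiv> coupled_op iV B Bs (\<lambda>u. - C u)"
abbreviation "Dsu z \<equiv> Ds (snd (snd z))"

lemma bounded_linear_iV: "bounded_linear iV"
  using V_inclusion by (simp add: inclusion_def bounded_clinear_def)

lemma iV_scaleC: "iV (c *\<^sub>C x) = c *\<^sub>C iV x"
  using V_inclusion by (simp add: inclusion_def bounded_clinear_def)

lemma inv_iV [simp]: "inv iV (iV x) = x"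
  using V_inclusion by (simp add: inclusion_def)

lemma B_eq: "B u \<phi> = cinner u (Bs \<phi>)"
  using B_adjoint by (simp add: adjoint_on_def)

text \<open>Everything follows by duality: additivity by testing against all u, boundedness by
  testing with u = \<open>Bs x\<close>, for which the bracket is the squared norm of
  \<open>Bs x\<close>.\<close>

lemma bounded_linear_Bs: "bounded_linear Bs"
proof -
  have add: "Bs (x + y) = Bs x + Bs y" for x y
    using B_bounded by (intro cinner_eqI) (simp add: bounded_into_dual_def cinner_add_right flip: B_eq)
  have scale: "Bs (r *\<^sub>R x) = r *\<^sub>R Bs x" for r x
    using B_bounded by (intro cinner_eqI)
      (simp add: bounded_into_dual_def cinner_scaleC_right flip: B_eq scaleC_of_real)
  obtain k where "\<And>u \<phi>. cmod (B u \<phi>) \<le> k * norm u * norm \<phi>"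
    using B_bounded unfolding bounded_into_dual_def by auto
  \<comment> \<open>The constant provided by \<open>bounded_into_dual\<close> may be
    negative.\<close>
  then have K: "cmod (B u \<phi>) \<le> \<bar>k\<bar> * norm u * norm \<phi>" for u \<phi>
    by (rule order_trans) (intro mult_right_mono, simp_all)
  show ?thesis
  proof (rule bounded_linear_intro[OF add scale])
    fix x
    show "norm (Bs x) \<le> norm x * \<bar>k\<bar>"
    proof (cases "Bs x = 0")
      case False
      have "(norm (Bs x))\<^sup>2 = cmod (B (Bs x) x)" by (simp add: B_eq cinner_self norm_power)
      also have "\<dots> \<le> \<bar>k\<bar> * norm (Bs x) * norm x" by (rule K)
      finally show ?thesis using False by (simp add: power2_eq_square mult_ac)
    qed simp
  qed
qed

text \<open>Eliminates \<open>inv\<close> and \<open>THE\<close> from the operator; density of V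
  makes f unique. The same f serves for every K, so the damped and the conservative operator can be
  compared at one point.\<close>

lemma coupled_domE:
  assumes "z \<in> coupled_dom iV B S"
  obtains x y u f where "z = (x, iV y, u)" "u \<in> S"
    "\<And>\<phi>. cinner x \<phi> + cinner u (Bs \<phi>) = cinner f (iV \<phi>)"
    "\<And>K. coupled_op iV B Bs K z = (y, - f, Bs y + K u)"
proof -
  obtain x y u f where z: "z = (x, iV y, u)" "u \<in> S"
    and f: "\<And>\<phi>. form_operator x \<phi> + B u \<phi> = cinner f (iV \<phi>)"
    using assms unfolding coupled_dom_def in_pivot_def by auto
  have "to_pivot iV (\<lambda>\<phi>. form_operator x \<phi> + B u \<phi>) = f"
    unfolding to_pivot_def
  proof (rule the_equality)
    fix g assume g: "\<forall>\<phi>. form_operator x \<phi> + B u \<phi> = cinner g (iV \<phi>)"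
    show "g = f" by (rule cinner_dense_eq[OF V_dense]) (use f g in auto)
  qed (simp add: f)
  then show ?thesis
    using f by (intro that[OF z]) (simp_all add: z coupled_op_def form_operator_def B_eq)
qed

lemma domAd_subset: "domAd \<subseteq> domAc"
  using domChat_eq by (auto simp: coupled_dom_def)

lemma domChat_subset: "domChat \<subseteq> domC"
  using domChat_eq by auto

lemma domC_of_domAc: "z \<in> domAc \<Longrightarrow> snd (snd z) \<in> domC"
  and domChat_of_domAd: "z \<in> domAd \<Longrightarrow> snd (snd z) \<in> domChat"
  by (auto simp: coupled_dom_def)

lemma Chat_linear: "linear_operator domChat Chat"
  using Chat_m_dissipative by (simp add: m_dissipative_def)

lemma Ad_linear: "linear_operator domAd Ad"
  using Ad_m_dissipative by (simp add: m_dissipative_def)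

lemmas C_linear = skew_adjointD(1)[OF C_skew_adjoint]
  and domC_dense = skew_adjointD(2)[OF C_skew_adjoint]
  and Ac_linear = skew_adjointD(1)[OF Ac_skew_adjoint]

lemma D_eq: "\<phi> \<in> domC \<Longrightarrow> D w \<phi> = cinner w (Ds \<phi>)"
  using D_adjoint by (simp add: adjoint_on_def)

lemma Ds_add: "u \<in> domC \<Longrightarrow> v \<in> domC \<Longrightarrow> Ds (u + v) = Ds u + Ds v"
  using D_bounded linear_operator_add(1)[OF C_linear]
  by (intro cinner_eqI) (simp add: bounded_into_dual_def cinner_add_right flip: D_eq)

lemma Ds_scaleC: "u \<in> domC \<Longrightarrow> Ds (c *\<^sub>C u) = c *\<^sub>C Ds u"
  using D_bounded linear_operator_scaleC(1)[OF C_linear]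
  by (intro cinner_eqI) (simp add: bounded_into_dual_def cinner_scaleC_right flip: D_eq)

lemma Ds_linear: "u \<in> domC \<Longrightarrow> v \<in> domC \<Longrightarrow> Ds (u - v) = Ds u - Ds v"
  using Ds_add[of u "- v"] Ds_scaleC[of v "-1"] linear_operator_scaleC(1)[OF C_linear, of v "-1"]
  by (simp add: scaleC_minus_one)

lemma Ds_sum:
  assumes "\<And>i. i \<in> I \<Longrightarrow> f i \<in> domC"
  shows "Ds (sum f I) = (\<Sum>i\<in>I. Ds (f i))"
proof -
  have zero: "Ds 0 = 0" using Ds_scaleC[of 0 0] linear_operator_zero[OF C_linear] by simp
  show ?thesis
    using assms
  proof (induction I rule: infinite_finite_induct)
    case (insert i I)
    then show ?case using linear_operator_sum[OF C_linear, of I f] by (simp add: Ds_add)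
  qed (simp_all add: zero)
qed

text \<open>\<open>Ds\<close> is bounded by the graph norm of \<open>C\<close>, and
  \<open>C u\<close> can be read off from \<open>Ac z\<close>: the first component of
  \<open>Ac z\<close> is y and the third is \<open>Bs y - C u\<close>. Hence the graph norm of
  \<open>Ac\<close> controls that of \<open>C\<close>.\<close>

lemma Ds_bound_Ac:
  obtains K where "0 < K" "\<And>z. z \<in> domAc \<Longrightarrow> norm (Dsu z) \<le> K * norm (z, Ac z)"
proof -
  obtain k where "\<And>w \<phi>. \<phi> \<in> domC \<Longrightarrow> cmod (D w \<phi>) \<le> k * norm w * graph_norm C \<phi>"
    using D_bounded unfolding bounded_into_dual_def by blast
  then have k: "cmod (D w \<phi>) \<le> \<bar>k\<bar> * norm w * graph_norm C \<phi>" if "\<phi> \<in> domC" for w \<phi>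
    by (rule order_trans[OF _ mult_right_mono[OF mult_right_mono[OF abs_ge_self]]])
      (simp_all add: that graph_norm_eq)
  obtain kB where kB: "0 < kB" "\<And>y. norm (Bs y) \<le> norm y * kB"
    using bounded_linear.pos_bounded[OF bounded_linear_Bs] by blast
  have "norm (Dsu z) \<le> \<bar>k\<bar> * (2 + kB) * norm (z, Ac z)" if "z \<in> domAc" for z
    using that
  proof (cases rule: coupled_domE)
    case (1 x y u f)
    have Ds_u: "norm (Ds u) \<le> \<bar>k\<bar> * graph_norm C u"
    proof (cases "Ds u = 0")
      case False
      have "(norm (Ds u))\<^sup>2 = cmod (D (Ds u) u)" using 1(2) by (simp add: D_eq cinner_self norm_power)
      also have "\<dots> \<le> \<bar>k\<bar> * norm (Ds u) * graph_norm C u" by (rule k[OF 1(2)])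
      finally show ?thesis using False by (simp add: power2_eq_square mult_ac)
    qed (simp add: graph_norm_eq)
    have "graph_norm C u \<le> norm u + norm (C u)" unfolding graph_norm_eq by (rule norm_Pair_le)
    also have "norm u \<le> norm (z, Ac z)"
      using norm_snd_pair_le[of z] norm_snd_pair_le[of "snd z"] norm_fst_le[of z "Ac z"] 1(1) by simp
    also have "norm (C u) \<le> (1 + kB) * norm (z, Ac z)"
    proof -
      have "C u = Bs (fst (Ac z)) - snd (snd (Ac z))" by (simp add: 1(4))
      then have "norm (C u) \<le> norm (Bs (fst (Ac z))) + norm (snd (snd (Ac z)))"
        using norm_triangle_ineq4 by metis
      also have "norm (Bs (fst (Ac z))) \<le> norm (Ac z) * kB"
        using kB(1) norm_fst_le[of "fst (Ac z)" "snd (Ac z)"]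
          by (intro order_trans[OF kB(2)] mult_right_mono) simp_all
      also have "norm (snd (snd (Ac z))) \<le> norm (Ac z)"
        using norm_snd_pair_le[of "Ac z"] norm_snd_pair_le[of "snd (Ac z)"] by simp
      finally have "norm (C u) \<le> (1 + kB) * norm (Ac z)" by (simp add: algebra_simps)
      also have "\<dots> \<le> (1 + kB) * norm (z, Ac z)"
        using kB(1) norm_snd_pair_le[of "(z, Ac z)"] by (intro mult_left_mono) simp_all
      finally show ?thesis .
    qed
    finally have "graph_norm C u \<le> (2 + kB) * norm (z, Ac z)" by (simp add: algebra_simps)
    then have "\<bar>k\<bar> * graph_norm C u \<le> \<bar>k\<bar> * ((2 + kB) * norm (z, Ac z))"
      by (intro mult_left_mono) simp_all
    with Ds_u show ?thesis using 1(1) by (simp add: mult.assoc)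
  qed
  then have "norm (Dsu z) \<le> (\<bar>k\<bar> * (2 + kB) + 1) * norm (z, Ac z)" if "z \<in> domAc" for z
    by (rule order_trans[OF _ mult_right_mono]) (simp_all add: that)
  moreover have "0 < \<bar>k\<bar> * (2 + kB) + 1" using kB(1) by (simp add: add_nonneg_pos)
  ultimately show ?thesis using that by blast
qed

text \<open>Since \<open>Chat = - C - D D\<^sup>*\<close>, this is \<open>D D\<^sup>* u\<close> as an element of \<open>U\<close>.\<close>

definition damping_term :: "'u \<Rightarrow> 'u"
  where "damping_term u = - C u - Chat u"

lemma cinner_damping_term:
  assumes "u \<in> domChat" "\<phi> \<in> domC"
  shows "cinner (damping_term u) \<phi> = cinner (Ds u) (Ds \<phi>)"
  using Chat_eq[OF assms] D_eq[OF assms(2)] by (simp add: damping_term_def cinner_diff_left)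

lemma damping_term_linear: "linear_operator domChat damping_term"
  unfolding linear_operator_def damping_term_def
  using domChat_subset linear_operator_zero(1)[OF Chat_linear] linear_operator_add[OF Chat_linear]
    linear_operator_scaleC[OF Chat_linear] linear_operator_add(2)[OF C_linear]
    linear_operator_scaleC(2)[OF C_linear]
  by (auto simp: subset_iff scaleC_diff_right)

text \<open>The relative bound of \<open>C\<close> with respect to \<open>Chat\<close> is what
  allows approximation in the graph norm of \<open>Chat\<close> to control the forcing.\<close>

lemma damping_term_bound:
  obtains K where "0 < K" "\<And>u. u \<in> domChat \<Longrightarrow> norm (damping_term u) \<le> K * norm (u, Chat u)"
proof -
  obtain k where k: "0 \<le> k" "\<And>u. u \<in> domChat \<Longrightarrow> norm (C u) \<le> k * (norm u + norm (Chat u))"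
    using m_dissipative_relative_bound[OF Chat_m_dissipative C_skew_adjoint domChat_subset] by blast
  have "norm (damping_term u) \<le> (2 * k + 1) * norm (u, Chat u)" if "u \<in> domChat" for u
  proof -
    have "norm (damping_term u) \<le> norm (C u) + norm (Chat u)"
      using norm_triangle_ineq4[of "- C u" "Chat u"] by (simp add: damping_term_def)
    also have "norm (C u) \<le> k * (norm u + norm (Chat u))" by (rule k(2)[OF that])
    also have "\<dots> \<le> k * (2 * norm (u, Chat u))"
      using k(1) norm_fst_le[of u "Chat u"] norm_snd_pair_le[of "(u, Chat u)"]
      by (intro mult_left_mono) simp_all
    also have "norm (Chat u) \<le> norm (u, Chat u)" using norm_snd_pair_le[of "(u, Chat u)"] by simp
    finally show ?thesis by (simp add: algebra_simps)
  qed
  then show ?thesis using that[of "2 * k + 1"] k(1) by simp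
qed

text \<open>Test \<open>Chat = - C - D Ds\<close> with u itself; the skew-adjoint part has no real
  part.\<close>

lemma norm_Ds_sq:
  assumes "u \<in> domChat"
  shows "(norm (Ds u))\<^sup>2 = - Re (cinner (Chat u) u)"
proof -
  have "u \<in> domC" using assms domChat_subset by blast
  then have "cinner (Ds u) (Ds u) = - cinner (C u) u - cinner (Chat u) u"
    using cinner_damping_term[OF assms, of u] by (simp add: damping_term_def cinner_diff_left)
  then show ?thesis
    using skew_adjoint_Re_zero[OF C_skew_adjoint \<open>u \<in> domC\<close>] by (simp flip: Re_cinner_self)
qed

lemma norm_Ds_le:
  assumes "u \<in> domChat"
  shows "norm (Ds u) \<le> norm (u, Chat u)"
proof -
  have "(norm (Ds u))\<^sup>2 \<le> norm (Chat u) * norm u"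
    unfolding norm_Ds_sq[OF assms] using Re_cinner_le[of "- Chat u" u] by simp
  also have "\<dots> \<le> norm (u, Chat u) * norm (u, Chat u)"
    using norm_fst_le[of u "Chat u"] norm_snd_pair_le[of "(u, Chat u)"] by (intro mult_mono) simp_all
  finally show ?thesis by (simp add: power2_le_iff_abs_le flip: power2_eq_square)
qed

text \<open>The defining identity of f with test vector y makes the terms coming from A, B and
  \<open>Bs\<close> cancel in the real part, and only the contribution of \<open>Chat\<close>
  remains.\<close>

lemma Re_cinner_Ad:
  assumes "z \<in> domAd"
  shows "Re (cinner (Ad z) z) = - (norm (Dsu z))\<^sup>2"
  using assms
proof (cases rule: coupled_domE)
  case (1 x y u f)
  have "Re (cinner x y) + Re (cinner u (Bs y)) = Re (cinner f (iV y))" by (simp flip: 1(3))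
  then show ?thesis
    using norm_Ds_sq[OF 1(2)] Re_cinner_commute[of y x] Re_cinner_commute[of "Bs y" u]
    by (simp add: 1(1) 1(4)[unfolded 1(1)] cinner_prod_def cinner_add_left)
qed

lemma Ac_minus_Ad:
  assumes "z \<in> domAd"
  shows "Ac z - Ad z = (0, 0, damping_term (snd (snd z)))"
  using assms by (cases rule: coupled_domE) (simp add: damping_term_def)

text \<open>Since x is given, only uniqueness is at stake. Testing the difference with itself gives
  l^2 p + q = 0 with p, q nonnegative. Dividing by l turns this into an expression with real part Re
  l (p + q / |l|^2), so both vanish.\<close>

lemma form_resolvent_eq:
  assumes "0 < Re l" and x: "\<And>\<phi>. l\<^sup>2 * cinner (iV x) (iV \<phi>) + cinner x \<phi> = g \<phi>"
  shows "form_resolvent iV (l\<^sup>2) g = x"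
  unfolding form_resolvent_def form_operator_def
proof (rule the_equality)
  fix x' assume x': "\<forall>\<phi>. l\<^sup>2 * cinner (iV x') (iV \<phi>) + cinner x' \<phi> = g \<phi>"
  define d where "d = x' - x"
  have "l\<^sup>2 * cinner (iV d) (iV d) + cinner d d
      = (l\<^sup>2 * cinner (iV x') (iV d) + cinner x' d) - (l\<^sup>2 * cinner (iV x) (iV d) + cinner x d)"
    by (simp add: d_def linear_diff[OF bounded_linear.linear[OF bounded_linear_iV]] cinner_diff_left
        right_diff_distrib)
  also have "\<dots> = 0" using x x' by simp
  finally have eq: "l\<^sup>2 * of_real ((norm (iV d))\<^sup>2) + of_real ((norm d)\<^sup>2) = 0"
    by (simp only: cinner_self)
  have "Re (l * of_real ((norm (iV d))\<^sup>2) + cnj l * of_real ((norm d)\<^sup>2) / of_real ((cmod l)\<^sup>2)) = 0"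
  proof -
    have "l \<noteq> 0" using assms(1) by auto
    have "l * cnj l = of_real ((cmod l)\<^sup>2)" by (simp only: complex_norm_square)
    then have "l * (l * of_real ((norm (iV d))\<^sup>2) + cnj l * of_real ((norm d)\<^sup>2) / of_real ((cmod l)\<^sup>2)) = 0"
      using eq \<open>l \<noteq> 0\<close> by (simp add: distrib_left power2_eq_square flip: mult.assoc)
    then show ?thesis using \<open>l \<noteq> 0\<close> by simp
  qed
  then have "Re l * ((norm (iV d))\<^sup>2 + (norm d)\<^sup>2 / (cmod l)\<^sup>2) = 0"
    by (simp add: distrib_left flip: of_real_power of_real_divide times_divide_eq_right)
  then have "(norm (iV d))\<^sup>2 + (norm d)\<^sup>2 / (cmod l)\<^sup>2 = 0" using assms(1) by simp
  then have "norm d = 0" using assms(1) by (auto simp: add_nonneg_eq_0_iff)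
  then show "x' = x" by (simp add: d_def)
qed (simp add: x)

text \<open>Block elimination in the resolvent equation. The first row gives y = l x, the second f =
  - l^2 x in X, so the identity for f becomes (l^2 + A)(- x) = B u. Inserting x into the third row
  leaves the transfer denominator applied to u. Thus - H maps the input \<open>Ds c\<close> to the
  output of the resolvent.\<close>

lemma transfer_value_resolvent:
  assumes "0 < Re l" "c \<in> domChat" "v \<in> domAc" "l *\<^sub>C v - Ac v = (0, 0, damping_term c)"
  shows "transfer_value iV B Bs domC C D Ds l (Ds c) (- Dsu v)"
  using assms(3)
proof (cases rule: coupled_domE)
  case (1 x y u f)
  have eqs: "y = l *\<^sub>C x" "l *\<^sub>C iV y + f = 0" "l *\<^sub>C u - (Bs y - C u) = damping_term c"
    using assms(4) by (simp_all add: 1(4)) (simp_all add: 1(1) scaleC_prod_def zero_prod_def)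
  have "form_resolvent iV (l\<^sup>2) (B u) = - x"
  proof (rule form_resolvent_eq[OF assms(1)])
    fix \<phi>
    have "f = - (l\<^sup>2 *\<^sub>C iV x)"
      using eqs(2) by (simp add: eqs(1) iV_scaleC scaleC_scaleC power2_eq_square eq_neg_iff_add_eq_0 add.commute)
    then show "l\<^sup>2 * cinner (iV (- x)) (iV \<phi>) + cinner (- x) \<phi> = B u \<phi>"
      using 1(3)[of \<phi>] by (simp add: B_eq linear_neg[OF bounded_linear.linear[OF bounded_linear_iV]] cinner_scaleC_left)
        (simp add: algebra_simps)
  qed
  moreover have "Bs y = l *\<^sub>C Bs x"
    unfolding eqs(1) by (rule cinner_eqI) (use B_bounded in
      \<open>simp add: bounded_into_dual_def cinner_scaleC_right flip: B_eq\<close>)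
  moreover have "l *\<^sub>C u + C u - Bs y = damping_term c"
    using eqs(3) by (simp add: algebra_simps)
  ultimately have "transfer_denominator iV B Bs C l u = damping_term c"
    by (simp add: transfer_denominator_def linear_neg[OF bounded_linear.linear[OF bounded_linear_Bs]])
  then show ?thesis
    unfolding transfer_value_def using 1(1,2) cinner_damping_term[OF assms(2)] D_eq
    by (intro bexI[of _ u]) simp_all
qed

end

section \<open>Classical solutions\<close>

lemma cauchy_solutionD:
  assumes "cauchy_solution S A z0 z"
  shows "z 0 = z0" "continuous_on {0..} (\<lambda>t. A (z t))" "\<And>t. 0 \<le> t \<Longrightarrow> z t \<in> S"
    "\<And>t. 0 \<le> t \<Longrightarrow> (z has_vector_derivative A (z t)) (at t within {0..})"
    "continuous_on {0..} z"
proof -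
  show deriv: "(z has_vector_derivative A (z t)) (at t within {0..})" if "0 \<le> t" for t
    using assms that by (simp add: cauchy_solution_def)
  show "continuous_on {0..} z"
    unfolding continuous_on_eq_continuous_within
    using deriv has_vector_derivative_continuous by fastforce
qed (use assms in \<open>auto simp: cauchy_solution_def\<close>)

lemma cauchy_solution_shift:
  assumes "cauchy_solution S A z0 z" "0 \<le> a"
  shows "cauchy_solution S A (z a) (\<lambda>t. z (a + t))"
  unfolding cauchy_solution_def
proof (intro conjI allI impI)
  note z = cauchy_solutionD[OF assms(1)]
  show "continuous_on {0..} (\<lambda>t. A (z (a + t)))"
    by (rule continuous_on_compose2[OF z(2)]) (use assms(2) in \<open>auto intro!: continuous_intros\<close>)
  fix t :: real assume "0 \<le> t"
  show "z (a + t) \<in> S" using z(3) assms(2) \<open>0 \<le> t\<close> by simp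
  have "(z has_vector_derivative A (z (a + t))) (at (a + t) within (+) a ` {0..})"
    using assms(2) \<open>0 \<le> t\<close> by (intro has_vector_derivative_within_subset[OF z(4)]) auto
  moreover have "((+) a has_vector_derivative 1) (at t within {0..})"
    by (auto intro!: derivative_eq_intros)
  ultimately show "((\<lambda>t. z (a + t)) has_vector_derivative A (z (a + t))) (at t within {0..})"
    using vector_diff_chain_within[of "(+) a" 1 t "{0..}" z] by (simp add: o_def)
qed simp

lemma tendsto_difference_quotient:
  fixes f :: "real \<Rightarrow> 'a::real_normed_vector"
  assumes "(f has_vector_derivative D) (at t within {0..})" "0 \<le> t"
  shows "((\<lambda>h. (f (t + h) - f t) /\<^sub>R h) \<longlongrightarrow> D) (at_right 0)"
proof -
  have "((\<lambda>s. norm (f s - f t - (s - t) *\<^sub>R D) / norm (s - t)) \<longlongrightarrow> 0) (at t within {0..})"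
    using assms(1) by (simp add: has_vector_derivative_def has_derivative_iff_norm)
  moreover have "filterlim (\<lambda>h. t + h) (at t within {0..}) (at_right 0)"
    unfolding filterlim_at
  proof (intro conjI)
    show "\<forall>\<^sub>F h in at_right 0. t + h \<in> {0..} \<and> t + h \<noteq> t"
      using eventually_at_right_less[of 0] by eventually_elim (use assms(2) in auto)
    show "((\<lambda>h. t + h) \<longlongrightarrow> t) (at_right 0)" by (auto intro!: tendsto_eq_intros)
  qed
  ultimately have "((\<lambda>h. norm (f (t + h) - f t - (t + h - t) *\<^sub>R D) / norm (t + h - t)) \<longlongrightarrow> 0) (at_right 0)"
    by (rule filterlim_compose)
  then have lim: "((\<lambda>h. norm (f (t + h) - f t - h *\<^sub>R D) / \<bar>h\<bar>) \<longlongrightarrow> 0) (at_right 0)" by simp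
  have "((\<lambda>h. norm ((f (t + h) - f t) /\<^sub>R h - D)) \<longlongrightarrow> 0) (at_right 0)"
  proof (rule Lim_transform_eventually[OF lim])
    show "\<forall>\<^sub>F h in at_right 0. norm (f (t + h) - f t - h *\<^sub>R D) / \<bar>h\<bar> = norm ((f (t + h) - f t) /\<^sub>R h - D)"
      using eventually_at_right_less[of 0]
    proof eventually_elim
      case (elim h)
      then have "(f (t + h) - f t) /\<^sub>R h - D = (f (t + h) - f t - h *\<^sub>R D) /\<^sub>R h"
        by (simp add: scaleR_right_diff_distrib)
      then show ?case by (simp add: divide_inverse mult.commute)
    qed
  qed
  then show ?thesis by (rule LIM_zero_cancel[OF tendsto_norm_zero_cancel])
qed

text \<open>The observability hypothesis quantifies over conservative solutions, so one must be
  produced from every point of a damped orbit before the hypothesis can be used there. The group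
  commutes with difference quotients, hence with A on the orbit.\<close>

lemma unitary_group_solution:
  assumes "generates_unitary_group S A" "z0 \<in> S"
  obtains z where "cauchy_solution S A z0 z"
proof -
  obtain T where bcl: "\<And>t. bounded_clinear (T t)"
    and inner: "\<And>t x y. cinner (T t x) (T t y) = cinner x y"
    and T0: "T 0 = id" and group: "\<And>s t. T (s + t) = T s \<circ> T t"
    and sc: "\<And>x. ((\<lambda>t. T t x) \<longlongrightarrow> x) (at 0)"
    and gen: "\<And>x y. ((\<lambda>h. (T h x - x) /\<^sub>R h) \<longlongrightarrow> y) (at 0) \<longleftrightarrow> x \<in> S \<and> y = A x"
    using assms(1) unfolding generates_unitary_group_def by (elim exE conjE) (rule that, (blast | simp)+)
  have bl: "bounded_linear (T t)" for t using bcl by (simp add: bounded_clinear_def)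
  have isom: "norm (T t x) = norm x" for t x
    using inner[of t x x] Re_cinner_self[of x] Re_cinner_self[of "T t x"] by simp
  have comm: "T (t + h) x = T t (T h x)" "T h (T t x) = T t (T h x)" for t h x
    by (metis add.commute comp_apply group)+
  have quot: "(T (t + h) z0 - T t z0) /\<^sub>R h = T t ((T h z0 - z0) /\<^sub>R h)"
      "(T h (T t z0) - T t z0) /\<^sub>R h = T t ((T h z0 - z0) /\<^sub>R h)" for t h
    by (simp_all add: linear_diff[OF bounded_linear.linear[OF bl]]
        linear_scale[OF bounded_linear.linear[OF bl]] comm)
  have lim: "((\<lambda>h. T t ((T h z0 - z0) /\<^sub>R h)) \<longlongrightarrow> T t (A z0)) (at 0)" for t
    using gen assms(2) by (intro bounded_linear.tendsto[OF bl]) blast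
  have inS: "T t z0 \<in> S" "A (T t z0) = T t (A z0)" for t
    using gen[of "T t z0" "T t (A z0)"] lim[of t] by (simp_all add: quot(2))
  have deriv: "((\<lambda>t. T t z0) has_vector_derivative A (T t z0)) (at t)" for t
    unfolding has_vector_derivative_def has_derivative_at
  proof (intro conjI bounded_linear_scaleR_left)
    have "((\<lambda>h. norm (T t ((T h z0 - z0) /\<^sub>R h) - T t (A z0))) \<longlongrightarrow> 0) (at 0)"
      by (rule tendsto_norm_zero[OF LIM_zero[OF lim]])
    then show "(\<lambda>h. norm (T (t + h) z0 - T t z0 - h *\<^sub>R A (T t z0)) / norm h) \<midarrow>0\<rightarrow> 0"
    proof (rule Lim_transform_eventually)
      show "\<forall>\<^sub>F h in at 0. norm (T t ((T h z0 - z0) /\<^sub>R h) - T t (A z0))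
          = norm (T (t + h) z0 - T t z0 - h *\<^sub>R A (T t z0)) / norm h"
        unfolding eventually_at
      proof (intro exI[of _ 1] conjI ballI impI)
        fix h :: real assume "h \<noteq> 0 \<and> dist h 0 < 1"
        then have "T (t + h) z0 - T t z0 - h *\<^sub>R A (T t z0) = h *\<^sub>R (T t ((T h z0 - z0) /\<^sub>R h) - T t (A z0))"
          unfolding inS(2) quot(1)[symmetric] scaleR_right_diff_distrib[of h] by simp
        then show "norm (T t ((T h z0 - z0) /\<^sub>R h) - T t (A z0))
          = norm (T (t + h) z0 - T t z0 - h *\<^sub>R A (T t z0)) / norm h"
          using \<open>h \<noteq> 0 \<and> dist h 0 < 1\<close> by simp
      qed simp
    qed
  qed
  \<comment> \<open>Strong continuity at 0 is transported to every t because the group is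
    isometric.\<close>
  have "isCont (\<lambda>t. T t (A z0)) t" for t
    unfolding isCont_iff
  proof (rule LIM_zero_cancel, rule tendsto_norm_zero_cancel)
    have "norm (T (t + h) (A z0) - T t (A z0)) = norm (T h (A z0) - A z0)" for h
      using group[of t h] isom[of t "T h (A z0) - A z0"]
      by (simp add: linear_diff[OF bounded_linear.linear[OF bl]])
    then show "(\<lambda>h. norm (T (t + h) (A z0) - T t (A z0))) \<midarrow>0\<rightarrow> 0"
      using tendsto_norm_zero[OF LIM_zero[OF sc]] by simp
  qed
  then have "cauchy_solution S A z0 (\<lambda>t. T t z0)"
    unfolding cauchy_solution_def
    using T0 inS deriv
    by (auto intro: continuous_at_imp_continuous_on has_vector_derivative_at_within)
  then show ?thesis using that by blast
qed

section \<open>Regularity, energy balance and contraction for damped solutions\<close>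

context coupled_system
begin

lemma continuous_on_Ds_Ac:
  assumes "continuous_on X w" "continuous_on X (\<lambda>t. Ac (w t))" "\<And>t. t \<in> X \<Longrightarrow> w t \<in> domAc"
  shows "continuous_on (X :: real set) (\<lambda>t. Dsu (w t))"
proof -
  obtain K where K: "\<And>z. z \<in> domAc \<Longrightarrow> norm (Dsu z) \<le> K * norm (z, Ac z)"
    using Ds_bound_Ac by blast
  show ?thesis
  proof (rule continuous_on_dist_le)
    show "continuous_on X (\<lambda>t. (w t, Ac (w t)))" by (intro continuous_intros assms)
    fix s t assume "s \<in> X" "t \<in> X"
    then show "dist (Dsu (w s)) (Dsu (w t)) \<le> K * dist (w s, Ac (w s)) (w t, Ac (w t))"
      using K[of "w s - w t"] linear_operator_diff[OF Ac_linear assms(3) assms(3), of s t]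
        Ds_linear[OF domC_of_domAc domC_of_domAc, OF assms(3) assms(3), of s t]
      by (simp add: dist_norm)
  qed
qed

text \<open>\<open>Chat (u t)\<close> is the third component of \<open>Ad (z t)\<close> minus
  \<open>Bs\<close> of the first one. Hence u is continuous in the graph norm of
  \<open>Chat\<close>, and \<open>Ds\<close> and the damping term are bounded by that norm.\<close>

lemma damped_solution_continuous:
  assumes "cauchy_solution domAd Ad z0 z"
  defines "u \<equiv> \<lambda>t. snd (snd (z t))"
  shows "continuous_on {0..} (\<lambda>t. (u t, Chat (u t)))" "\<And>t. 0 \<le> t \<Longrightarrow> u t \<in> domChat"
    "continuous_on {0..} (\<lambda>t. Ds (u t))" "continuous_on {0..} (\<lambda>t. damping_term (u t))"
proof -
  note z = cauchy_solutionD[OF assms(1)]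
  show u: "u t \<in> domChat" if "0 \<le> t" for t
    unfolding u_def using domChat_of_domAd z(3)[OF that] .
  have "continuous_on {0..} (\<lambda>t. (u t, snd (snd (Ad (z t))) - Bs (fst (Ad (z t)))))"
    unfolding u_def by (intro continuous_intros z(2,5) bounded_linear.continuous_on[OF bounded_linear_Bs])
  moreover have "snd (snd (Ad (z t))) - Bs (fst (Ad (z t))) = Chat (u t)" if "0 \<le> t" for t
    using z(3)[OF that] by (cases rule: coupled_domE) (simp add: u_def)
  ultimately show cont: "continuous_on {0..} (\<lambda>t. (u t, Chat (u t)))"
    by (subst continuous_on_cong[OF refl]) (auto simp: u_def)
  have diff: "u s - u t \<in> domChat" "Chat (u s - u t) = Chat (u s) - Chat (u t)"
      "damping_term (u s - u t) = damping_term (u s) - damping_term (u t)"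
      "Ds (u s - u t) = Ds (u s) - Ds (u t)" if "0 \<le> s" "0 \<le> t" for s t
    using that u linear_operator_diff[OF Chat_linear] linear_operator_diff[OF damping_term_linear]
      Ds_linear domChat_subset by (auto simp: subset_iff)
  show "continuous_on {0..} (\<lambda>t. Ds (u t))"
  proof (rule continuous_on_dist_le[OF cont])
    fix s t :: real assume "s \<in> {0..}" "t \<in> {0..}"
    then show "dist (Ds (u s)) (Ds (u t)) \<le> 1 * dist (u s, Chat (u s)) (u t, Chat (u t))"
      using norm_Ds_le[OF diff(1), of s t] by (simp add: dist_norm diff)
  qed
  obtain K where K: "\<And>u. u \<in> domChat \<Longrightarrow> norm (damping_term u) \<le> K * norm (u, Chat u)"
    using damping_term_bound by blast
  show "continuous_on {0..} (\<lambda>t. damping_term (u t))"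
  proof (rule continuous_on_dist_le[OF cont])
    fix s t :: real assume "s \<in> {0..}" "t \<in> {0..}"
    then show "dist (damping_term (u s)) (damping_term (u t)) \<le> K * dist (u s, Chat (u s)) (u t, Chat (u t))"
      using K[OF diff(1), of s t] by (simp add: dist_norm diff)
  qed
qed

lemma damped_energy:
  assumes "cauchy_solution domAd Ad z0 z" "0 \<le> T"
  shows "2 * integral {0..T} (\<lambda>t. (norm (Dsu (z t)))\<^sup>2) = (norm z0)\<^sup>2 - (norm (z T))\<^sup>2"
proof -
  note z = cauchy_solutionD[OF assms(1)]
  have "((\<lambda>t. (norm (z t))\<^sup>2) has_vector_derivative - 2 * (norm (Dsu (z t)))\<^sup>2) (at t within {0..T})"
    if "t \<in> {0..T}" for t
  proof -
    have "0 \<le> t" "(z has_vector_derivative Ad (z t)) (at t within {0..T})"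
      using that by (auto intro: has_vector_derivative_within_subset[OF z(4)])
    from has_real_derivative_norm_sq[OF this(2)] Re_cinner_Ad[OF z(3)[OF this(1)]]
    show ?thesis by (simp add: has_real_derivative_iff_has_vector_derivative)
  qed
  from fundamental_theorem_of_calculus[OF assms(2) this]
  have "integral {0..T} (\<lambda>t. - 2 * (norm (Dsu (z t)))\<^sup>2) = (norm (z T))\<^sup>2 - (norm z0)\<^sup>2"
    unfolding z(1) by (rule integral_unique)
  then show ?thesis by simp
qed

lemma damped_contraction:
  assumes "cauchy_solution domAd Ad z0 z" "cauchy_solution domAd Ad z0' z'" "0 \<le> t"
  shows "norm (z t - z' t) \<le> norm (z0 - z0')"
proof -
  note z = cauchy_solutionD[OF assms(1)] and z' = cauchy_solutionD[OF assms(2)]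
  have "norm (z t - z' t) \<le> norm (z 0 - z' 0) + (0 - 0)"
  proof (rule norm_growth_le[OF assms(3), where \<beta> = "\<lambda>_. 0" and \<beta>' = "\<lambda>_. 0"])
    fix s assume "s \<in> {0..t}"
    then have s: "0 \<le> s" by simp
    have "(z has_vector_derivative Ad (z s)) (at s within {0..t})"
         "(z' has_vector_derivative Ad (z' s)) (at s within {0..t})"
      using s by (auto intro: has_vector_derivative_within_subset[OF z(4)]
          has_vector_derivative_within_subset[OF z'(4)])
    then show "((\<lambda>s. z s - z' s) has_vector_derivative Ad (z s) - Ad (z' s)) (at s within {0..t})"
      by (rule has_vector_derivative_diff)
    show "Re (cinner (Ad (z s) - Ad (z' s)) (z s - z' s)) \<le> 0 * norm (z s - z' s)"
      using linear_operator_diff[OF Ad_linear z(3)[OF s] z'(3)[OF s]] Re_cinner_Ad by fastforce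
  qed simp_all
  then show ?thesis by (simp add: z(1) z'(1))
qed

text \<open>By contraction, z and its shift by h are no further apart at time t than at time 0.
  Dividing by h and letting h tend to 0 compares \<open>Ad (z t)\<close> with \<open>Ad z0\<close>,
  without representing z by the semigroup.\<close>

lemma damped_graph_norm_le:
  assumes "cauchy_solution domAd Ad z0 z" "0 \<le> t" and z0: "z0 \<in> domAd"
  shows "norm (z t) \<le> norm z0" "graph_norm Ad (z t) \<le> graph_norm Ad z0"
proof -
  note z = cauchy_solutionD[OF assms(1)]
  have "cauchy_solution domAd Ad 0 (\<lambda>_. 0)"
    using linear_operator_zero[OF Ad_linear] by (simp add: cauchy_solution_def)
  from damped_contraction[OF assms(1) this assms(2)] show le: "norm (z t) \<le> norm z0" by simp
  have "norm (Ad (z t)) \<le> norm (Ad (z 0))"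
  proof (rule tendsto_le[OF trivial_limit_at_right_real])
    show "((\<lambda>h. norm ((z (t + h) - z t) /\<^sub>R h)) \<longlongrightarrow> norm (Ad (z t))) (at_right 0)"
      by (intro tendsto_norm tendsto_difference_quotient z(4) assms(2))
    show "((\<lambda>h. norm ((z (0 + h) - z 0) /\<^sub>R h)) \<longlongrightarrow> norm (Ad (z 0))) (at_right 0)"
      by (intro tendsto_norm tendsto_difference_quotient z(4)) simp_all
    show "\<forall>\<^sub>F h in at_right 0. norm ((z (t + h) - z t) /\<^sub>R h) \<le> norm ((z (0 + h) - z 0) /\<^sub>R h)"
      using eventually_at_right_less[of 0]
    proof eventually_elim
      case (elim h)
      then have "norm (z (h + t) - z t) \<le> norm (z h - z0)"
        using damped_contraction[OF cauchy_solution_shift[OF assms(1)] assms(1,2), of h] by simp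
      then show ?case using elim by (simp add: z(1) add.commute mult_left_mono)
    qed
  qed
  then show "graph_norm Ad (z t) \<le> graph_norm Ad z0"
    unfolding graph_norm_def using le by (intro real_sqrt_le_mono add_mono power_mono) (simp_all add: z(1))
qed

end

section \<open>The input-output estimate\<close>

text \<open>For L > 0 these are exactly the solutions l of exp (L l) = exp (\<beta> L), so all their
  exponentials share the multiplier exp (\<beta> L) over a period.\<close>

definition line_freq :: "real \<Rightarrow> real \<Rightarrow> int \<Rightarrow> complex"
  where "line_freq \<beta> L n = Complex \<beta> (2 * pi * n / L)"

lemma Re_line_freq [simp]: "Re (line_freq \<beta> L n) = \<beta>"
  by (simp add: line_freq_def)

lemma exp_line_freq:
  "exp (t *\<^sub>R line_freq \<beta> L n) = of_real (exp (\<beta> * t)) * cis (2 * pi * n * t / L)"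
  by (simp add: exp_eq_polar line_freq_def mult_ac)

lemma exp_line_freq_scaleC:
  "exp (t *\<^sub>R line_freq \<beta> L n) *\<^sub>C x = exp (\<beta> * t) *\<^sub>R (cis (2 * pi * n * t / L) *\<^sub>C x)"
  by (simp add: exp_line_freq scaleC_of_real flip: scaleC_scaleC)

lemma exp_line_freq_period:
  assumes "0 < L"
  shows "exp (L *\<^sub>R line_freq \<beta> L n) = of_real (exp (\<beta> * L))"
  using assms cis_multiple_2pi[of "real_of_int n"] by (simp add: exp_line_freq)

lemma has_vector_derivative_exp_scaleC:
  "((\<lambda>t. exp (t *\<^sub>R l) *\<^sub>C v) has_vector_derivative exp (t *\<^sub>R l) *\<^sub>C (l *\<^sub>C v)) (at t within X)"
  for l :: complex
proof -
  have "((\<lambda>t. exp (t *\<^sub>R l) *\<^sub>C v) has_vector_derivative exp (t *\<^sub>R l) *\<^sub>C 0 + (exp (t *\<^sub>R l) * l) *\<^sub>C v) (at t within X)"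
    by (rule bounded_bilinear.has_vector_derivative[OF bounded_bilinear_scaleC
        exp_scaleR_has_vector_derivative_right has_vector_derivative_const])
  then show ?thesis by (simp add: scaleC_scaleC)
qed

text \<open>Averaging over a window of length h acts on a mode as multiplication by a number that
  does not depend on t, so an averaged exponential sum keeps its frequencies.\<close>

lemma has_integral_exp_scaleC:
  fixes v :: "'a::complex_banach"
  assumes "l \<noteq> 0" "0 \<le> h"
  shows "((\<lambda>s. exp (s *\<^sub>R l) *\<^sub>C v) has_integral exp (t *\<^sub>R l) *\<^sub>C (((exp (h *\<^sub>R l) - 1) / l) *\<^sub>C v)) {t..t + h}"
proof -
  have "((\<lambda>s. exp (s *\<^sub>R l) *\<^sub>C (inverse l *\<^sub>C v)) has_vector_derivative exp (s *\<^sub>R l) *\<^sub>C v) (at s within {t..t + h})" for s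
    using has_vector_derivative_exp_scaleC[of l "inverse l *\<^sub>C v" s] assms(1)
    by (simp add: scaleC_scaleC)
  then have "((\<lambda>s. exp (s *\<^sub>R l) *\<^sub>C v) has_integral
      exp ((t + h) *\<^sub>R l) *\<^sub>C (inverse l *\<^sub>C v) - exp (t *\<^sub>R l) *\<^sub>C (inverse l *\<^sub>C v)) {t..t + h}"
    using assms(2) by (intro fundamental_theorem_of_calculus) simp_all
  moreover have "exp ((t + h) *\<^sub>R l) = exp (t *\<^sub>R l) * exp (h *\<^sub>R l)"
    by (simp add: scaleR_left_distrib exp_add)
  ultimately show ?thesis
    by (simp add: scaleC_scaleC divide_inverse algebra_simps flip: scaleC_diff_left)
qed

text \<open>The multiplier is the integral of exp (s l) over the window, which bounds it uniformly
  in the imaginary part of l.\<close>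

lemma norm_exp_average_le:
  assumes "l \<noteq> 0" "0 \<le> Re l" "0 \<le> h"
  shows "cmod ((exp (h *\<^sub>R l) - 1) / l) \<le> h * exp (Re l * h)"
proof -
  have "((\<lambda>s. exp (s *\<^sub>R l)) has_integral exp (h *\<^sub>R l) / l - exp (0 *\<^sub>R l) / l) {0..h}"
  proof (rule fundamental_theorem_of_calculus[OF assms(3)])
    fix s assume "s \<in> {0..h}"
    have "((\<lambda>s. exp (s *\<^sub>R l) / l) has_vector_derivative exp (s *\<^sub>R l) * l / l) (at s within {0..h})"
      by (intro has_vector_derivative_divide exp_scaleR_has_vector_derivative_right)
    then show "((\<lambda>s. exp (s *\<^sub>R l) / l) has_vector_derivative exp (s *\<^sub>R l)) (at s within {0..h})"
      using assms(1) by simp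
  qed
  then have "integral {0..h} (\<lambda>s. exp (s *\<^sub>R l)) = (exp (h *\<^sub>R l) - 1) / l"
    by (simp add: integral_unique diff_divide_distrib)
  moreover have "norm (integral {0..h} (\<lambda>s. exp (s *\<^sub>R l))) \<le> exp (Re l * h) * (h - 0)"
    using assms(2,3) by (intro integral_bound continuous_intros)
      (auto simp: norm_exp_eq_Re mult.commute intro!: mult_right_mono)
  ultimately show ?thesis by (simp add: mult.commute)
qed

lemma exists_long_period:
  assumes "0 < \<beta>" "0 < S" "0 < (\<tau>::real)"
  obtains L where "a \<le> L" "0 < L" "L * S \<le> \<tau> * (exp (\<beta> * L) - 1)"
proof -
  \<comment> \<open>Since exp (\<beta> L) - 1 is at least (\<beta> L)^2 / 2, it suffices that 2 S is
    at most \<beta>^2 \<tau> L.\<close>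
  define L where "L = max (max a 1) (2 * S / (\<beta>\<^sup>2 * \<tau>))"
  have "0 < L" "a \<le> L" by (auto simp: L_def)
  have "2 * S / (\<beta>\<^sup>2 * \<tau>) \<le> L" by (simp add: L_def)
  then have "S \<le> \<tau> * \<beta>\<^sup>2 * L / 2" using assms by (simp add: field_simps)
  then have "L * S \<le> L * (\<tau> * \<beta>\<^sup>2 * L / 2)" using \<open>0 < L\<close> by (intro mult_left_mono) simp_all
  also have "\<dots> = \<tau> * ((\<beta> * L)\<^sup>2 / 2)" by (simp add: power2_eq_square)
  also have "\<dots> \<le> \<tau> * (exp (\<beta> * L) - 1)"
  proof (rule mult_left_mono)
    have "0 \<le> \<beta> * L" using assms \<open>0 < L\<close> by simp
    with exp_lower_Taylor_quadratic[OF this] show "(\<beta> * L)\<^sup>2 / 2 \<le> exp (\<beta> * L) - 1" by linarith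
  qed (use assms in simp)
  finally show ?thesis using that \<open>0 < L\<close> \<open>a \<le> L\<close> by blast
qed

section \<open>Periodic approximation and the transfer estimate for forced paths\<close>

context coupled_system
begin

lemma Re_cinner_forced_le:
  assumes "v \<in> domAc" "norm g \<le> b"
  shows "Re (cinner (Ac v + (0, 0, g)) v) \<le> b * norm v"
proof -
  have "Re (cinner (Ac v + (0, 0, g)) v) \<le> norm (0 :: 'v, 0 :: 'x, g) * norm v"
    using skew_adjoint_Re_zero[OF Ac_skew_adjoint assms(1)] Re_cinner_le[of "(0, 0, g)" v]
    by (simp add: cinner_add_left)
  also have "\<dots> \<le> b * norm v" using assms(2) by (intro mult_right_mono) (simp_all add: norm_Pair)
  finally show ?thesis .
qed

text \<open>Packages what both damping conditions use about the control u of a damped solution and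
  the difference w of the conservative and the damped solution, so that their estimates share one
  hypothesis.\<close>

definition forced_path :: "(real \<Rightarrow> 'u) \<Rightarrow> (real \<Rightarrow> 'v \<times> 'x \<times> 'u) \<Rightarrow> bool"
  where "forced_path u w \<longleftrightarrow>
    (\<forall>t\<ge>0. u t \<in> domChat) \<and> continuous_on {0..} (\<lambda>t. (u t, Chat (u t))) \<and>
    continuous_on {0..} (\<lambda>t. Ds (u t)) \<and>
    w 0 = 0 \<and> (\<forall>t\<ge>0. w t \<in> domAc) \<and> continuous_on {0..} (\<lambda>t. Ac (w t)) \<and>
    (\<forall>t\<ge>0. (w has_vector_derivative Ac (w t) + (0, 0, damping_term (u t))) (at t within {0..}))"

lemma forced_pathD:
  assumes "forced_path u w"
  shows "continuous_on {0..} (\<lambda>t. (u t, Chat (u t)))" "\<And>t. 0 \<le> t \<Longrightarrow> u t \<in> domChat"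
    "continuous_on {0..} (\<lambda>t. Ds (u t))" "w 0 = 0" "\<And>t. 0 \<le> t \<Longrightarrow> w t \<in> domAc"
    "continuous_on {0..} (\<lambda>t. Ac (w t))"
    "\<And>t. 0 \<le> t \<Longrightarrow> (w has_vector_derivative Ac (w t) + (0, 0, damping_term (u t))) (at t within {0..})"
    "continuous_on {0..} w"
proof -
  show deriv: "(w has_vector_derivative Ac (w t) + (0, 0, damping_term (u t))) (at t within {0..})"
    if "0 \<le> t" for t using assms that by (simp add: forced_path_def)
  show "continuous_on {0..} w"
    unfolding continuous_on_eq_continuous_within
    using deriv has_vector_derivative_continuous by fastforce
qed (use assms in \<open>auto simp: forced_path_def\<close>)

text \<open>Two errors separate w from the exponential sum: the initial value of the sum, and the
  forcing error up to time T + 1. Each is made at most \<tau> / 2. The forcing error comes from the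
  approximation and from a short layer near 0 where the cutoff deviates from 1; the latter is small
  only in the mean, which is enough because \<open>norm_growth_le\<close> integrates it.\<close>

lemma periodic_approximation:
  assumes "0 < \<beta>" "0 \<le> T" "0 < \<tau>"
    and path: "forced_path u w"
  obtains L and I :: "int set" and c v where
    "T + 2 \<le> L" "finite I" "\<And>n. c n \<in> domChat" "\<And>n. v n \<in> domAc"
    "\<And>n. line_freq \<beta> L n *\<^sub>C v n - Ac (v n) = (0, 0, damping_term (c n))"
    "\<And>t. t \<in> {0..T + 1} \<Longrightarrow> norm (w t - (\<Sum>n\<in>I. exp (t *\<^sub>R line_freq \<beta> L n) *\<^sub>C v n)) \<le> \<tau>"
    "\<And>t h. t \<in> {0..T} \<Longrightarrow> h \<in> {0..1} \<Longrightarrow>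
      integral {t..t + h} (\<lambda>s. w s - (\<Sum>n\<in>I. exp (s *\<^sub>R line_freq \<beta> L n) *\<^sub>C v n)) \<in> domAc \<and>
      norm (Ac (integral {t..t + h} (\<lambda>s. w s - (\<Sum>n\<in>I. exp (s *\<^sub>R line_freq \<beta> L n) *\<^sub>C v n)))) \<le> 3 * \<tau>"
    "L * (\<Sum>n\<in>I. (norm (Ds (c n)))\<^sup>2) \<le> 2 * integral {0..T + 2} (\<lambda>t. (norm (Ds (u t)))\<^sup>2) + \<tau>"
proof -
  note u = forced_pathD(1-3)[OF path] and w = forced_pathD(4-7)[OF path]
  obtain K where K: "0 < K" "\<And>u. u \<in> domChat \<Longrightarrow> norm (damping_term u) \<le> K * norm (u, Chat u)"
    using damping_term_bound by blast
  have "bounded ((\<lambda>t. (u t, Chat (u t))) ` {0..T + 2})"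
    by (intro compact_imp_bounded compact_continuous_image continuous_on_subset[OF u(1)]) auto
  then obtain P where P: "0 < P" "\<And>t. t \<in> {0..T + 2} \<Longrightarrow> norm (u t, Chat (u t)) \<le> P"
    unfolding bounded_pos by auto
  define S where "S = K * P"
  have "0 < S" using K(1) P(1) by (simp add: S_def)
  have S: "norm (damping_term (u t)) \<le> S" if "t \<in> {0..T + 2}" for t
  proof -
    have "norm (damping_term (u t)) \<le> K * norm (u t, Chat (u t))" using that by (intro K(2) u(2)) simp
    also have "\<dots> \<le> S" unfolding S_def using P(2)[OF that] K(1) by (intro mult_left_mono) simp_all
    finally show ?thesis .
  qed
  \<comment> \<open>S bounds the forcing independently of L, so L can be chosen before the
    approximation.\<close>
  obtain L where L: "T + 2 \<le> L" "0 < L" "L * S \<le> \<tau> / 4 * (exp (\<beta> * L) - 1)"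
    using exists_long_period[OF \<open>0 < \<beta>\<close> \<open>0 < S\<close>, of "\<tau> / 4"] \<open>0 < \<tau>\<close> by auto
  define E where "E = exp (\<beta> * L)"
  have "1 < E" using \<open>0 < \<beta>\<close> L(2) by (simp add: E_def)
  \<comment> \<open>The first two entries give 2 L \<epsilon>^2 \<le> \<tau> for the energy bound,
    the third bounds the accumulated forcing error, the last the error in the initial value. The
    factor E is the price of undoing the weight over a whole period.\<close>
  define \<epsilon> where "\<epsilon> = Min {1, \<tau> / (2 * L), \<tau> / 4 / (K * E * L), \<tau> / 4 * (E - 1) / (K * E * L)}"
  have KEL: "0 < K * E * L" using K(1) \<open>1 < E\<close> L(2) by simp
  have "0 < \<epsilon>" using \<open>0 < \<tau>\<close> L(2) KEL \<open>1 < E\<close> by (simp add: \<epsilon>_def)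
  have "\<epsilon> \<le> 1" "\<epsilon> \<le> \<tau> / (2 * L)" "\<epsilon> \<le> \<tau> / 4 / (K * E * L)" "\<epsilon> \<le> \<tau> / 4 * (E - 1) / (K * E * L)"
    by (simp_all add: \<epsilon>_def)
  then have \<epsilon>: "\<epsilon> \<le> 1" "2 * L * \<epsilon> \<le> \<tau>" "K * E * \<epsilon> * L \<le> \<tau> / 4" "K * E * \<epsilon> * L \<le> \<tau> / 4 * (E - 1)"
    using L(2) KEL by (simp_all only: pos_le_divide_eq[OF KEL]) (simp_all add: field_simps)
  define \<eta> where "\<eta> = \<tau> / (4 * S)"
  have "0 < \<eta>" and S\<eta>: "S * \<eta> = \<tau> / 4" using \<open>0 < \<tau>\<close> \<open>0 < S\<close> by (simp_all add: \<eta>_def)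
  \<comment> \<open>Vanishes at 0 and from T + 2 on, which makes f periodic. The exponential layer
    has width \<eta>, and S \<eta> = \<tau> / 4 is what it can add to the norm of the difference. Up
    to T + 1 the ramp is inactive.\<close>
  define \<kappa> where "\<kappa> t = (1 - exp (- t / \<eta>)) * max 0 (min 1 (T + 2 - t))" for t
  have \<kappa>: "0 \<le> \<kappa> t" "\<kappa> t \<le> 1" if "0 \<le> t" for t
    using that \<open>0 < \<eta>\<close> by (auto simp: \<kappa>_def intro!: mult_le_one)
  have \<kappa>0: "\<kappa> 0 = 0" "\<And>t. T + 2 \<le> t \<Longrightarrow> \<kappa> t = 0" by (simp_all add: \<kappa>_def)
  have \<kappa>1: "\<kappa> t = 1 - exp (- t / \<eta>)" if "t \<le> T + 1" for t
    using that by (simp add: \<kappa>_def)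
  have \<kappa>_cont: "continuous_on X \<kappa>" for X
    unfolding \<kappa>_def using \<open>0 < \<eta>\<close> by (intro continuous_intros) auto
  define f where "f t = (exp (- (\<beta> * t)) * \<kappa> t) *\<^sub>R (u t, Chat (u t))" for t
  \<comment> \<open>Approximating inside the graph yields one set of coefficients that serves for u
    and \<open>Chat u\<close>, and hence for the damping term and for \<open>Ds\<close>.\<close>
  define Gr where "Gr = {(c, Chat c) | c. c \<in> domChat}"
  have f_cont: "continuous_on {0..L} f"
    unfolding f_def by (intro continuous_intros \<kappa>_cont continuous_on_subset[OF u(1)]) auto
  have f_per: "f 0 = f L" using \<kappa>0 L(1) by (simp add: f_def)
  have f_mem: "f t \<in> Gr" if "t \<in> {0..L}" for t
    unfolding f_def Gr_def using linear_operator_scaleR[OF Chat_linear u(2)] that by force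
  have Gr_zero: "0 \<in> Gr" unfolding Gr_def using linear_operator_zero[OF Chat_linear]
    by (force simp: zero_prod_def)
  have Gr_add: "x + y \<in> Gr" if "x \<in> Gr" "y \<in> Gr" for x y
    using that linear_operator_add[OF Chat_linear] unfolding Gr_def by force
  have Gr_scale: "a *\<^sub>C x \<in> Gr" if "x \<in> Gr" for a x
    using that linear_operator_scaleC[OF Chat_linear] unfolding Gr_def
    by (force simp: scaleC_prod_def)
  obtain I :: "int set" and cc where I: "finite I" "\<And>n. cc n \<in> Gr"
    and approx: "\<And>t. t \<in> {0..L} \<Longrightarrow> norm (f t - (\<Sum>n\<in>I. cis (2 * pi * n * t / L) *\<^sub>C cc n)) \<le> \<epsilon>"
    by (rule trigonometric_approximation[OF L(2) f_cont f_per \<open>0 < \<epsilon>\<close> Gr_zero])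
      (erule (1) Gr_add, erule Gr_scale, erule f_mem, rule that)
  define c where "c n = fst (cc n)" for n
  have c: "c n \<in> domChat" "cc n = (c n, Chat (c n))" for n
    using I(2)[of n] by (auto simp: c_def Gr_def)
  define Z where "Z t = (\<Sum>n\<in>I. cis (2 * pi * n * t / L) *\<^sub>C c n)" for t
  have Z: "Z t \<in> domChat" "Chat (Z t) = (\<Sum>n\<in>I. cis (2 * pi * n * t / L) *\<^sub>C Chat (c n))"
      "damping_term (Z t) = (\<Sum>n\<in>I. cis (2 * pi * n * t / L) *\<^sub>C damping_term (c n))" for t
    unfolding Z_def
    by (rule linear_operator_combination[OF Chat_linear c(1)]
        linear_operator_combination[OF damping_term_linear c(1)])+
  \<comment> \<open>The approximation error before the weight is undone.\<close>
  define x where "x t = (exp (- (\<beta> * t)) * \<kappa> t) *\<^sub>R u t - Z t" for t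
  have x: "x t \<in> domChat" "norm (x t, Chat (x t)) \<le> \<epsilon>"
      "damping_term (x t) = (exp (- (\<beta> * t)) * \<kappa> t) *\<^sub>R damping_term (u t) - damping_term (Z t)"
      "Ds (x t) = (exp (- (\<beta> * t)) * \<kappa> t) *\<^sub>R Ds (u t) - Ds (Z t)" if "t \<in> {0..L}" for t
  proof -
    have ut: "u t \<in> domChat" using that u(2) by simp
    note su = linear_operator_scaleR[OF Chat_linear ut]
    show "x t \<in> domChat" unfolding x_def by (rule linear_operator_diff[OF Chat_linear su(1) Z(1)])
    have "f t - (\<Sum>n\<in>I. cis (2 * pi * n * t / L) *\<^sub>C cc n) = (x t, Chat (x t))"
      by (simp add: prod_eq_iff fst_sum snd_sum c scaleC_prod_def f_def x_def Z
          linear_operator_diff(2)[OF Chat_linear su(1) Z(1)] su(2)) (simp add: Z_def)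
    then show "norm (x t, Chat (x t)) \<le> \<epsilon>" using approx[OF that] by simp
    show "damping_term (x t) = (exp (- (\<beta> * t)) * \<kappa> t) *\<^sub>R damping_term (u t) - damping_term (Z t)"
      unfolding x_def linear_operator_diff(2)[OF damping_term_linear su(1) Z(1)]
      by (simp only: linear_operator_scaleR(2)[OF damping_term_linear ut])
    have "u t \<in> domC" "(exp (- (\<beta> * t)) * \<kappa> t) *\<^sub>R u t \<in> domC" "Z t \<in> domC"
      using ut su(1) Z(1) domChat_subset by blast+
    then show "Ds (x t) = (exp (- (\<beta> * t)) * \<kappa> t) *\<^sub>R Ds (u t) - Ds (Z t)"
      unfolding x_def using Ds_linear Ds_scaleC[of "u t" "of_real (exp (- (\<beta> * t)) * \<kappa> t)"]
      by (simp only: scaleC_of_real)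
  qed
  define F where "F t = exp (\<beta> * t) *\<^sub>R damping_term (Z t)" for t
  have F_close: "norm (\<kappa> t *\<^sub>R damping_term (u t) - F t) \<le> K * E * \<epsilon>" if "t \<in> {0..L}" for t
  proof -
    have "\<kappa> t *\<^sub>R damping_term (u t) - F t = exp (\<beta> * t) *\<^sub>R damping_term (x t)"
      by (simp add: x(3)[OF that] F_def scaleR_right_diff_distrib exp_minus)
    also have "norm \<dots> = exp (\<beta> * t) * norm (damping_term (x t))" by simp
    also have "\<dots> \<le> E * (K * \<epsilon>)"
    proof (rule mult_mono)
      show "exp (\<beta> * t) \<le> E" unfolding E_def using that \<open>0 < \<beta>\<close> by simp
      have "norm (damping_term (x t)) \<le> K * norm (x t, Chat (x t))" by (rule K(2)[OF x(1)[OF that]])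
      also have "\<dots> \<le> K * \<epsilon>" using x(2)[OF that] K(1) by (intro mult_left_mono) simp_all
      finally show "norm (damping_term (x t)) \<le> K * \<epsilon>" .
    qed (use \<open>1 < E\<close> in simp_all)
    finally show ?thesis by (simp add: mult_ac)
  qed
  have F_bound: "norm (F t) \<le> S + K * E * \<epsilon>" if "t \<in> {0..L}" for t
  proof -
    have "norm (\<kappa> t *\<^sub>R damping_term (u t)) \<le> S"
    proof (cases "t \<le> T + 2")
      case True
      then have "\<kappa> t * norm (damping_term (u t)) \<le> 1 * S"
        using that \<kappa> S \<open>0 < S\<close> by (intro mult_mono) simp_all
      then show ?thesis using \<kappa> that by simp
    qed (use \<kappa>0 \<open>0 < S\<close> in simp)
    then show ?thesis
      using F_close[OF that] norm_triangle_ineq4[of "\<kappa> t *\<^sub>R damping_term (u t)" "\<kappa> t *\<^sub>R damping_term (u t) - F t"]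
      by simp
  qed
  have "\<exists>v. v \<in> domAc \<and> line_freq \<beta> L n *\<^sub>C v - Ac v = (0, 0, damping_term (c n))" for n
    using skew_adjoint_surj[OF Ac_skew_adjoint, of "line_freq \<beta> L n"] \<open>0 < \<beta>\<close> by (metis Re_line_freq)
  then obtain v where v: "\<And>n. v n \<in> domAc"
      "\<And>n. line_freq \<beta> L n *\<^sub>C v n - Ac (v n) = (0, 0, damping_term (c n))"
    by metis
  define V where "V t = (\<Sum>n\<in>I. exp (t *\<^sub>R line_freq \<beta> L n) *\<^sub>C v n)" for t
  have V: "V t \<in> domAc" "Ac (V t) = (\<Sum>n\<in>I. exp (t *\<^sub>R line_freq \<beta> L n) *\<^sub>C Ac (v n))" for t
    unfolding V_def by (rule linear_operator_combination[OF Ac_linear v(1)])+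
  have V_deriv: "(V has_vector_derivative Ac (V t) + (0, 0, F t)) (at t within X)" for t X
  proof -
    have "(V has_vector_derivative (\<Sum>n\<in>I. exp (t *\<^sub>R line_freq \<beta> L n) *\<^sub>C (line_freq \<beta> L n *\<^sub>C v n))) (at t within X)"
      unfolding V_def by (intro has_vector_derivative_sum has_vector_derivative_exp_scaleC)
    also have "(\<Sum>n\<in>I. exp (t *\<^sub>R line_freq \<beta> L n) *\<^sub>C (line_freq \<beta> L n *\<^sub>C v n))
        = Ac (V t) + (\<Sum>n\<in>I. exp (t *\<^sub>R line_freq \<beta> L n) *\<^sub>C (0, 0, damping_term (c n)))"
      by (simp add: V(2) scaleC_diff_right sum_subtractf flip: v(2))
    also have "(\<Sum>n\<in>I. exp (t *\<^sub>R line_freq \<beta> L n) *\<^sub>C (0 :: 'v, 0 :: 'x, damping_term (c n))) = (0, 0, F t)"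
      by (simp add: prod_eq_iff fst_sum snd_sum scaleC_prod_def F_def Z exp_line_freq_scaleC scaleR_sum_right)
    finally show ?thesis .
  qed
  have V_cont: "continuous_on X V" "continuous_on X (\<lambda>t. Ac (V t))" for X
  proof -
    show "continuous_on X V" unfolding V_def[abs_def] by (intro continuous_intros)
    show "continuous_on X (\<lambda>t. Ac (V t))" unfolding V(2) by (intro continuous_intros)
  qed
  \<comment> \<open>Over one period the norm grows by at most L (S + K E \<epsilon>), while the
    solution is multiplied by E. Hence (E - 1) times the initial norm is at most this
    growth.\<close>
  have V0: "norm (V 0) \<le> \<tau> / 2"
  proof -
    have "norm (V L) \<le> norm (V 0) + ((S + K * E * \<epsilon>) * L - (S + K * E * \<epsilon>) * 0)"
    proof (rule norm_growth_le[OF less_imp_le[OF L(2)] V_deriv])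
      show "((\<lambda>t. (S + K * E * \<epsilon>) * t) has_real_derivative S + K * E * \<epsilon>) (at t within {0..L})" for t
        by (auto intro!: derivative_eq_intros)
      show "0 \<le> S + K * E * \<epsilon>" using \<open>0 < S\<close> K(1) \<open>1 < E\<close> \<open>0 < \<epsilon>\<close> by simp
    qed (intro Re_cinner_forced_le V F_bound)
    moreover have "V L = E *\<^sub>R V 0"
      by (simp add: V_def exp_line_freq_period[OF L(2)] scaleC_of_real E_def scaleR_sum_right)
    ultimately have "E * norm (V 0) \<le> norm (V 0) + (L * S + K * E * \<epsilon> * L)"
      using \<open>1 < E\<close> by (simp add: algebra_simps)
    then have "(E - 1) * norm (V 0) \<le> \<tau> / 4 * (E - 1) + \<tau> / 4 * (E - 1)"
      using L(3) \<epsilon>(4) unfolding E_def[symmetric] by (simp add: algebra_simps)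
    then have "(E - 1) * norm (V 0) \<le> (E - 1) * (\<tau> / 2)" by (simp add: algebra_simps)
    then show ?thesis using \<open>1 < E\<close> by simp
  qed
  define d where "d t = w t - V t" for t
  define g where "g t = damping_term (u t) - F t" for t
  \<comment> \<open>A primitive of b', which bounds the forcing error: a uniform part from the
    approximation and a decaying part from the layer of the cutoff.\<close>
  define b where "b t = K * E * \<epsilon> * t - S * \<eta> * exp (- t / \<eta>)" for t
  define b' where "b' t = K * E * \<epsilon> + S * exp (- t / \<eta>)" for t
  have b: "(b has_real_derivative b' t) (at t within X)" for t X
    unfolding b_def b'_def using \<open>0 < \<eta>\<close> by (auto intro!: derivative_eq_intros)
  have b'_nonneg: "0 \<le> b' t" for t
    using \<open>0 < S\<close> K(1) \<open>1 < E\<close> \<open>0 < \<epsilon>\<close> by (simp add: b'_def)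
  have b_diff: "b t - b s \<le> \<tau> / 2" if "0 \<le> s" "s \<le> t" "t \<le> T + 1" for s t
  proof -
    have "b t - b s = K * E * \<epsilon> * (t - s) + S * \<eta> * (exp (- s / \<eta>) - exp (- t / \<eta>))"
      by (simp add: b_def algebra_simps)
    also have "\<dots> \<le> K * E * \<epsilon> * L + S * \<eta> * 1"
    proof (intro add_mono mult_left_mono)
      have "exp (- s / \<eta>) \<le> 1" using that \<open>0 < \<eta>\<close> by simp
      then show "exp (- s / \<eta>) - exp (- t / \<eta>) \<le> 1" using exp_ge_zero[of "- t / \<eta>"] by linarith
    qed (use that L(1) \<open>0 < S\<close> K(1) \<open>1 < E\<close> \<open>0 < \<epsilon>\<close> \<open>0 < \<eta>\<close> in simp_all)
    finally show ?thesis using \<epsilon>(3) S\<eta> by simp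
  qed
  have g: "norm (g t) \<le> b' t" if "t \<in> {0..T + 1}" for t
  proof -
    have "g t = (\<kappa> t *\<^sub>R damping_term (u t) - F t) + exp (- t / \<eta>) *\<^sub>R damping_term (u t)"
      using that by (simp add: g_def \<kappa>1 scaleR_left_diff_distrib)
    also have "norm \<dots> \<le> K * E * \<epsilon> + exp (- t / \<eta>) * S"
      using F_close[of t] S[of t] that L(1)
      by (intro norm_triangle_le add_mono) (simp_all add: mult_left_mono)
    finally show ?thesis by (simp add: b'_def mult.commute)
  qed
  have d_dom: "d t \<in> domAc" and Ac_d: "Ac (d t) = Ac (w t) - Ac (V t)" if "0 \<le> t" for t
    unfolding d_def by (rule linear_operator_diff[OF Ac_linear w(2)[OF that] V(1)])+
  have d_deriv: "(d has_vector_derivative Ac (d t) + (0, 0, g t)) (at t within X)"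
    if "0 \<le> t" "X \<subseteq> {0..}" for t X
  proof -
    have "(d has_vector_derivative Ac (w t) + (0, 0, damping_term (u t)) - (Ac (V t) + (0, 0, F t))) (at t within X)"
      unfolding d_def using that
      by (intro has_vector_derivative_diff has_vector_derivative_within_subset[OF w(4)] V_deriv)
    also have "Ac (w t) + (0, 0, damping_term (u t)) - (Ac (V t) + (0, 0, F t)) = Ac (d t) + (0, 0, g t)"
      by (simp add: Ac_d[OF that(1)] g_def prod_eq_iff)
    finally show ?thesis .
  qed
  have d_bound: "norm (d t) \<le> \<tau>" if "t \<in> {0..T + 1}" for t
  proof -
    have "norm (d t) \<le> norm (d 0) + (b t - b 0)"
    proof (rule norm_growth_le[OF _ _ b b'_nonneg])
      fix s assume s: "s \<in> {0..t}"
      then show "(d has_vector_derivative Ac (d s) + (0, 0, g s)) (at s within {0..t})"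
        by (intro d_deriv) auto
      show "Re (cinner (Ac (d s) + (0, 0, g s)) (d s)) \<le> b' s * norm (d s)"
        using s that by (intro Re_cinner_forced_le d_dom g) auto
    qed (use that in simp)
    also have "norm (d 0) \<le> \<tau> / 2" using V0 by (simp add: d_def w(1))
    also have "b t - b 0 \<le> \<tau> / 2" using that by (intro b_diff) simp_all
    finally show ?thesis by simp
  qed
  have d_cont: "continuous_on X d" "continuous_on X (\<lambda>t. Ac (d t))" if "X \<subseteq> {0..}" for X
  proof -
    show "continuous_on X d"
      unfolding continuous_on_eq_continuous_within
      using d_deriv[OF _ that] that by (fastforce intro: has_vector_derivative_continuous)
    have "continuous_on X (\<lambda>t. Ac (w t) - Ac (V t))"
      by (intro continuous_intros continuous_on_subset[OF w(3) that] V_cont)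
    then show "continuous_on X (\<lambda>t. Ac (d t))"
      by (rule continuous_on_eq) (use that in \<open>auto simp: Ac_d\<close>)
  qed
  have avg: "integral {t..t + h} d \<in> domAc \<and> norm (Ac (integral {t..t + h} d)) \<le> 3 * \<tau>"
    if "t \<in> {0..T}" "h \<in> {0..1}" for t h
  proof -
    have sub: "{t..t + h} \<subseteq> {0..}" using that by auto
    define J where "J s = integral {t..s} (\<lambda>s. Ac (d s))" for s
    have int: "integral {t..t + h} d \<in> domAc \<and> Ac (integral {t..t + h} d) = J (t + h)"
      unfolding J_def using that
      by (intro skew_adjoint_integral[OF Ac_skew_adjoint] d_cont sub d_dom) auto
    \<comment> \<open>The equation integrated over the window: the increment of d minus
      \<open>Ac\<close> of the integral is the integral of the forcing error, at most \<tau> / 2.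
      The increment itself is at most 2 \<tau>, so \<open>Ac\<close> of the average is small
      although \<open>Ac (d t)\<close> need not be.\<close>
    have "norm ((d (t + h) - d t) - J (t + h)) \<le> norm ((d t - d t) - J t) + (b (t + h) - b t)"
    proof (rule norm_growth_le[OF _ _ b b'_nonneg])
      fix s assume s: "s \<in> {t..t + h}"
      have "(J has_vector_derivative Ac (d s)) (at s within {t..t + h})"
        unfolding J_def by (rule integral_has_vector_derivative[OF d_cont(2)[OF sub] s])
      moreover have "(d has_vector_derivative Ac (d s) + (0, 0, g s)) (at s within {t..t + h})"
        using s sub by (intro d_deriv) auto
      ultimately show "((\<lambda>s. (d s - d t) - J s) has_vector_derivative (0, 0, g s)) (at s within {t..t + h})"
        by (auto intro!: derivative_eq_intros)
      have "Re (cinner (0, 0, g s) ((d s - d t) - J s)) \<le> norm (0 :: 'v, 0 :: 'x, g s) * norm ((d s - d t) - J s)"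
        by (rule Re_cinner_le)
      also have "\<dots> \<le> b' s * norm ((d s - d t) - J s)"
        using g[of s] s that by (intro mult_right_mono) (simp_all add: norm_Pair)
      finally show "Re (cinner (0, 0, g s) ((d s - d t) - J s)) \<le> b' s * norm ((d s - d t) - J s)" .
    qed (use that in simp)
    also have "\<dots> \<le> \<tau> / 2" using that b_diff[of t "t + h"] by (simp add: J_def)
    finally have "norm (J (t + h)) \<le> \<tau> / 2 + norm (d (t + h) - d t)"
      using norm_triangle_ineq4[of "d (t + h) - d t" "(d (t + h) - d t) - J (t + h)"] by simp
    also have "norm (d (t + h) - d t) \<le> \<tau> + \<tau>"
      using that by (intro order_trans[OF norm_triangle_ineq4] add_mono d_bound) auto
    finally show ?thesis using int \<open>0 < \<tau>\<close> by simp
  qed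
  have energy: "L * (\<Sum>n\<in>I. (norm (Ds (c n)))\<^sup>2) \<le> 2 * integral {0..T + 2} (\<lambda>t. (norm (Ds (u t)))\<^sup>2) + \<tau>"
  proof -
    have cC: "c n \<in> domC" for n using c(1) domChat_subset by blast
    have DsZ: "Ds (Z t) = (\<Sum>n\<in>I. cis (2 * pi * n * t / L) *\<^sub>C Ds (c n))" for t
      unfolding Z_def using Ds_sum[OF linear_operator_scaleC(1)[OF C_linear cC]] Ds_scaleC[OF cC] by simp
    define \<psi> where "\<psi> t = (norm (\<kappa> t *\<^sub>R Ds (u t)))\<^sup>2" for t
    have \<psi>_cont: "continuous_on X \<psi>" if "X \<subseteq> {0..}" for X
      unfolding \<psi>_def by (intro continuous_intros \<kappa>_cont continuous_on_subset[OF u(3) that])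
    have Ds_int: "((\<lambda>t. (norm (Ds (Z t)))\<^sup>2) has_integral L * (\<Sum>n\<in>I. (norm (Ds (c n)))\<^sup>2)) {0..L}"
      unfolding DsZ by (rule has_integral_norm_sq_trigonometric[OF L(2) I(1)])
    have le: "(norm (Ds (Z t)))\<^sup>2 \<le> 2 * \<psi> t + 2 * \<epsilon>\<^sup>2" if t: "t \<in> {0..L}" for t
    proof -
      have "Ds (Z t) = (exp (- (\<beta> * t)) * \<kappa> t) *\<^sub>R Ds (u t) - Ds (x t)" by (simp add: x(4)[OF t])
      then have "norm (Ds (Z t)) \<le> exp (- (\<beta> * t)) * norm (\<kappa> t *\<^sub>R Ds (u t)) + norm (Ds (x t))"
        using norm_triangle_ineq4[of "(exp (- (\<beta> * t)) * \<kappa> t) *\<^sub>R Ds (u t)" "Ds (x t)"]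
        by (simp add: abs_mult mult.assoc)
      \<comment> \<open>Dropping the weight here keeps the energy bound free of exponentials of
        \<beta>.\<close>
      also have "exp (- (\<beta> * t)) * norm (\<kappa> t *\<^sub>R Ds (u t)) \<le> norm (\<kappa> t *\<^sub>R Ds (u t))"
        using t \<open>0 < \<beta>\<close> by (intro mult_left_le_one_le) simp_all
      also have "norm (Ds (x t)) \<le> \<epsilon>" using norm_Ds_le[OF x(1)[OF t]] x(2)[OF t] by simp
      finally have "(norm (Ds (Z t)))\<^sup>2 \<le> (norm (\<kappa> t *\<^sub>R Ds (u t)) + \<epsilon>)\<^sup>2" by (intro power_mono) simp_all
      also have "\<dots> \<le> 2 * \<psi> t + 2 * \<epsilon>\<^sup>2"
        using sum_squares_bound[of "norm (\<kappa> t *\<^sub>R Ds (u t))" \<epsilon>] by (simp add: \<psi>_def power2_sum)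
      finally show ?thesis .
    qed
    have "L * (\<Sum>n\<in>I. (norm (Ds (c n)))\<^sup>2) = integral {0..L} (\<lambda>t. (norm (Ds (Z t)))\<^sup>2)"
      using Ds_int by (simp add: integral_unique)
    also have "\<dots> \<le> integral {0..L} (\<lambda>t. 2 * \<psi> t + 2 * \<epsilon>\<^sup>2)"
      by (rule integral_le[OF has_integral_integrable[OF Ds_int]])
        (use le in \<open>auto intro!: integrable_continuous_real continuous_intros \<psi>_cont\<close>)
    also have "\<dots> = 2 * integral {0..L} \<psi> + 2 * L * \<epsilon>\<^sup>2"
    proof -
      have "\<psi> integrable_on {0..L}" by (intro integrable_continuous_real \<psi>_cont) auto
      then show ?thesis using L(2) by (subst integral_add) auto
    qed
    also have "2 * L * \<epsilon>\<^sup>2 \<le> \<tau>"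
    proof -
      have "2 * L * \<epsilon>\<^sup>2 = 2 * L * \<epsilon> * \<epsilon>" by (simp add: power2_eq_square)
      also have "\<dots> \<le> 2 * L * \<epsilon> * 1" using \<epsilon>(1) L(2) \<open>0 < \<epsilon>\<close> by (intro mult_left_mono) simp_all
      finally show ?thesis using \<epsilon>(2) by simp
    qed
    also have "integral {0..L} \<psi> \<le> integral {0..T + 2} (\<lambda>t. (norm (Ds (u t)))\<^sup>2)"
    proof -
      have "integral {0..L} \<psi> = integral {0..T + 2} \<psi> + integral {T + 2..L} \<psi>"
        using \<open>0 \<le> T\<close> L(1)
        by (intro Henstock_Kurzweil_Integration.integral_combine[symmetric] integrable_continuous_real \<psi>_cont) auto
      also have "integral {T + 2..L} \<psi> = integral {T + 2..L} (\<lambda>t. 0)"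
        using \<kappa>0(2) by (intro integral_cong) (simp add: \<psi>_def)
      also have "integral {0..T + 2} \<psi> \<le> integral {0..T + 2} (\<lambda>t. (norm (Ds (u t)))\<^sup>2)"
      proof (intro integral_le integrable_continuous_real \<psi>_cont continuous_intros continuous_on_subset[OF u(3)])
        fix t assume "t \<in> {0..T + 2}"
        then show "\<psi> t \<le> (norm (Ds (u t)))\<^sup>2"
          unfolding \<psi>_def using \<kappa>[of t] by (intro power_mono) (simp_all add: mult_left_le_one_le)
      qed auto
      finally show ?thesis by simp
    qed
    finally show ?thesis by simp
  qed
  show ?thesis
    using L(1) I(1) c(1) v d_bound[unfolded d_def V_def] avg[unfolded d_def[abs_def] V_def] energy
    by (rule that)
qed

text \<open>The approximations converge only in the energy norm.  Averaging in time turns this into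
  convergence in the graph norm, and it does not spoil the bound on the Fourier coefficients.\<close>

lemma transfer_estimate:
  assumes "0 < \<beta>" "0 \<le> M" "0 \<le> T"
    and M: "\<And>l c v. Re l = \<beta> \<Longrightarrow> c \<in> domChat \<Longrightarrow> v \<in> domAc \<Longrightarrow>
      l *\<^sub>C v - Ac v = (0, 0, damping_term c) \<Longrightarrow> norm (Dsu v) \<le> M * norm (Ds c)"
    and path: "forced_path u w"
  shows "integral {0..T} (\<lambda>t. (norm (Dsu (w t)))\<^sup>2)
    \<le> 4 * (exp (\<beta> * (T + 1)) * M)\<^sup>2 * integral {0..T + 2} (\<lambda>t. (norm (Ds (u t)))\<^sup>2)"
proof (rule field_le_epsilon)
  fix e :: real assume "0 < e"
  note u = forced_pathD(1-3)[OF path] and w = forced_pathD(4-7)[OF path]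
    and w_cont = forced_pathD(8)[OF path]
  obtain K where K: "0 < K" "\<And>z. z \<in> domAc \<Longrightarrow> norm (Dsu z) \<le> K * norm (z, Ac z)"
    using Ds_bound_Ac by blast
  have K2: "norm (Dsu z) \<le> K * (norm z + norm (Ac z))" if "z \<in> domAc" for z
    using K(1) by (intro order_trans[OF K(2)[OF that]] mult_left_mono norm_Pair_le) simp
  define N where "N = (exp (\<beta> * (T + 1)) * M)\<^sup>2"
  have "0 \<le> N" by (simp add: N_def)
  \<comment> \<open>The admissible pointwise error of the output. Its square is integrated over
    [0, T] with a factor 2 and must stay below e / 2.\<close>
  define r where "r = min 1 (e / (4 * (T + 1)))"
  have "0 < r" "r \<le> 1" using \<open>0 < e\<close> \<open>0 \<le> T\<close> by (simp_all add: r_def)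
  have "r * (4 * (T + 1)) \<le> e" using \<open>0 \<le> T\<close> by (simp add: r_def pos_le_divide_eq[symmetric])
  then have r: "2 * r\<^sup>2 * T \<le> e / 2"
  proof -
    have "r\<^sup>2 * T \<le> r * 1 * (T + 1)"
      using \<open>0 < r\<close> \<open>r \<le> 1\<close> \<open>0 \<le> T\<close> unfolding power2_eq_square by (intro mult_mono) simp_all
    with \<open>r * (4 * (T + 1)) \<le> e\<close> show ?thesis by (simp add: algebra_simps)
  qed
  define \<kappa> where "\<kappa> = r / (4 * K)"
  have "0 < \<kappa>" using \<open>0 < r\<close> K(1) by (simp add: \<kappa>_def)
  have "uniformly_continuous_on {0..T + 1} (\<lambda>t. (w t, Ac (w t)))"
    by (intro compact_uniformly_continuous continuous_intros continuous_on_subset[OF w(3)]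
        continuous_on_subset[OF w_cont]) auto
  then obtain \<rho> where \<rho>: "0 < \<rho>" "\<And>s t. s \<in> {0..T + 1} \<Longrightarrow> t \<in> {0..T + 1} \<Longrightarrow> dist s t < \<rho> \<Longrightarrow>
      dist (w s, Ac (w s)) (w t, Ac (w t)) < \<kappa>"
    using \<open>0 < \<kappa>\<close> unfolding uniformly_continuous_on_def by metis
  \<comment> \<open>The window must be short enough for w to be nearly constant in the graph norm,
    and it is fixed before \<tau> because the approximation error is divided by h.\<close>
  define h where "h = min 1 (\<rho> / 2)"
  have h: "0 < h" "h \<le> 1" "h < \<rho>" using \<rho>(1) by (simp_all add: h_def min_def)
  \<comment> \<open>The first entry makes the averaged error, which has graph norm at most \<tau> +
    3 \<tau>, contribute at most h r / 2 to the output. The second absorbs the \<tau> in the energy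
    bound after multiplication by 2 N.\<close>
  define \<tau> where "\<tau> = min (h * r / (8 * K)) (e / (4 * (N + 1)))"
  have "0 < \<tau>" using h(1) \<open>0 < r\<close> K(1) \<open>0 < e\<close> \<open>0 \<le> N\<close> by (simp add: \<tau>_def)
  have "\<tau> \<le> h * r / (8 * K)" "\<tau> \<le> e / (4 * (N + 1))" by (simp_all add: \<tau>_def)
  then have \<tau>: "K * (4 * \<tau>) \<le> h * (r / 2)" "2 * N * \<tau> \<le> e / 2"
  proof -
    assume "\<tau> \<le> h * r / (8 * K)" "\<tau> \<le> e / (4 * (N + 1))"
    then have "\<tau> * (8 * K) \<le> h * r" "\<tau> * (4 * (N + 1)) \<le> e"
      using K(1) \<open>0 \<le> N\<close> by (simp_all add: pos_le_divide_eq)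
    then show "K * (4 * \<tau>) \<le> h * (r / 2)" "2 * N * \<tau> \<le> e / 2"
      using \<open>0 < \<tau>\<close> by (simp_all add: algebra_simps)
  qed
  obtain L and I :: "int set" and c v where L: "T + 2 \<le> L" and I: "finite I"
    and c: "\<And>n. c n \<in> domChat" and v: "\<And>n. v n \<in> domAc"
      "\<And>n. line_freq \<beta> L n *\<^sub>C v n - Ac (v n) = (0, 0, damping_term (c n))"
    and d: "\<And>t. t \<in> {0..T + 1} \<Longrightarrow> norm (w t - (\<Sum>n\<in>I. exp (t *\<^sub>R line_freq \<beta> L n) *\<^sub>C v n)) \<le> \<tau>"
    and avg: "\<And>t h. t \<in> {0..T} \<Longrightarrow> h \<in> {0..1} \<Longrightarrow>
      integral {t..t + h} (\<lambda>s. w s - (\<Sum>n\<in>I. exp (s *\<^sub>R line_freq \<beta> L n) *\<^sub>C v n)) \<in> domAc \<and>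
      norm (Ac (integral {t..t + h} (\<lambda>s. w s - (\<Sum>n\<in>I. exp (s *\<^sub>R line_freq \<beta> L n) *\<^sub>C v n)))) \<le> 3 * \<tau>"
    and energy: "L * (\<Sum>n\<in>I. (norm (Ds (c n)))\<^sup>2) \<le> 2 * integral {0..T + 2} (\<lambda>t. (norm (Ds (u t)))\<^sup>2) + \<tau>"
    using periodic_approximation[OF \<open>0 < \<beta>\<close> \<open>0 \<le> T\<close> \<open>0 < \<tau>\<close> path] by blast
  have "0 < L" using L \<open>0 \<le> T\<close> by simp
  have l_nz: "line_freq \<beta> L n \<noteq> 0" for n using \<open>0 < \<beta>\<close> by (auto simp: complex_eq_iff)
  define V where "V t = (\<Sum>n\<in>I. exp (t *\<^sub>R line_freq \<beta> L n) *\<^sub>C v n)" for t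
  have V_cont: "continuous_on X V" for X unfolding V_def[abs_def] by (intro continuous_intros)
  \<comment> \<open>The multiplier by which averaging over the window acts on the n-th mode.\<close>
  define m where "m n = (exp (h *\<^sub>R line_freq \<beta> L n) - 1) / line_freq \<beta> L n" for n
  have m: "cmod (m n) \<le> h * exp \<beta>" for n
  proof -
    have "cmod (m n) \<le> h * exp (\<beta> * h)"
      using norm_exp_average_le[OF l_nz[of n], of h] h(1) \<open>0 < \<beta>\<close> by (simp add: m_def)
    also have "\<dots> \<le> h * exp \<beta>" using h \<open>0 < \<beta>\<close> by (intro mult_left_mono) simp_all
    finally show ?thesis .
  qed
  have vC: "snd (snd (v n)) \<in> domC" for n by (rule domC_of_domAc[OF v(1)])
  have V_avg: "integral {t..t + h} V = (\<Sum>n\<in>I. exp (t *\<^sub>R line_freq \<beta> L n) *\<^sub>C (m n *\<^sub>C v n))" for t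
    unfolding V_def[abs_def] m_def
    by (intro integral_unique has_integral_sum I has_integral_exp_scaleC l_nz less_imp_le h(1))
  define a where "a n = m n *\<^sub>C Dsu (v n)" for n
  have V_avg_dom: "integral {t..t + h} V \<in> domAc" for t
    unfolding V_avg
    by (rule linear_operator_combination(1)[OF Ac_linear linear_operator_scaleC(1)[OF Ac_linear v(1)]])
  have Ds_V_avg: "Dsu (integral {t..t + h} V)
      = exp (\<beta> * t) *\<^sub>R (\<Sum>n\<in>I. cis (2 * pi * n * t / L) *\<^sub>C a n)" for t
  proof -
    have mem: "m n *\<^sub>C snd (snd (v n)) \<in> domC" "exp (t *\<^sub>R line_freq \<beta> L n) *\<^sub>C (m n *\<^sub>C snd (snd (v n))) \<in> domC" for n
      by (intro linear_operator_scaleC(1)[OF C_linear] vC)+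
    have "snd (snd (integral {t..t + h} V)) = (\<Sum>n\<in>I. exp (t *\<^sub>R line_freq \<beta> L n) *\<^sub>C (m n *\<^sub>C snd (snd (v n))))"
      by (simp add: V_avg snd_sum scaleC_prod_def)
    also have "Ds \<dots> = (\<Sum>n\<in>I. exp (t *\<^sub>R line_freq \<beta> L n) *\<^sub>C a n)"
      using Ds_sum[OF mem(2)] Ds_scaleC[OF mem(1)] Ds_scaleC[OF vC] by (simp add: a_def)
    finally show ?thesis by (simp add: exp_line_freq_scaleC scaleR_sum_right)
  qed
  \<comment> \<open>The output at t is compared with that of the averaged exponential sum in two
    steps: \<open>q\<close> replaces w t by its average, \<open>p\<close> replaces w by the sum
    under the average. Both are small in the graph norm of \<open>Ac\<close>, so \<open>Ds\<close>
    may be applied.\<close>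
  have close: "norm (h *\<^sub>R Dsu (w t)) \<le> h * r + norm (Dsu (integral {t..t + h} V))"
    if t: "t \<in> {0..T}" for t
  proof -
    have sub: "{t..t + h} \<subseteq> {0..T + 1}" using t h by auto
    then have sub0: "{t..t + h} \<subseteq> {0..}" by auto
    note wc = continuous_on_subset[OF w_cont sub0] and Acwc = continuous_on_subset[OF w(3) sub0]
    have near: "norm (w s - w t) \<le> \<kappa>" "norm (Ac (w s) - Ac (w t)) \<le> \<kappa>" if "s \<in> {t..t + h}" for s
    proof -
      have "dist (w s, Ac (w s)) (w t, Ac (w t)) < \<kappa>"
        using that sub t h by (intro \<rho>(2)) (auto simp: dist_norm)
      then have "norm (w s - w t, Ac (w s) - Ac (w t)) \<le> \<kappa>" by (simp add: dist_norm)
      then show "norm (w s - w t) \<le> \<kappa>" "norm (Ac (w s) - Ac (w t)) \<le> \<kappa>"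
        using norm_fst_le[of "w s - w t" "Ac (w s) - Ac (w t)"]
          norm_snd_pair_le[of "(w s - w t, Ac (w s) - Ac (w t))"] by simp_all
    qed
    define Iw where "Iw = integral {t..t + h} w"
    have Iw: "Iw \<in> domAc" "Ac Iw = integral {t..t + h} (\<lambda>s. Ac (w s))"
      unfolding Iw_def using skew_adjoint_integral[OF Ac_skew_adjoint wc _ Acwc] w(2) sub0 by auto
    define q where "q = Iw - h *\<^sub>R w t"
    have wt: "w t \<in> domAc" using t w(2) by simp
    note hw = linear_operator_scaleR[OF Ac_linear wt, of h]
    have "q \<in> domAc" "Ac q = Ac Iw - h *\<^sub>R Ac (w t)"
      unfolding q_def using linear_operator_diff[OF Ac_linear Iw(1) hw(1)] hw(2) by simp_all
    have avg_dev: "norm (integral {t..t + h} g - h *\<^sub>R g t) \<le> \<kappa> * h"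
      if "continuous_on {t..t + h} g" "\<And>s. s \<in> {t..t + h} \<Longrightarrow> norm (g s - g t) \<le> \<kappa>"
      for g :: "real \<Rightarrow> 'v \<times> 'x \<times> 'u"
    proof -
      have "integral {t..t + h} g - h *\<^sub>R g t = integral {t..t + h} (\<lambda>s. g s - g t)"
        using h(1) integrable_continuous_real[OF that(1)]
        by (subst integral_diff) (simp_all add: integrable_continuous_real)
      also have "norm \<dots> \<le> \<kappa> * (t + h - t)"
        using h(1) that by (intro integral_bound continuous_intros) simp_all
      finally show ?thesis by simp
    qed
    have "norm q \<le> \<kappa> * h" unfolding q_def Iw_def by (rule avg_dev[OF wc near(1)])
    moreover have "norm (Ac q) \<le> \<kappa> * h"
      unfolding \<open>Ac q = _\<close> Iw(2) by (rule avg_dev[OF Acwc near(2)])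
    ultimately have "norm (Dsu q) \<le> K * (\<kappa> * h + \<kappa> * h)"
      using K(1) by (intro order_trans[OF K2[OF \<open>q \<in> domAc\<close>]] mult_left_mono add_mono) simp_all
    then have q: "norm (Dsu q) \<le> h * (r / 2)" using K(1) by (simp add: \<kappa>_def)
    define p where "p = Iw - integral {t..t + h} V"
    have p_eq: "p = integral {t..t + h} (\<lambda>s. w s - V s)"
      unfolding p_def Iw_def using wc V_cont
      by (intro integral_diff[symmetric] integrable_continuous_real)
    have p: "p \<in> domAc" "norm (Ac p) \<le> 3 * \<tau>"
      using avg[OF t, of h] h unfolding p_eq V_def by auto
    have "norm p \<le> \<tau> * (t + h - t)"
      unfolding p_eq using h sub d
      by (intro integral_bound continuous_intros wc V_cont) (auto simp: V_def)
    also have "\<dots> \<le> \<tau>" using h \<open>0 < \<tau>\<close> by (simp add: mult_left_le)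
    finally have "norm (Dsu p) \<le> K * (\<tau> + 3 * \<tau>)"
      using K(1) p(2) by (intro order_trans[OF K2[OF p(1)]] mult_left_mono add_mono) simp_all
    then have p_le: "norm (Dsu p) \<le> h * (r / 2)" using \<tau>(1) by simp
    have "Dsu q = Dsu Iw - Dsu (h *\<^sub>R w t)"
      unfolding q_def using Ds_linear[OF domC_of_domAc[OF Iw(1)] domC_of_domAc[OF hw(1)]] by simp
    moreover have "Dsu p = Dsu Iw - Dsu (integral {t..t + h} V)"
      unfolding p_def using Ds_linear[OF domC_of_domAc[OF Iw(1)] domC_of_domAc[OF V_avg_dom]] by simp
    moreover have "Dsu (h *\<^sub>R w t) = h *\<^sub>R Dsu (w t)"
      using Ds_scaleC[OF domC_of_domAc[OF wt], of "of_real h"] by (simp add: scaleC_of_real)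
    ultimately have "h *\<^sub>R Dsu (w t)
        = (Dsu p - Dsu q) + Dsu (integral {t..t + h} V)" by simp
    also have "norm \<dots> \<le> (h * (r / 2) + h * (r / 2)) + norm (Dsu (integral {t..t + h} V))"
      by (intro order_trans[OF norm_triangle_ineq] add_mono order_trans[OF norm_triangle_ineq4] p_le q order_refl)
    finally show ?thesis by simp
  qed
  define Y where "Y t = (norm (\<Sum>n\<in>I. cis (2 * pi * n * t / L) *\<^sub>C a n))\<^sup>2" for t
  have Y_int: "(Y has_integral L * (\<Sum>n\<in>I. (norm (a n))\<^sup>2)) {0..L}"
    unfolding Y_def[abs_def] by (rule has_integral_norm_sq_trigonometric[OF \<open>0 < L\<close> I])
  have Y_cont: "continuous_on X Y" for X
    unfolding Y_def[abs_def] cis_conv_exp using \<open>0 < L\<close> by (intro continuous_intros) auto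
  \<comment> \<open>The division by h^2 undoes the window length; it cancels against the factor h in
    the bound on the multipliers \<open>m n\<close>.\<close>
  define k where "k = 2 * (exp (\<beta> * T))\<^sup>2 / h\<^sup>2"
  have "0 \<le> k" by (simp add: k_def)
  have pointwise: "(norm (Dsu (w t)))\<^sup>2 \<le> 2 * r\<^sup>2 + k * Y t" if t: "t \<in> {0..T}" for t
  proof -
    have "h * norm (Dsu (w t)) \<le> h * r + exp (\<beta> * t) * sqrt (Y t)"
      using close[OF t] h(1) by (simp add: Ds_V_avg Y_def)
    also have "\<dots> \<le> h * r + exp (\<beta> * T) * sqrt (Y t)"
      using t \<open>0 < \<beta>\<close> by (intro add_left_mono mult_right_mono) (simp_all add: Y_def)
    finally have "(h * norm (Dsu (w t)))\<^sup>2 \<le> (h * r + exp (\<beta> * T) * sqrt (Y t))\<^sup>2"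
      using h(1) by (intro power_mono) simp_all
    also have "\<dots> \<le> 2 * (h * r)\<^sup>2 + 2 * (exp (\<beta> * T) * sqrt (Y t))\<^sup>2"
      using sum_squares_bound[of "h * r" "exp (\<beta> * T) * sqrt (Y t)"] unfolding power2_sum by linarith
    also have "\<dots> = h\<^sup>2 * (2 * r\<^sup>2 + k * Y t)"
      using h(1) by (simp add: k_def power_mult_distrib Y_def algebra_simps)
    finally show ?thesis using h(1) by (simp add: power_mult_distrib)
  qed
  have Dsw_cont: "continuous_on {0..} (\<lambda>t. Dsu (w t))"
    by (intro continuous_on_Ds_Ac w_cont w) simp
  have "integral {0..T} (\<lambda>t. (norm (Dsu (w t)))\<^sup>2) \<le> integral {0..T} (\<lambda>t. 2 * r\<^sup>2 + k * Y t)"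
    using pointwise
    by (intro integral_le integrable_continuous_real continuous_intros Y_cont
        continuous_on_subset[OF Dsw_cont]) auto
  also have "\<dots> = 2 * r\<^sup>2 * T + k * integral {0..T} Y"
    using \<open>0 \<le> T\<close>
    by (subst integral_add) (auto intro!: integrable_continuous_real continuous_intros Y_cont)
  \<comment> \<open>Enlarging to a full period costs nothing since Y is nonnegative, and makes
    Parseval's identity available.\<close>
  also have "integral {0..T} Y \<le> integral {0..L} Y"
    using L by (intro integral_subset_le integrable_continuous_real Y_cont) (auto simp: Y_def)
  also have "integral {0..L} Y = L * (\<Sum>n\<in>I. (norm (a n))\<^sup>2)"
    using Y_int by (rule integral_unique)
  also have "\<dots> \<le> L * (\<Sum>n\<in>I. (h * exp \<beta> * M)\<^sup>2 * (norm (Ds (c n)))\<^sup>2)"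
  proof (intro mult_left_mono sum_mono)
    fix n
    have "norm (a n) \<le> (h * exp \<beta>) * (M * norm (Ds (c n)))"
      unfolding a_def norm_scaleC using h(1) by (intro mult_mono m M[OF Re_line_freq c v]) simp_all
    then have "(norm (a n))\<^sup>2 \<le> ((h * exp \<beta> * M) * norm (Ds (c n)))\<^sup>2"
      by (intro power_mono) (simp_all add: mult.assoc)
    then show "(norm (a n))\<^sup>2 \<le> (h * exp \<beta> * M)\<^sup>2 * (norm (Ds (c n)))\<^sup>2"
      by (simp add: power_mult_distrib)
  qed (use \<open>0 < L\<close> in simp)
  also have "\<dots> = (h * exp \<beta> * M)\<^sup>2 * (L * (\<Sum>n\<in>I. (norm (Ds (c n)))\<^sup>2))"
    by (simp add: sum_distrib_left mult_ac)
  also have "\<dots> \<le> (h * exp \<beta> * M)\<^sup>2 * (2 * integral {0..T + 2} (\<lambda>t. (norm (Ds (u t)))\<^sup>2) + \<tau>)"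
    by (intro mult_left_mono energy) simp
  finally have "integral {0..T} (\<lambda>t. (norm (Dsu (w t)))\<^sup>2) \<le> 2 * r\<^sup>2 * T
      + k * ((h * exp \<beta> * M)\<^sup>2 * (2 * integral {0..T + 2} (\<lambda>t. (norm (Ds (u t)))\<^sup>2) + \<tau>))"
    using \<open>0 \<le> k\<close> by (simp add: mult_left_mono)
  also have "k * ((h * exp \<beta> * M)\<^sup>2 * (2 * integral {0..T + 2} (\<lambda>t. (norm (Ds (u t)))\<^sup>2) + \<tau>))
      = 2 * N * (2 * integral {0..T + 2} (\<lambda>t. (norm (Ds (u t)))\<^sup>2) + \<tau>)"
  proof -
    \<comment> \<open>exp (\<beta> T) comes from restoring the weight on [0, T], the additional exp
      \<beta> from averaging over a window of length at most 1.\<close>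
    have "k * (h * exp \<beta> * M)\<^sup>2 = 2 * N"
      using h(1) by (simp add: k_def N_def power_mult_distrib distrib_left exp_add)
    then show ?thesis by (simp flip: mult.assoc)
  qed
  also have "2 * r\<^sup>2 * T + 2 * N * (2 * integral {0..T + 2} (\<lambda>t. (norm (Ds (u t)))\<^sup>2) + \<tau>)
      \<le> 4 * N * integral {0..T + 2} (\<lambda>t. (norm (Ds (u t)))\<^sup>2) + e"
    using r \<tau>(2) by (simp add: algebra_simps)
  finally show "integral {0..T} (\<lambda>t. (norm (Dsu (w t)))\<^sup>2)
      \<le> 4 * (exp (\<beta> * (T + 1)) * M)\<^sup>2 * integral {0..T + 2} (\<lambda>t. (norm (Ds (u t)))\<^sup>2) + e"
    by (simp add: N_def)
qed

section \<open>From the two damping conditions to observability of the damped solution\<close>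

lemma transfer_boundedE:
  assumes "transfer_bounded_on_line iV B Bs domC C D Ds"
  obtains \<beta> M where "0 < \<beta>" "0 \<le> M" "\<And>l c v. Re l = \<beta> \<Longrightarrow> c \<in> domChat \<Longrightarrow> v \<in> domAc \<Longrightarrow>
      l *\<^sub>C v - Ac v = (0, 0, damping_term c) \<Longrightarrow> norm (Dsu v) \<le> M * norm (Ds c)"
proof -
  obtain H \<beta> M where H: "\<And>l w v. 0 < Re l \<Longrightarrow> transfer_value iV B Bs domC C D Ds l w v \<Longrightarrow> H l w = v"
    and "0 < \<beta>" and M: "\<And>l w. Re l = \<beta> \<Longrightarrow> norm (H l w) \<le> M * norm w"
    using assms unfolding transfer_bounded_on_line_def by metis
  show ?thesis
  proof (rule that[OF \<open>0 < \<beta>\<close>, of "\<bar>M\<bar>"])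
    fix l c v assume *: "Re l = \<beta>" "c \<in> domChat" "v \<in> domAc" "l *\<^sub>C v - Ac v = (0, 0, damping_term c)"
    \<comment> \<open>\<open>H l\<close> is known only through \<open>transfer_value\<close>, so the
      resolvent must first be recognised as such a value. From here on, H is replaced by a bound on
      resolvents.\<close>
    have "H l (Ds c) = - Dsu v"
      using * \<open>0 < \<beta>\<close> by (intro H transfer_value_resolvent) simp_all
    then have "norm (Dsu v) \<le> M * norm (Ds c)" using M[OF *(1), of "Ds c"] by simp
    also have "\<dots> \<le> \<bar>M\<bar> * norm (Ds c)" by (intro mult_right_mono) simp_all
    finally show "norm (Dsu v) \<le> \<bar>M\<bar> * norm (Ds c)" .
  qed simp
qed

text \<open>For bounded D, the norm of \<open>Ds \<phi>\<close> is at most k times that of \<phi>,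
  and by duality the damping term is at most k times the norm of \<open>Ds c\<close>. So the input
  controls the energy of w by Gronwall, and the energy controls the output.\<close>

lemma bounded_damping_estimate:
  assumes "damping_bounded domC iW D" "0 \<le> T"
  obtains K where "0 \<le> K" "\<And>u w. forced_path u w \<Longrightarrow>
    integral {0..T} (\<lambda>t. (norm (Dsu (w t)))\<^sup>2) \<le> K * integral {0..T} (\<lambda>t. (norm (Ds (u t)))\<^sup>2)"
proof -
  obtain D0 :: "'u \<Rightarrow> 'u" where D0: "bounded_clinear D0" "\<And>w \<phi>. \<phi> \<in> domC \<Longrightarrow> D w \<phi> = cinner (D0 (iW w)) \<phi>"
    and iW: "\<And>w. norm (iW w) = norm w"
    using assms(1) unfolding damping_bounded_def by metis
  obtain k where k: "0 < k" "\<And>u. norm (D0 u) \<le> norm u * k"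
    using bounded_linear.pos_bounded D0(1) unfolding bounded_clinear_def by blast
  have Ds_le: "norm (Ds \<phi>) \<le> k * norm \<phi>" if "\<phi> \<in> domC" for \<phi>
  proof (cases "Ds \<phi> = 0")
    case False
    have "(norm (Ds \<phi>))\<^sup>2 = cmod (cinner (D0 (iW (Ds \<phi>))) \<phi>)"
      using D_eq[OF that, of "Ds \<phi>"] D0(2)[OF that, of "Ds \<phi>"] by (metis Re_cinner_self cinner_self norm_of_real abs_power2)
    also have "\<dots> \<le> norm (D0 (iW (Ds \<phi>))) * norm \<phi>" by (rule norm_cinner_le)
    also have "\<dots> \<le> (norm (Ds \<phi>) * k) * norm \<phi>"
      using k(2)[of "iW (Ds \<phi>)"] by (intro mult_right_mono) (simp_all add: iW)
    finally show ?thesis using False by (simp add: power2_eq_square mult_ac)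
  qed (use k(1) in simp)
  have damping_le: "norm (damping_term c) \<le> k * norm (Ds c)" if "c \<in> domChat" for c
  proof (rule norm_le_dense[OF domC_dense])
    fix \<phi> assume \<phi>: "\<phi> \<in> domC"
    have "cinner (damping_term c) \<phi> = cinner (Ds c) (Ds \<phi>)" by (rule cinner_damping_term[OF that \<phi>])
    then have "cmod (cinner (damping_term c) \<phi>) \<le> norm (Ds c) * norm (Ds \<phi>)"
      by (simp add: norm_cinner_le)
    also have "\<dots> \<le> norm (Ds c) * (k * norm \<phi>)" by (intro mult_left_mono Ds_le \<phi>) simp
    finally show "cmod (cinner (damping_term c) \<phi>) \<le> k * norm (Ds c) * norm \<phi>" by (simp add: mult_ac)
  qed (use k(1) in simp)
  show ?thesis
  \<comment> \<open>One square of k bounds the output by the energy, the other comes from the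
    forcing, exp T from Gronwall, and T from integrating a pointwise bound.\<close>
  proof (rule that[of "k\<^sup>2 * exp T * k\<^sup>2 * T"])
    show "0 \<le> k\<^sup>2 * exp T * k\<^sup>2 * T" using \<open>0 \<le> T\<close> by simp
    fix u and w :: "real \<Rightarrow> 'v \<times> 'x \<times> 'u"
    assume path: "forced_path u w"
    note u = forced_pathD(2,3)[OF path] and w = forced_pathD(4,5,7)[OF path]
      and w_cont = forced_pathD(8)[OF path]
    define R where "R t = integral {0..t} (\<lambda>t. (norm (Ds (u t)))\<^sup>2)" for t
    have p_cont: "continuous_on X (\<lambda>t. (norm (Ds (u t)))\<^sup>2)" if "X \<subseteq> {0..}" for X
      by (intro continuous_intros continuous_on_subset[OF u(2) that])
    have R_nonneg: "0 \<le> R t" for t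
      unfolding R_def by (intro integral_nonneg integrable_continuous_real p_cont) auto
    have R_mono: "R t \<le> R T" if "t \<in> {0..T}" for t
      unfolding R_def using that
      by (intro integral_subset_le integrable_continuous_real p_cont) auto
    have w_le: "(norm (w t))\<^sup>2 \<le> exp T * (k\<^sup>2 * R T)" if t: "t \<in> {0..T}" for t
    proof -
      \<comment> \<open>The weight exp (- t) absorbs the energy term that 2 a b \<le> a^2 + b^2
        produces.\<close>
      define f where "f t = exp (- t) * (norm (w t))\<^sup>2 - k\<^sup>2 * R t" for t
      have "f t \<le> f 0"
      proof (rule nonincreasing_of_deriv_within[where f = f and f' = "\<lambda>s.
          exp (- s) * (2 * Re (cinner (Ac (w s) + (0, 0, damping_term (u s))) (w s)) - (norm (w s))\<^sup>2)
          - k\<^sup>2 * (norm (Ds (u s)))\<^sup>2"])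
        fix s assume s: "s \<in> {0..t}"
        then have s0: "0 \<le> s" by simp
        have "(w has_vector_derivative Ac (w s) + (0, 0, damping_term (u s))) (at s within {0..t})"
          using s by (intro has_vector_derivative_within_subset[OF w(3)]) auto
        note dw = has_real_derivative_norm_sq[OF this]
        have "(R has_vector_derivative (norm (Ds (u s)))\<^sup>2) (at s within {0..t})"
          unfolding R_def by (rule integral_has_vector_derivative[OF p_cont s]) auto
        then have dR: "(R has_real_derivative (norm (Ds (u s)))\<^sup>2) (at s within {0..t})"
          by (simp add: has_real_derivative_iff_has_vector_derivative)
        let ?q = "Re (cinner (Ac (w s) + (0, 0, damping_term (u s))) (w s))"
        show "(f has_real_derivative
            exp (- s) * (2 * ?q - (norm (w s))\<^sup>2) - k\<^sup>2 * (norm (Ds (u s)))\<^sup>2) (at s within {0..t})"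
          unfolding f_def
          by (rule derivative_eq_intros dw dR refl | simp add: algebra_simps)+
        have "2 * ?q \<le> 2 * ((k * norm (Ds (u s))) * norm (w s))"
          using Re_cinner_forced_le[OF w(2)[OF s0] damping_le[OF u(1)[OF s0]]] by simp
        also have "\<dots> \<le> (k * norm (Ds (u s)))\<^sup>2 + (norm (w s))\<^sup>2"
          using sum_squares_bound[of "k * norm (Ds (u s))" "norm (w s)"] by simp
        finally have q: "2 * ?q - (norm (w s))\<^sup>2 \<le> k\<^sup>2 * (norm (Ds (u s)))\<^sup>2"
          by (simp add: power_mult_distrib)
        have "exp (- s) * (2 * ?q - (norm (w s))\<^sup>2) \<le> exp (- s) * (k\<^sup>2 * (norm (Ds (u s)))\<^sup>2)"
          by (intro mult_left_mono q) simp
        also have "\<dots> \<le> 1 * (k\<^sup>2 * (norm (Ds (u s)))\<^sup>2)" using s0 by (intro mult_right_mono) simp_all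
        finally show "exp (- s) * (2 * ?q - (norm (w s))\<^sup>2) - k\<^sup>2 * (norm (Ds (u s)))\<^sup>2 \<le> 0" by simp
      qed (use t in simp)
      then have "exp (- t) * (norm (w t))\<^sup>2 \<le> k\<^sup>2 * R t" by (simp add: f_def w(1) R_def)
      then have "(norm (w t))\<^sup>2 \<le> exp t * (k\<^sup>2 * R t)" by (simp add: exp_minus field_simps)
      also have "\<dots> \<le> exp T * (k\<^sup>2 * R T)"
      proof (intro mult_mono mult_left_mono R_mono t)
        show "0 \<le> k\<^sup>2 * R t" using R_nonneg by simp
      qed (use t R_nonneg in simp_all)
      finally show ?thesis .
    qed
    have y_le: "norm ((norm (Dsu (w t)))\<^sup>2) \<le> k\<^sup>2 * (exp T * (k\<^sup>2 * R T))" if t: "t \<in> {0..T}" for t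
    proof -
      have "norm (Dsu (w t)) \<le> k * norm (snd (snd (w t)))"
        using t by (intro Ds_le domC_of_domAc w(2)) simp
      also have "\<dots> \<le> k * norm (w t)"
        using k(1) norm_snd_pair_le[of "w t"] norm_snd_pair_le[of "snd (w t)"] by (intro mult_left_mono) simp_all
      finally have "(norm (Dsu (w t)))\<^sup>2 \<le> (k * norm (w t))\<^sup>2" by (intro power_mono) simp_all
      also have "\<dots> \<le> k\<^sup>2 * (exp T * (k\<^sup>2 * R T))"
        unfolding power_mult_distrib by (intro mult_left_mono w_le t) simp
      finally show ?thesis by simp
    qed
    have Dsw_cont: "continuous_on {0..} (\<lambda>t. Dsu (w t))"
    proof (rule continuous_on_dist_le[OF w_cont])
      fix s t :: real assume "s \<in> {0..}" "t \<in> {0..}"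
      then have *: "w s \<in> domAc" "w t \<in> domAc" using w(2) by auto
      have "norm (Dsu (w s - w t)) \<le> k * norm (snd (snd (w s - w t)))"
        by (intro Ds_le domC_of_domAc linear_operator_diff[OF Ac_linear] *)
      also have "\<dots> \<le> k * norm (w s - w t)"
        using k(1) norm_snd_pair_le[of "w s - w t"] norm_snd_pair_le[of "snd (w s - w t)"]
        by (intro mult_left_mono) simp_all
      finally show "dist (Dsu (w s)) (Dsu (w t)) \<le> k * dist (w s) (w t)"
        using Ds_linear[OF domC_of_domAc[OF *(1)] domC_of_domAc[OF *(2)]] by (simp add: dist_norm)
    qed
    have "norm (integral {0..T} (\<lambda>t. (norm (Dsu (w t)))\<^sup>2)) \<le> k\<^sup>2 * (exp T * (k\<^sup>2 * R T)) * (T - 0)"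
    proof (rule integral_bound[OF \<open>0 \<le> T\<close>])
      show "continuous_on {0..T} (\<lambda>t. (norm (Dsu (w t)))\<^sup>2)"
        by (intro continuous_intros continuous_on_subset[OF Dsw_cont]) auto
    qed (rule y_le)
    then show "integral {0..T} (\<lambda>t. (norm (Dsu (w t)))\<^sup>2)
        \<le> k\<^sup>2 * exp T * k\<^sup>2 * T * integral {0..T} (\<lambda>t. (norm (Ds (u t)))\<^sup>2)"
      by (simp add: R_def mult_ac)
  qed
qed

lemma damped_observability:
  assumes damping: "transfer_bounded_on_line iV B Bs domC C D Ds \<or> damping_bounded domC iW D"
    and "0 \<le> T"
  obtains K T' where "0 < K" "T \<le> T'"
    "\<And>z0 z z1. z0 \<in> domAd \<Longrightarrow> cauchy_solution domAd Ad z0 z \<Longrightarrow> cauchy_solution domAc Ac z0 z1 \<Longrightarrow>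
      integral {0..T} (\<lambda>t. (norm (Dsu (z1 t)))\<^sup>2)
        \<le> K * integral {0..T'} (\<lambda>t. (norm (Dsu (z t)))\<^sup>2)"
proof -
  have "\<exists>K\<ge>0. \<forall>u w. forced_path u w \<longrightarrow> integral {0..T} (\<lambda>t. (norm (Dsu (w t)))\<^sup>2)
      \<le> K * integral {0..T + 2} (\<lambda>t. (norm (Ds (u t)))\<^sup>2)"
    using damping
  proof
    assume "transfer_bounded_on_line iV B Bs domC C D Ds"
    then obtain \<beta> M where \<beta>M: "0 < \<beta>" "0 \<le> M" "\<And>l c v. Re l = \<beta> \<Longrightarrow> c \<in> domChat \<Longrightarrow> v \<in> domAc \<Longrightarrow>
      l *\<^sub>C v - Ac v = (0, 0, damping_term c) \<Longrightarrow> norm (Dsu v) \<le> M * norm (Ds c)"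
      by (rule transfer_boundedE) (rule that)
    show ?thesis
      by (intro exI[of _ "4 * (exp (\<beta> * (T + 1)) * M)\<^sup>2"] conjI allI impI
          transfer_estimate[OF \<beta>M(1,2) \<open>0 \<le> T\<close> \<beta>M(3)]) simp_all
  next
    assume bounded: "damping_bounded domC iW D"
    obtain K where K: "0 \<le> K" "\<And>u w. forced_path u w \<Longrightarrow>
      integral {0..T} (\<lambda>t. (norm (Dsu (w t)))\<^sup>2) \<le> K * integral {0..T} (\<lambda>t. (norm (Ds (u t)))\<^sup>2)"
      by (rule bounded_damping_estimate[OF bounded \<open>0 \<le> T\<close>]) (rule that)
    have mono: "integral {0..T} (\<lambda>t. (norm (Ds (u t)))\<^sup>2) \<le> integral {0..T + 2} (\<lambda>t. (norm (Ds (u t)))\<^sup>2)"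
      if "forced_path u w" for u w
      by (intro integral_subset_le integrable_continuous_real continuous_intros
          continuous_on_subset[OF forced_pathD(3)[OF that]]) auto
    show ?thesis
      using K(1) order_trans[OF K(2) mult_left_mono[OF mono K(1)]] by blast
  qed
  then obtain K where "0 \<le> K" and K: "\<And>u w. forced_path u w \<Longrightarrow>
      integral {0..T} (\<lambda>t. (norm (Dsu (w t)))\<^sup>2) \<le> K * integral {0..T + 2} (\<lambda>t. (norm (Ds (u t)))\<^sup>2)"
    by blast
  show ?thesis
  \<comment> \<open>The conservative output is the sum of the outputs of w and z, and the square of
    a sum is at most twice the sum of the squares.\<close>
  proof (rule that[of "2 * K + 2" "T + 2"])
    fix z0 z z1
    assume "z0 \<in> domAd" and sz: "cauchy_solution domAd Ad z0 z" and sz1: "cauchy_solution domAc Ac z0 z1"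
    note z = cauchy_solutionD[OF sz] and z1 = cauchy_solutionD[OF sz1]
    define u where "u t = snd (snd (z t))" for t
    note u = damped_solution_continuous[OF sz, folded u_def]
    define w where "w t = z1 t - z t" for t
    have zc: "z t \<in> domAc" if "0 \<le> t" for t using z(3)[OF that] domAd_subset by blast
    have Ac_z: "Ac (z t) = Ad (z t) + (0, 0, damping_term (u t))" if "0 \<le> t" for t
      using Ac_minus_Ad[OF z(3)[OF that]] by (simp add: u_def algebra_simps)
    have w_dom: "w t \<in> domAc" and Ac_w: "Ac (w t) = Ac (z1 t) - Ac (z t)" if "0 \<le> t" for t
      unfolding w_def using linear_operator_diff[OF Ac_linear z1(3)[OF that] zc[OF that]] by simp_all
    have w_cont: "continuous_on {0..} (\<lambda>t. Ac (w t))"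
    proof (rule continuous_on_eq)
      show "continuous_on {0..} (\<lambda>t. Ac (z1 t) - (Ad (z t) + (0, 0, damping_term (u t))))"
        by (intro continuous_intros z z1 u)
    qed (simp add: Ac_w Ac_z)
    have w_deriv: "(w has_vector_derivative Ac (w t) + (0, 0, damping_term (u t))) (at t within {0..})"
      if "0 \<le> t" for t
    proof -
      have "(w has_vector_derivative Ac (z1 t) - Ad (z t)) (at t within {0..})"
        unfolding w_def by (intro has_vector_derivative_diff z z1 that)
      then show ?thesis by (simp add: Ac_w Ac_z that)
    qed
    have y: "integral {0..T} (\<lambda>t. (norm (Dsu (w t)))\<^sup>2) \<le> K * integral {0..T + 2} (\<lambda>t. (norm (Ds (u t)))\<^sup>2)"
    proof (rule K)
      show "forced_path u w"
        unfolding forced_path_def using u w_dom w_cont w_deriv by (simp add: w_def z z1)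
    qed
    have wc: "continuous_on {0..} w" unfolding w_def by (intro continuous_intros z z1)
    note Dsw_cont = continuous_on_Ds_Ac[OF wc w_cont w_dom]
    note Dsz1_cont = continuous_on_Ds_Ac[OF z1(5,2,3)]
    have split: "(norm (Dsu (z1 t)))\<^sup>2 \<le> 2 * (norm (Dsu (w t)))\<^sup>2 + 2 * (norm (Ds (u t)))\<^sup>2"
      if "t \<in> {0..T}" for t
    proof -
      have "Dsu (w t) = Dsu (z1 t) - Ds (u t)"
        unfolding w_def u_def using that domC_of_domAc[OF z1(3)] domC_of_domAc[OF zc] by (simp add: Ds_linear)
      then have "norm (Dsu (z1 t)) \<le> norm (Dsu (w t)) + norm (Ds (u t))"
        using norm_triangle_ineq[of "Dsu (w t)" "Ds (u t)"] by simp
      then have "(norm (Dsu (z1 t)))\<^sup>2 \<le> (norm (Dsu (w t)) + norm (Ds (u t)))\<^sup>2"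
        by (intro power_mono) simp_all
      then show ?thesis
        using sum_squares_bound[of "norm (Dsu (w t))" "norm (Ds (u t))"] unfolding power2_sum by linarith
    qed
    have sub: "{0..T} \<subseteq> {0..}" by auto
    have int: "(\<lambda>t. (norm (Dsu (w t)))\<^sup>2) integrable_on {0..T}" "(\<lambda>t. (norm (Ds (u t)))\<^sup>2) integrable_on {0..T}"
      "(\<lambda>t. (norm (Dsu (z1 t)))\<^sup>2) integrable_on {0..T}"
      by (intro integrable_continuous_real continuous_intros continuous_on_subset[OF _ sub] Dsw_cont u Dsz1_cont; simp)+
    have "integral {0..T} (\<lambda>t. (norm (Dsu (z1 t)))\<^sup>2)
        \<le> integral {0..T} (\<lambda>t. 2 * (norm (Dsu (w t)))\<^sup>2 + 2 * (norm (Ds (u t)))\<^sup>2)"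
      using split by (intro integral_le integrable_add integrable_on_mult_right int) auto
    also have "\<dots> = 2 * integral {0..T} (\<lambda>t. (norm (Dsu (w t)))\<^sup>2) + 2 * integral {0..T} (\<lambda>t. (norm (Ds (u t)))\<^sup>2)"
      using int by (subst integral_add) (auto intro: integrable_on_mult_right)
    also have "integral {0..T} (\<lambda>t. (norm (Ds (u t)))\<^sup>2) \<le> integral {0..T + 2} (\<lambda>t. (norm (Ds (u t)))\<^sup>2)"
      by (intro integral_subset_le integrable_continuous_real continuous_intros continuous_on_subset[OF u(3)]) auto
    finally show "integral {0..T} (\<lambda>t. (norm (Dsu (z1 t)))\<^sup>2)
        \<le> (2 * K + 2) * integral {0..T + 2} (\<lambda>t. (norm (Dsu (z t)))\<^sup>2)"
      using y unfolding u_def by (simp add: algebra_simps)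
  qed (use \<open>0 \<le> K\<close> in simp_all)
qed

end

section \<open>Interpolation\<close>

text \<open>The explicit competitor exp ((\<zeta> - \<theta>) l) a has value a at \<theta>, and l is
  chosen so that its norms on the two boundary lines coincide. Both then equal the geometric mean on
  the right.\<close>

lemma interpolation_norm_le:
  fixes j :: "'a::complex_banach \<Rightarrow> 'b::complex_banach"
  assumes j: "inclusion j" and "0 < \<theta>" "\<theta> < 1"
  shows "interpolation_norm j \<theta> (j a) \<le> norm a powr (1 - \<theta>) * norm (j a) powr \<theta>"
proof -
  have scale: "j (c *\<^sub>C x) = c *\<^sub>C j x" for c x
    using j by (simp add: inclusion_def bounded_clinear_def)
  define M where "M = norm a powr (1 - \<theta>) * norm (j a) powr \<theta>"
  have "\<exists>f. calderon_bound j M f \<and> f (complex_of_real \<theta>) = j a"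
  proof (cases "a = 0")
    case True
    then have "j a = 0" using scale[of 0 a] by simp
    have "calderon_bound j M (\<lambda>_. 0)"
      unfolding calderon_bound_def
      using True \<open>j a = 0\<close> by (auto intro!: exI[of _ "\<lambda>_. 0"] exI[of _ 0] boundedI[where B = 0] simp: M_def)
    then show ?thesis using \<open>j a = 0\<close> by auto
  next
    case False
    have "j 0 = 0" using scale[of 0 0] by simp
    then have "j a \<noteq> 0" using False j unfolding inclusion_def by (metis injD)
    \<comment> \<open>The balancing exponent; it needs both norms to be positive, hence the separate
      case a = 0.\<close>
    define l where "l = ln (norm a / norm (j a))"
    have l: "exp (r * l) = norm a powr r * norm (j a) powr (- r)" for r
    proof -
      have "l = ln (norm a) - ln (norm (j a))" using False \<open>j a \<noteq> 0\<close> by (simp add: l_def ln_div)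
      then show ?thesis
        using False \<open>j a \<noteq> 0\<close>
        by (simp add: powr_def right_diff_distrib exp_diff exp_minus divide_inverse)
    qed
    define \<phi> where "\<phi> \<zeta> = exp ((\<zeta> - of_real \<theta>) * of_real l)" for \<zeta> :: complex
    have norm_\<phi>: "cmod (\<phi> \<zeta>) = exp ((Re \<zeta> - \<theta>) * l)" for \<zeta>
      by (simp add: \<phi>_def norm_exp_eq_Re)
    have M0: "exp ((0 - \<theta>) * l) * norm a = M"
    proof -
      have "norm a powr (- \<theta>) * norm a = norm a powr (1 - \<theta>)"
        using False powr_add[of "norm a" "- \<theta>" 1] by simp
      then show ?thesis unfolding l by (simp add: M_def mult_ac)
    qed
    have M1: "exp ((1 - \<theta>) * l) * norm (j a) = M"
    proof -
      have "norm (j a) powr (\<theta> - 1) * norm (j a) = norm (j a) powr \<theta>"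
        using \<open>j a \<noteq> 0\<close> powr_add[of "norm (j a)" "\<theta> - 1" 1] by simp
      then show ?thesis unfolding l by (simp add: M_def mult_ac)
    qed
    have "calderon_bound j M (\<lambda>\<zeta>. \<phi> \<zeta> *\<^sub>C j a)"
      unfolding calderon_bound_def
    proof (intro conjI ballI)
      show "continuous_on cstrip (\<lambda>\<zeta>. \<phi> \<zeta> *\<^sub>C j a)"
        unfolding \<phi>_def by (intro continuous_intros)
      show "bounded ((\<lambda>\<zeta>. \<phi> \<zeta> *\<^sub>C j a) ` cstrip)"
      proof (rule boundedI)
        fix y assume "y \<in> (\<lambda>\<zeta>. \<phi> \<zeta> *\<^sub>C j a) ` cstrip"
        then obtain \<zeta> where \<zeta>: "\<zeta> \<in> cstrip" "y = \<phi> \<zeta> *\<^sub>C j a" by blast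
        have "\<bar>Re \<zeta> - \<theta>\<bar> * \<bar>l\<bar> \<le> 1 * \<bar>l\<bar>"
          using \<zeta>(1) assms(2,3) by (intro mult_right_mono) (auto simp: cstrip_def)
        then have "(Re \<zeta> - \<theta>) * l \<le> \<bar>l\<bar>" by (simp flip: abs_mult)
        then show "norm y \<le> exp \<bar>l\<bar> * norm (j a)"
          by (simp add: \<zeta>(2) norm_scaleC norm_\<phi> mult_right_mono)
      qed
      fix \<zeta> :: complex
      have "(\<phi> has_field_derivative \<phi> \<zeta> * of_real l) (at \<zeta>)"
        unfolding \<phi>_def by (auto intro!: derivative_eq_intros)
      then have "((\<lambda>h. (\<phi> (\<zeta> + h) - \<phi> \<zeta>) / h) \<longlongrightarrow> \<phi> \<zeta> * of_real l) (at 0)" by (simp add: DERIV_def)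
      then have "((\<lambda>h. ((\<phi> (\<zeta> + h) - \<phi> \<zeta>) / h) *\<^sub>C j a) \<longlongrightarrow> (\<phi> \<zeta> * of_real l) *\<^sub>C j a) (at 0)"
        by (intro bounded_bilinear.tendsto[OF bounded_bilinear_scaleC] tendsto_const)
      then show "\<exists>d. ((\<lambda>h. inverse h *\<^sub>C (\<phi> (\<zeta> + h) *\<^sub>C j a - \<phi> \<zeta> *\<^sub>C j a)) \<longlongrightarrow> d) (at 0)"
        by (auto simp: divide_inverse scaleC_scaleC mult.commute simp flip: scaleC_diff_left)
    next
      show "\<exists>g. continuous_on UNIV g \<and> (\<forall>t. \<phi> (Complex 0 t) *\<^sub>C j a = j (g t) \<and> norm (g t) \<le> M)"
      proof (intro exI[of _ "\<lambda>t. \<phi> (Complex 0 t) *\<^sub>C a"] conjI allI)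
        show "continuous_on UNIV (\<lambda>t. \<phi> (Complex 0 t) *\<^sub>C a)"
          unfolding \<phi>_def Complex_eq by (intro continuous_intros)
      qed (use M0 in \<open>simp_all add: scale norm_scaleC norm_\<phi>\<close>)
      show "\<forall>t. norm (\<phi> (Complex 1 t) *\<^sub>C j a) \<le> M"
        using M1 by (simp add: norm_scaleC norm_\<phi>)
    qed
    moreover have "\<phi> (of_real \<theta>) = 1" by (simp add: \<phi>_def)
    ultimately show ?thesis by (intro exI[of _ "\<lambda>\<zeta>. \<phi> \<zeta> *\<^sub>C j a"]) simp
  qed
  moreover have "bdd_below {M. \<exists>f. calderon_bound j M f \<and> f (complex_of_real \<theta>) = j a}"
  proof (rule bdd_belowI[of _ 0])
    fix M assume "M \<in> {M. \<exists>f. calderon_bound j M f \<and> f (complex_of_real \<theta>) = j a}"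
    then obtain f :: "complex \<Rightarrow> 'b" where "norm (f (Complex 1 0)) \<le> M" unfolding calderon_bound_def by blast
    then show "0 \<le> M" using norm_ge_zero order_trans by blast
  qed
  ultimately show ?thesis
    unfolding interpolation_norm_def M_def by (intro cInf_lower) simp_all
qed

text \<open>X plays the energy norm, N the graph norm and J the weak norm. Solving the interpolation
  inequality for J / X, by logarithms, bounds the argument of G from below by a power of the
  normalised energy.\<close>

lemma interpolation_ratio:
  fixes X N J \<kappa> \<theta> :: real
  assumes "0 < \<theta>" "\<theta> < 1" "0 < X" "0 < N" "0 < \<kappa>" "0 \<le> J"
    and le: "X \<le> \<kappa> * N powr (1 - \<theta>) * J powr \<theta>"
  shows "(X\<^sup>2 / (\<kappa> powr (2 / (1 - \<theta>)) * N\<^sup>2)) powr ((1 - \<theta>) / \<theta>) \<le> J\<^sup>2 / X\<^sup>2"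
proof -
  have "J \<noteq> 0" using le \<open>0 < X\<close> by auto
  then have "0 < J" using \<open>0 \<le> J\<close> by simp
  have "ln X \<le> ln (\<kappa> * N powr (1 - \<theta>) * J powr \<theta>)"
    using le \<open>0 < X\<close> by simp
  also have "\<dots> = ln \<kappa> + (1 - \<theta>) * ln N + \<theta> * ln J"
    using assms \<open>0 < J\<close> by (simp add: ln_mult)
  finally have "ln X \<le> ln \<kappa> + (1 - \<theta>) * ln N + \<theta> * ln J" .
  then have "2 * ((1 - \<theta>) * (ln X - ln N) - ln \<kappa>) / \<theta> \<le> 2 * (\<theta> * (ln J - ln X)) / \<theta>"
    using \<open>0 < \<theta>\<close> by (intro divide_right_mono) (simp_all add: algebra_simps)
  then have "(1 - \<theta>) / \<theta> * (2 * ln X - (2 / (1 - \<theta>) * ln \<kappa> + 2 * ln N)) \<le> 2 * ln J - 2 * ln X"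
  proof -
    have "a / \<theta> * (2 * x - (2 / a * k + 2 * n)) = 2 * (a * (x - n) - k) / \<theta>" if "0 < a" for a x k n :: real
      using that \<open>0 < \<theta>\<close> by (simp add: field_simps)
    from this[of "1 - \<theta>" "ln X" "ln \<kappa>" "ln N"] show ?thesis
      using \<open>2 * ((1 - \<theta>) * (ln X - ln N) - ln \<kappa>) / \<theta> \<le> _\<close> \<open>0 < \<theta>\<close> \<open>\<theta> < 1\<close> by simp
  qed
  then have "ln ((X\<^sup>2 / (\<kappa> powr (2 / (1 - \<theta>)) * N\<^sup>2)) powr ((1 - \<theta>) / \<theta>)) \<le> ln (J\<^sup>2 / X\<^sup>2)"
    using assms \<open>0 < J\<close> by (simp add: ln_mult ln_div ln_realpow)
  then show ?thesis using assms \<open>0 < J\<close> by (subst (asm) ln_le_cancel_iff) simp_all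
qed

section \<open>Decay of sequences\<close>

text \<open>Induction on (1 + k) g k \<le> A. Either (2 + k) g k is already at most A and
  monotonicity suffices, or c (2 + k) g k exceeds c A, which is at least 1, and the factor 2 + k
  drops to 1 + k.\<close>

lemma quadratic_recursion_decay:
  fixes g :: "nat \<Rightarrow> real"
  assumes "0 < c" and nonneg: "\<And>k. 0 \<le> g k" and rec: "\<And>k. g (Suc k) \<le> g k * (1 - c * g k)"
    and A: "g 0 \<le> A" "1 \<le> c * A"
  shows "g k \<le> A / (1 + real k)"
proof -
  have "(1 + real k) * g k \<le> A"
  proof (induction k)
    case (Suc k)
    show ?case
    proof (cases "(2 + real k) * g k \<le> A")
      case True
      have "g (Suc k) \<le> g k * 1"
        using \<open>0 < c\<close> nonneg[of k] by (intro order_trans[OF rec] mult_left_mono) simp_all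
      then have "(2 + real k) * g (Suc k) \<le> (2 + real k) * g k" by (intro mult_left_mono) simp_all
      from order_trans[OF this True] show ?thesis by simp
    next
      case False
      have "(2 + real k) * g (Suc k) \<le> (2 + real k) * (g k * (1 - c * g k))"
        by (intro mult_left_mono rec) simp
      also have "\<dots> = g k * ((2 + real k) - c * ((2 + real k) * g k))" by (simp add: algebra_simps)
      also have "\<dots> \<le> g k * ((2 + real k) - c * A)"
        using False \<open>0 < c\<close> nonneg by (intro mult_left_mono diff_left_mono) simp_all
      also have "\<dots> \<le> g k * (1 + real k)" using A(2) nonneg by (intro mult_left_mono) simp_all
      also have "\<dots> \<le> A" using Suc by (simp add: mult.commute)
      finally show ?thesis by simp
    qed
  qed (use A in simp)
  then show ?thesis by (simp add: pos_le_divide_eq mult.commute)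
qed

text \<open>A Bernoulli inequality: Young's inequality for s < 1, comparison with exponent 1 for s
  at least 1.\<close>

lemma powr_one_minus_le:
  fixes s y :: real
  assumes "0 < s" "0 \<le> y" "y \<le> 1"
  shows "(1 - y) powr s \<le> 1 - min 1 s * y"
proof (cases "s < 1 \<and> y < 1")
  case True
  then have "(1 - y) powr s * 1 powr (1 - s) \<le> s * (1 - y) + (1 - s) * 1"
    using assms by (intro Youngs_inequality_0) simp_all
  then show ?thesis using True by (simp add: algebra_simps)
next
  case False
  show ?thesis
  proof (cases "y < 1")
    case True
    then have "(1 - y) powr s \<le> (1 - y) powr 1" using assms False by (intro powr_mono') simp_all
    then show ?thesis using False True assms by (simp add: min_def)
  next
    case False
    then have "y = 1" using assms by simp
    then show ?thesis by simp
  qed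
qed

text \<open>p stands for \<theta> / (1 - \<theta>). After the substitution x to
  \<open>x powr (1 / p)\<close>, which is how G meets the energy, \<open>growth\<close> says that
  \<open>G (x powr (1 / p)) / x\<close> is increasing.\<close>

locale growth_function =
  fixes G :: "real \<Rightarrow> real" and p :: real
  assumes p: "0 < p" and bij: "bij_betw G {0..} {0..}" and mono: "mono_on {0..} G"
    and growth: "mono_on {0<..<1} (\<lambda>x. x powr (- p) * G x)"
begin

lemma G_nonneg: "0 \<le> x \<Longrightarrow> 0 \<le> G x"
  using bij_betwE[OF bij] by auto

lemma G_zero: "G 0 = 0"
proof -
  obtain x where x: "0 \<le> x" "G x = 0"
    using bij_betw_imp_surj_on[OF bij] by (metis (no_types, lifting) atLeast_iff imageE order_refl)
  then have "G 0 \<le> 0" using monotone_onD[OF mono, of 0 x] by simp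
  then show ?thesis using G_nonneg[of 0] by simp
qed

lemma scale_le:
  assumes "0 \<le> r" "r \<le> 1" "0 < x" "x < 1"
  shows "G ((r * x) powr (1 / p)) \<le> r * G (x powr (1 / p))"
proof (cases "r = 0")
  case True
  then show ?thesis using G_zero by simp
next
  case False
  then have rx: "0 < r * x" "r * x \<le> x" using assms by (simp_all add: mult_left_le_one_le)
  then have "r * x < 1" using assms by linarith
  have "(r * x) powr (1 / p) \<in> {0<..<1}" "x powr (1 / p) \<in> {0<..<1}"
    using assms rx \<open>r * x < 1\<close> p powr_less_mono2[of "1 / p" "r * x" 1] powr_less_mono2[of "1 / p" x 1] by auto
  moreover have "(r * x) powr (1 / p) \<le> x powr (1 / p)"
    using rx p by (intro powr_mono2) auto
  ultimately have "((r * x) powr (1 / p)) powr (- p) * G ((r * x) powr (1 / p))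
      \<le> (x powr (1 / p)) powr (- p) * G (x powr (1 / p))"
    by (rule monotone_onD[OF growth])
  then have "G ((r * x) powr (1 / p)) / (r * x) \<le> G (x powr (1 / p)) / x"
    using p rx assms by (simp add: powr_powr powr_minus divide_inverse mult.commute)
  moreover have "0 < r" using False assms by simp
  ultimately show ?thesis using \<open>0 < x\<close> by (simp add: field_simps)
qed

text \<open>\<open>scale_le\<close> with r = 1 / a moves the constant a from the value of G to its
  argument, so it comes out of the inverse as a mere factor. G is only assumed weakly increasing, so
  strictness is recovered from injectivity.\<close>

lemma le_inverse_powr:
  assumes "0 \<le> x" "x < 1" "1 \<le> a" "0 \<le> y" and le: "G (x powr (1 / p)) \<le> a * y"
  shows "x \<le> a * inv_into {0..} G y powr p"
proof (cases "x = 0")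
  case True
  then show ?thesis using assms by simp
next
  case False
  have y: "y \<in> G ` {0..}" using bij_betw_imp_surj_on[OF bij] \<open>0 \<le> y\<close> by simp
  define i where "i = inv_into {0..} G y"
  have i: "0 \<le> i" "G i = y" unfolding i_def using inv_into_into[OF y] f_inv_into_f[OF y] by simp_all
  have "G ((1 / a * x) powr (1 / p)) \<le> 1 / a * G (x powr (1 / p))"
    using assms False by (intro scale_le) auto
  also have "\<dots> \<le> y" using le assms by (simp add: field_simps)
  finally have Gle: "G ((x / a) powr (1 / p)) \<le> G i" using i by simp
  have "(x / a) powr (1 / p) \<le> i"
  proof (rule ccontr)
    assume less: "\<not> (x / a) powr (1 / p) \<le> i"
    then have "G i \<le> G ((x / a) powr (1 / p))"
      using i monotone_onD[OF mono, of i "(x / a) powr (1 / p)"] by simp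
    then have "G i = G ((x / a) powr (1 / p))" using Gle by simp
    then have "i = (x / a) powr (1 / p)"
      using bij_betw_imp_inj_on[OF bij] i(1) by (simp add: inj_on_eq_iff)
    then show False using less by simp
  qed
  then have "((x / a) powr (1 / p)) powr p \<le> i powr p" using p by (intro powr_mono2) simp_all
  then have "x / a \<le> i powr p" using p assms by (simp add: powr_powr)
  then show ?thesis using assms by (simp add: i_def field_simps)
qed

text \<open>By \<open>scale_le\<close>, passing from \<delta> k to \<delta> (k + 1) multiplies the
  value of G by at most the same factor, so the values of G satisfy the quadratic recursion.\<close>

lemma recursion_le:
  fixes \<delta> :: "nat \<Rightarrow> real"
  assumes "0 < c" and \<delta>: "\<And>k. 0 \<le> \<delta> k" "\<And>k. \<delta> k < 1"
    and rec: "\<And>k. \<delta> (Suc k) \<le> \<delta> k * (1 - c * G (\<delta> k powr (1 / p)))"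
  shows "G (\<delta> k powr (1 / p)) \<le> max (G 1) (1 / c) / (1 + real k)"
proof (rule quadratic_recursion_decay[OF \<open>0 < c\<close>])
  show "0 \<le> G (\<delta> k powr (1 / p))" for k by (simp add: G_nonneg)
  have "\<delta> 0 powr (1 / p) \<le> 1 powr (1 / p)" using \<delta>(1,2)[of 0] p by (intro powr_mono2) simp_all
  then show "G (\<delta> 0 powr (1 / p)) \<le> max (G 1) (1 / c)"
    using monotone_onD[OF mono, of "\<delta> 0 powr (1 / p)" 1] by simp
  have "c * (1 / c) \<le> c * max (G 1) (1 / c)" using \<open>0 < c\<close> by (intro mult_left_mono) simp_all
  then show "1 \<le> c * max (G 1) (1 / c)" using \<open>0 < c\<close> by simp
  fix k
  define r where "r = 1 - c * G (\<delta> k powr (1 / p))"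
  show "G (\<delta> (Suc k) powr (1 / p)) \<le> G (\<delta> k powr (1 / p)) * (1 - c * G (\<delta> k powr (1 / p)))"
  proof (cases "\<delta> k = 0")
    case True
    then have "\<delta> (Suc k) = 0" using rec[of k] \<delta>(1)[of "Suc k"] by simp
    then show ?thesis using True by (simp add: G_zero)
  next
    case False
    then have "0 < \<delta> k" using \<delta>(1)[of k] by simp
    \<comment> \<open>Nonnegativity of the factor is not assumed; it is forced by that of the next
      term.\<close>
    have "0 \<le> \<delta> k * r" using rec[of k] \<delta>(1)[of "Suc k"] by (simp add: r_def)
    then have r: "0 \<le> r" "r \<le> 1" using \<open>0 < \<delta> k\<close> \<open>0 < c\<close> G_nonneg
      by (simp_all add: zero_le_mult_iff r_def)
    have "\<delta> (Suc k) powr (1 / p) \<le> (r * \<delta> k) powr (1 / p)"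
      using rec[of k] \<delta>(1)[of "Suc k"] p by (intro powr_mono2) (simp_all add: r_def mult.commute)
    then have "G (\<delta> (Suc k) powr (1 / p)) \<le> G ((r * \<delta> k) powr (1 / p))"
      by (intro monotone_onD[OF mono]) simp_all
    also have "\<dots> \<le> r * G (\<delta> k powr (1 / p))" by (intro scale_le r \<open>0 < \<delta> k\<close> \<delta>(2))
    finally show ?thesis by (simp add: r_def mult.commute)
  qed
qed

end

text \<open>The counterpart for the identity in place of G. The growth condition would then require
  p \<le> 1, so Bernoulli's inequality takes the place of \<open>scale_le\<close> and covers all
  p.\<close>

lemma power_recursion_le:
  fixes \<delta> :: "nat \<Rightarrow> real"
  assumes "0 < c" "0 < p" and \<delta>: "\<And>k. 0 \<le> \<delta> k" "\<And>k. \<delta> k < 1"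
    and rec: "\<And>k. \<delta> (Suc k) \<le> \<delta> k * (1 - c * \<delta> k powr (1 / p))"
  shows "\<delta> k powr (1 / p) \<le> max 1 (1 / (min 1 (1 / p) * c)) / (1 + real k)"
proof (rule quadratic_recursion_decay)
  define m where "m = min 1 (1 / p) * c"
  have "0 < m" using assms by (simp add: m_def)
  then show "0 < min 1 (1 / p) * c" by (simp only: m_def)
  show "0 \<le> \<delta> k powr (1 / p)" for k by simp
  have "\<delta> 0 powr (1 / p) \<le> 1 powr (1 / p)" using \<delta>(1,2)[of 0] assms(2) by (intro powr_mono2) simp_all
  then show "\<delta> 0 powr (1 / p) \<le> max 1 (1 / (min 1 (1 / p) * c))" by simp
  have "m * (1 / m) \<le> m * max 1 (1 / m)"
    using \<open>0 < m\<close> by (intro mult_left_mono) simp_all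
  then show "1 \<le> min 1 (1 / p) * c * max 1 (1 / (min 1 (1 / p) * c))"
    using \<open>0 < m\<close> by (simp flip: m_def)
  fix k
  define y where "y = c * \<delta> k powr (1 / p)"
  show "\<delta> (Suc k) powr (1 / p) \<le> \<delta> k powr (1 / p) * (1 - min 1 (1 / p) * c * \<delta> k powr (1 / p))"
  proof (cases "\<delta> k = 0")
    case True
    then have "\<delta> (Suc k) = 0" using rec[of k] \<delta>(1)[of "Suc k"] by simp
    then show ?thesis using True by simp
  next
    case False
    then have "0 < \<delta> k" using \<delta>(1)[of k] by simp
    have "0 \<le> \<delta> k * (1 - y)" using rec[of k] \<delta>(1)[of "Suc k"] by (simp add: y_def)
    then have y: "0 \<le> y" "y \<le> 1" using \<open>0 < \<delta> k\<close> \<open>0 < c\<close>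
      by (simp_all add: zero_le_mult_iff y_def)
    have "\<delta> (Suc k) powr (1 / p) \<le> (\<delta> k * (1 - y)) powr (1 / p)"
      using rec[of k] \<delta>(1)[of "Suc k"] assms(2) by (intro powr_mono2) (simp_all add: y_def)
    also have "\<dots> = \<delta> k powr (1 / p) * (1 - y) powr (1 / p)"
      by (simp add: powr_mult)
    also have "\<dots> \<le> \<delta> k powr (1 / p) * (1 - min 1 (1 / p) * y)"
      using y assms(2) by (intro mult_left_mono powr_one_minus_le) simp_all
    finally show ?thesis by (simp add: y_def mult.assoc)
  qed
qed

lemma inverse_floor_le:
  fixes t R :: real
  assumes "0 < R" "0 \<le> t"
  shows "1 / (1 + real (nat \<lfloor>t / R\<rfloor>)) \<le> (1 + R) * (1 / (1 + t))"
proof -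
  define n where "n = real (nat \<lfloor>t / R\<rfloor>)"
  have "n = of_int \<lfloor>t / R\<rfloor>" "0 \<le> n" using assms by (simp_all add: n_def)
  then have "t / R < 1 + n" using real_of_int_floor_add_one_gt[of "t / R"] by linarith
  then have "t \<le> R * (1 + n)" using assms by (simp add: field_simps)
  then have "1 + t \<le> (1 + R) * (1 + n)" using \<open>0 \<le> n\<close> by (simp add: algebra_simps)
  then show ?thesis using assms \<open>0 \<le> n\<close> unfolding n_def[symmetric] by (simp add: field_simps)
qed

section \<open>Energy recursion and decay rates of damped solutions\<close>

context coupled_system
begin

text \<open>\<Psi> is G for the first claim and the identity for the second. The observability
  inequality is applied afresh at each time k R, with the conservative solution started from the
  damped state; the graph norm of the initial value bounds all later ones, so one normalisation
  serves for all k.\<close>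

lemma energy_recursion:
  fixes j2 :: "'v \<times> 'x \<times> 'u \<Rightarrow> 'h2::real_normed_vector"
  assumes damping: "transfer_bounded_on_line iV B Bs domC C D Ds \<or> damping_bounded domC iW D"
    and "0 < \<theta>" "\<theta> < 1" "0 < \<kappa>"
    and interp: "\<And>x. x \<in> domAd \<Longrightarrow> norm x \<le> \<kappa> * graph_norm Ad x powr (1 - \<theta>) * norm (j2 x) powr \<theta>"
    and \<Psi>: "mono_on {0..} \<Psi>" and "0 < T" "0 < c"
    and obs: "\<And>z0 z1. z0 \<in> domAd \<Longrightarrow> z0 \<noteq> 0 \<Longrightarrow> cauchy_solution domAc Ac z0 z1 \<Longrightarrow>
      c * (norm z0)\<^sup>2 * \<Psi> ((norm (j2 z0))\<^sup>2 / (norm z0)\<^sup>2)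
        \<le> integral {0..T} (\<lambda>s. (norm (Dsu (z1 s)))\<^sup>2)"
  obtains Q R c' where "0 < Q" "0 < R" "0 < c'"
    "\<And>z0 z. z0 \<in> domAd \<Longrightarrow> z0 \<noteq> 0 \<Longrightarrow> cauchy_solution domAd Ad z0 z \<Longrightarrow>
      \<exists>\<delta>. (\<forall>k. 0 \<le> \<delta> k \<and> \<delta> k < 1 \<and> \<delta> (Suc k) \<le> \<delta> k * (1 - c' * \<Psi> (\<delta> k powr ((1 - \<theta>) / \<theta>)))) \<and>
        (\<forall>t\<ge>0. (norm (z t))\<^sup>2 \<le> Q * (graph_norm Ad z0)\<^sup>2 * \<delta> (nat \<lfloor>t / R\<rfloor>))"
proof -
  obtain K R where K: "0 < K" "T \<le> R"
    and damped: "\<And>z0 z z1. z0 \<in> domAd \<Longrightarrow> cauchy_solution domAd Ad z0 z \<Longrightarrow> cauchy_solution domAc Ac z0 z1 \<Longrightarrow>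
      integral {0..T} (\<lambda>t. (norm (Dsu (z1 t)))\<^sup>2)
        \<le> K * integral {0..R} (\<lambda>t. (norm (Dsu (z t)))\<^sup>2)"
    by (rule damped_observability[OF damping less_imp_le[OF \<open>0 < T\<close>]]) (rule that)
  have "0 < R" using K(2) \<open>0 < T\<close> by simp
  \<comment> \<open>At least 2 so that the normalised energies stay strictly below 1, where the
    growth condition on G applies; at least the power of \<kappa> so that
    \<open>interpolation_ratio\<close> applies.\<close>
  define Q where "Q = max 2 (\<kappa> powr (2 / (1 - \<theta>)))"
  have Q: "2 \<le> Q" "\<kappa> powr (2 / (1 - \<theta>)) \<le> Q" by (simp_all add: Q_def)
  \<comment> \<open>The 2 comes from the energy balance, K from passing to the damped
    output.\<close>
  define c' where "c' = 2 * c / K"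
  have "0 < c'" using \<open>0 < c\<close> K(1) by (simp add: c'_def)
  show ?thesis
  proof (rule that[of Q R c'])
    fix z0 z assume z0: "z0 \<in> domAd" "z0 \<noteq> 0" and sol: "cauchy_solution domAd Ad z0 z"
    note z = cauchy_solutionD[OF sol]
    define N where "N = graph_norm Ad z0"
    have zN: "norm z0 \<le> N" unfolding N_def graph_norm_def by (intro real_le_rsqrt) simp
    then have "0 < N" using z0(2) by (meson less_le_trans zero_less_norm_iff)
    have QN: "0 < Q * N\<^sup>2" using Q(1) \<open>0 < N\<close> by simp
    define \<delta> where "\<delta> k = (norm (z (real k * R)))\<^sup>2 / (Q * N\<^sup>2)" for k
    have \<delta>: "0 \<le> \<delta> k" "\<delta> k < 1" for k
    proof -
      show "0 \<le> \<delta> k" using QN by (simp add: \<delta>_def)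
      have "norm (z (real k * R)) \<le> N"
        using damped_graph_norm_le(1)[OF sol _ z0(1), of "real k * R"] zN \<open>0 < R\<close> by simp
      then have "(norm (z (real k * R)))\<^sup>2 \<le> N\<^sup>2" by (intro power_mono) simp_all
      also have "\<dots> < Q * N\<^sup>2" using Q(1) \<open>0 < N\<close> by simp
      finally show "\<delta> k < 1" using QN by (simp add: \<delta>_def)
    qed
    have rec: "\<delta> (Suc k) \<le> \<delta> k * (1 - c' * \<Psi> (\<delta> k powr ((1 - \<theta>) / \<theta>)))" for k
    proof -
      define \<tau> where "\<tau> = real k * R"
      have "0 \<le> \<tau>" using \<open>0 < R\<close> by (simp add: \<tau>_def)
      define x where "x = z \<tau>"
      have x: "x \<in> domAd" unfolding x_def by (rule z(3)[OF \<open>0 \<le> \<tau>\<close>])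
      note shift = cauchy_solution_shift[OF sol \<open>0 \<le> \<tau>\<close>, folded x_def]
      have next_eq: "z (real (Suc k) * R) = z (\<tau> + R)" by (simp add: \<tau>_def algebra_simps)
      have \<delta>_k: "\<delta> k = (norm x)\<^sup>2 / (Q * N\<^sup>2)" unfolding \<delta>_def x_def \<tau>_def ..
      have \<delta>_Suc: "\<delta> (Suc k) = (norm (z (\<tau> + R)))\<^sup>2 / (Q * N\<^sup>2)" unfolding \<delta>_def next_eq ..
      have energy: "2 * integral {0..R} (\<lambda>t. (norm (Dsu (z (\<tau> + t))))\<^sup>2) = (norm x)\<^sup>2 - (norm (z (\<tau> + R)))\<^sup>2"
        by (rule damped_energy[OF shift less_imp_le[OF \<open>0 < R\<close>]])
      show ?thesis
      proof (cases "x = 0")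
        case True
        have "norm (z (\<tau> + R)) \<le> norm x"
          by (rule damped_graph_norm_le(1)[OF shift less_imp_le[OF \<open>0 < R\<close>] x])
        then have "z (\<tau> + R) = 0" using True by simp
        then show ?thesis using True by (simp add: \<delta>_k \<delta>_Suc)
      next
        case False
        have "x \<in> domAc" using x domAd_subset by blast
        then obtain z1 where z1: "cauchy_solution domAc Ac x z1"
          using unitary_group_solution[OF Ac_generates] by blast
        have "c * (norm x)\<^sup>2 * \<Psi> ((norm (j2 x))\<^sup>2 / (norm x)\<^sup>2)
            \<le> K * integral {0..R} (\<lambda>t. (norm (Dsu (z (\<tau> + t))))\<^sup>2)"
          by (rule order_trans[OF obs[OF x False z1] damped[OF x shift z1]])
        then have drop: "c' * (norm x)\<^sup>2 * \<Psi> ((norm (j2 x))\<^sup>2 / (norm x)\<^sup>2) \<le> (norm x)\<^sup>2 - (norm (z (\<tau> + R)))\<^sup>2"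
          unfolding energy[symmetric] using K(1) by (simp add: c'_def field_simps)
        have "graph_norm Ad x \<le> N"
          unfolding N_def x_def by (rule damped_graph_norm_le(2)[OF sol \<open>0 \<le> \<tau>\<close> z0(1)])
        have "norm x \<le> \<kappa> * N powr (1 - \<theta>) * norm (j2 x) powr \<theta>"
        proof (rule order_trans[OF interp[OF x]])
          have "graph_norm Ad x powr (1 - \<theta>) \<le> N powr (1 - \<theta>)"
            using \<open>graph_norm Ad x \<le> N\<close> \<open>\<theta> < 1\<close> by (intro powr_mono2) (simp_all add: graph_norm_def)
          then show "\<kappa> * graph_norm Ad x powr (1 - \<theta>) * norm (j2 x) powr \<theta> \<le> \<kappa> * N powr (1 - \<theta>) * norm (j2 x) powr \<theta>"
            using \<open>0 < \<kappa>\<close> by (intro mult_right_mono mult_left_mono) simp_all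
        qed
        then have ratio: "((norm x)\<^sup>2 / (\<kappa> powr (2 / (1 - \<theta>)) * N\<^sup>2)) powr ((1 - \<theta>) / \<theta>) \<le> (norm (j2 x))\<^sup>2 / (norm x)\<^sup>2"
          using False \<open>0 < N\<close> assms(2,3,4) by (intro interpolation_ratio) simp_all
        have "\<delta> k \<le> (norm x)\<^sup>2 / (\<kappa> powr (2 / (1 - \<theta>)) * N\<^sup>2)"
          unfolding \<delta>_k
          using Q(2) \<open>0 < N\<close> \<open>0 < \<kappa>\<close> Q(1) by (intro divide_left_mono mult_right_mono) simp_all
        then have "\<delta> k powr ((1 - \<theta>) / \<theta>) \<le> (norm (j2 x))\<^sup>2 / (norm x)\<^sup>2"
          using \<delta>(1) assms(2,3) by (intro order_trans[OF powr_mono2 ratio]) simp_all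
        then have "\<Psi> (\<delta> k powr ((1 - \<theta>) / \<theta>)) \<le> \<Psi> ((norm (j2 x))\<^sup>2 / (norm x)\<^sup>2)"
          by (intro monotone_onD[OF \<Psi>]) simp_all
        then have "c' * (norm x)\<^sup>2 * \<Psi> (\<delta> k powr ((1 - \<theta>) / \<theta>)) \<le> c' * (norm x)\<^sup>2 * \<Psi> ((norm (j2 x))\<^sup>2 / (norm x)\<^sup>2)"
          using \<open>0 < c'\<close> by (intro mult_left_mono) simp_all
        with drop have "(norm (z (\<tau> + R)))\<^sup>2 \<le> (norm x)\<^sup>2 * (1 - c' * \<Psi> (\<delta> k powr ((1 - \<theta>) / \<theta>)))"
          by (simp add: algebra_simps)
        then have "(norm (z (\<tau> + R)))\<^sup>2 / (Q * N\<^sup>2) \<le> (norm x)\<^sup>2 * (1 - c' * \<Psi> (\<delta> k powr ((1 - \<theta>) / \<theta>))) / (Q * N\<^sup>2)"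
          using QN by (intro divide_right_mono) simp_all
        then show ?thesis unfolding \<delta>_Suc by (simp add: \<delta>_k)
      qed
    qed
    \<comment> \<open>Between grid times the energy does not increase, so the preceding grid time
      bounds it.\<close>
    have "(norm (z t))\<^sup>2 \<le> Q * N\<^sup>2 * \<delta> (nat \<lfloor>t / R\<rfloor>)" if "0 \<le> t" for t
    proof -
      define \<tau> where "\<tau> = real (nat \<lfloor>t / R\<rfloor>) * R"
      have "real (nat \<lfloor>t / R\<rfloor>) = of_int \<lfloor>t / R\<rfloor>" using that \<open>0 < R\<close> by simp
      then have "\<tau> \<le> t / R * R" unfolding \<tau>_def using \<open>0 < R\<close> by (intro mult_right_mono) simp_all
      then have \<tau>: "0 \<le> \<tau>" "\<tau> \<le> t" using \<open>0 < R\<close> by (simp_all add: \<tau>_def)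
      have "norm (z (\<tau> + (t - \<tau>))) \<le> norm (z \<tau>)"
        using \<tau> by (intro damped_graph_norm_le(1)[OF cauchy_solution_shift[OF sol \<tau>(1)] _ z(3)]) simp_all
      then have "(norm (z t))\<^sup>2 \<le> (norm (z \<tau>))\<^sup>2" by (intro power_mono) simp_all
      also have "\<dots> = Q * N\<^sup>2 * \<delta> (nat \<lfloor>t / R\<rfloor>)" using Q(1) \<open>0 < N\<close> by (simp add: \<delta>_def \<tau>_def)
      finally show ?thesis .
    qed
    then show "\<exists>\<delta>. (\<forall>k. 0 \<le> \<delta> k \<and> \<delta> k < 1 \<and> \<delta> (Suc k) \<le> \<delta> k * (1 - c' * \<Psi> (\<delta> k powr ((1 - \<theta>) / \<theta>)))) \<and>
        (\<forall>t\<ge>0. (norm (z t))\<^sup>2 \<le> Q * (graph_norm Ad z0)\<^sup>2 * \<delta> (nat \<lfloor>t / R\<rfloor>))"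
      using \<delta> rec unfolding N_def by blast
  qed (use Q(1) \<open>0 < R\<close> \<open>0 < c'\<close> in simp_all)
qed

lemma interpolation_inequality:
  fixes j1 :: "'h1::complex_banach \<Rightarrow> 'v \<times> 'x \<times> 'u" and j2 :: "'v \<times> 'x \<times> 'u \<Rightarrow> 'h2::complex_banach"
  assumes "0 < \<theta>" "\<theta> < 1" and j1: "inclusion j1" and j2: "inclusion j2" and "domAd \<subseteq> range j1"
    and norm_H1: "equivalent_norms_on domAd (graph_norm Ad) (\<lambda>z. norm (inv j1 z))"
    and equiv: "equivalent_norms_on UNIV norm (\<lambda>z. interpolation_norm (j2 \<circ> j1) \<theta> (j2 z))"
  obtains \<kappa> where "0 < \<kappa>"
    "\<And>x. x \<in> domAd \<Longrightarrow> norm x \<le> \<kappa> * graph_norm Ad x powr (1 - \<theta>) * norm (j2 x) powr \<theta>"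
proof -
  obtain c where c: "0 < c" "\<And>z. c * norm z \<le> interpolation_norm (j2 \<circ> j1) \<theta> (j2 z)"
    using equiv unfolding equivalent_norms_on_def by blast
  obtain K where K: "0 < K" "\<And>x. x \<in> domAd \<Longrightarrow> norm (inv j1 x) \<le> K * graph_norm Ad x"
    using norm_H1 unfolding equivalent_norms_on_def by blast
  have incl: "inclusion (j2 \<circ> j1)"
    using j1 j2 unfolding inclusion_def bounded_clinear_def
    by (auto intro: inj_compose bounded_linear_compose[of j2 j1, folded o_def]
        simp del: split_paired_All)
  show ?thesis
  \<comment> \<open>K compares the norm of the first space with the graph norm, c the interpolation
    norm with the energy norm.\<close>
  proof (rule that[of "K powr (1 - \<theta>) / c"])
    fix x assume x: "x \<in> domAd"
    then have "j1 (inv j1 x) = x" using assms(5) by (intro f_inv_into_f) blast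
    then have "c * norm x \<le> norm (inv j1 x) powr (1 - \<theta>) * norm (j2 x) powr \<theta>"
      using order_trans[OF c(2) interpolation_norm_le[OF incl assms(1,2), of "inv j1 x", simplified o_apply]]
      by simp
    also have "\<dots> \<le> (K * graph_norm Ad x) powr (1 - \<theta>) * norm (j2 x) powr \<theta>"
      using K(2)[OF x] assms(2) by (intro mult_right_mono powr_mono2) simp_all
    also have "\<dots> = K powr (1 - \<theta>) * graph_norm Ad x powr (1 - \<theta>) * norm (j2 x) powr \<theta>"
      by (simp add: powr_mult)
    finally show "norm x \<le> K powr (1 - \<theta>) / c * graph_norm Ad x powr (1 - \<theta>) * norm (j2 x) powr \<theta>"
      using c(1) by (simp add: field_simps)
  qed (use c(1) K(1) in simp)
qed

lemma energy_decay:
  fixes j2 :: "'v \<times> 'x \<times> 'u \<Rightarrow> 'h2::real_normed_vector"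
  assumes damping: "transfer_bounded_on_line iV B Bs domC C D Ds \<or> damping_bounded domC iW D"
    and "0 < \<theta>" "\<theta> < 1" "0 < \<kappa>"
    and interp: "\<And>x. x \<in> domAd \<Longrightarrow> norm x \<le> \<kappa> * graph_norm Ad x powr (1 - \<theta>) * norm (j2 x) powr \<theta>"
    and G: "growth_function G (\<theta> / (1 - \<theta>))"
    and "\<exists>T>0. \<exists>c>0. \<forall>z0\<in>domAd. z0 \<noteq> 0 \<longrightarrow> (\<forall>z1. cauchy_solution domAc Ac z0 z1 \<longrightarrow>
          integral {0..T} (\<lambda>s. (norm (Dsu (z1 s)))\<^sup>2)
            \<ge> c * (norm z0)\<^sup>2 * G ((norm (j2 z0))\<^sup>2 / (norm z0)\<^sup>2))"
  shows "\<exists>K>0. \<forall>z0\<in>domAd. \<forall>z. cauchy_solution domAd Ad z0 z \<longrightarrow> (\<forall>t\<ge>0.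
          (norm (z t))\<^sup>2 / 2
            \<le> K * inv_into {0..} G (1 / (1 + t)) powr (\<theta> / (1 - \<theta>)) * (graph_norm Ad z0)\<^sup>2)"
proof -
  interpret growth_function G "\<theta> / (1 - \<theta>)" by (rule G)
  obtain T c where obs: "0 < T" "0 < c" "\<And>z0 z1. z0 \<in> domAd \<Longrightarrow> z0 \<noteq> 0 \<Longrightarrow> cauchy_solution domAc Ac z0 z1 \<Longrightarrow>
      c * (norm z0)\<^sup>2 * G ((norm (j2 z0))\<^sup>2 / (norm z0)\<^sup>2)
        \<le> integral {0..T} (\<lambda>s. (norm (Dsu (z1 s)))\<^sup>2)"
    using assms(7) by blast
  obtain Q R c' where "0 < Q" "0 < R" "0 < c'" and
    \<delta>: "\<And>z0 z. z0 \<in> domAd \<Longrightarrow> z0 \<noteq> 0 \<Longrightarrow> cauchy_solution domAd Ad z0 z \<Longrightarrow>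
      \<exists>\<delta>. (\<forall>k. 0 \<le> \<delta> k \<and> \<delta> k < 1 \<and> \<delta> (Suc k) \<le> \<delta> k * (1 - c' * G (\<delta> k powr ((1 - \<theta>) / \<theta>)))) \<and>
        (\<forall>t\<ge>0. (norm (z t))\<^sup>2 \<le> Q * (graph_norm Ad z0)\<^sup>2 * \<delta> (nat \<lfloor>t / R\<rfloor>))"
    by (rule energy_recursion[OF damping assms(2-4) _ mono obs(1,2)])
      (erule interp, erule (2) obs(3), rule that)
  define A where "A = max (G 1) (1 / c')"
  \<comment> \<open>A (1 + R) accounts for the recursion and for passing from steps to time;
    \<open>le_inverse_powr\<close> requires the constant to be at least 1.\<close>
  define a where "a = max 1 (A * (1 + R))"
  have "0 \<le> A" using \<open>0 < c'\<close> by (simp add: A_def le_max_iff_disj)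
  show ?thesis
  proof (intro exI[of _ "Q * a / 2"] conjI ballI allI impI)
    show "0 < Q * a / 2" using \<open>0 < Q\<close> by (simp add: a_def)
    fix z0 z and t :: real assume z0: "z0 \<in> domAd" and sol: "cauchy_solution domAd Ad z0 z" and "0 \<le> t"
    show "(norm (z t))\<^sup>2 / 2 \<le> Q * a / 2 * inv_into {0..} G (1 / (1 + t)) powr (\<theta> / (1 - \<theta>)) * (graph_norm Ad z0)\<^sup>2"
    proof (cases "z0 = 0")
      case True
      then have "z t = 0" using damped_graph_norm_le(1)[OF sol \<open>0 \<le> t\<close> z0] by simp
      then show ?thesis using \<open>0 < Q\<close> by (simp add: a_def)
    next
      case False
      from \<delta>[OF z0 this sol] obtain \<delta> where \<delta>: "\<And>k. 0 \<le> \<delta> k" "\<And>k. \<delta> k < 1"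
          "\<And>k. \<delta> (Suc k) \<le> \<delta> k * (1 - c' * G (\<delta> k powr (1 / (\<theta> / (1 - \<theta>)))))"
        and le: "\<And>t. 0 \<le> t \<Longrightarrow> (norm (z t))\<^sup>2 \<le> Q * (graph_norm Ad z0)\<^sup>2 * \<delta> (nat \<lfloor>t / R\<rfloor>)"
        by auto
      define k where "k = nat \<lfloor>t / R\<rfloor>"
      have "G (\<delta> k powr (1 / (\<theta> / (1 - \<theta>)))) \<le> A / (1 + real k)"
        unfolding A_def by (rule recursion_le[where \<delta> = \<delta>, OF \<open>0 < c'\<close> \<delta>])
      also have "\<dots> \<le> A * ((1 + R) * (1 / (1 + t)))"
        using mult_left_mono[OF inverse_floor_le[OF \<open>0 < R\<close> \<open>0 \<le> t\<close>] \<open>0 \<le> A\<close>] by (simp add: k_def)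
      also have "\<dots> \<le> a * (1 / (1 + t))"
        unfolding mult.assoc[symmetric] using \<open>0 \<le> t\<close> by (intro mult_right_mono) (simp_all add: a_def)
      finally have "\<delta> k \<le> a * inv_into {0..} G (1 / (1 + t)) powr (\<theta> / (1 - \<theta>))"
        using \<open>0 \<le> t\<close> by (intro le_inverse_powr \<delta>) (simp_all add: a_def)
      then have "Q * (graph_norm Ad z0)\<^sup>2 * \<delta> k
          \<le> Q * (graph_norm Ad z0)\<^sup>2 * (a * inv_into {0..} G (1 / (1 + t)) powr (\<theta> / (1 - \<theta>)))"
        using \<open>0 < Q\<close> by (intro mult_left_mono) simp_all
      with le[OF \<open>0 \<le> t\<close>] show ?thesis by (simp add: k_def mult_ac)
    qed
  qed
qed

lemma energy_decay_power:
  fixes j2 :: "'v \<times> 'x \<times> 'u \<Rightarrow> 'h2::real_normed_vector"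
  assumes damping: "transfer_bounded_on_line iV B Bs domC C D Ds \<or> damping_bounded domC iW D"
    and "0 < \<theta>" "\<theta> < 1" "0 < \<kappa>"
    and interp: "\<And>x. x \<in> domAd \<Longrightarrow> norm x \<le> \<kappa> * graph_norm Ad x powr (1 - \<theta>) * norm (j2 x) powr \<theta>"
    and "\<exists>T>0. \<exists>c>0. \<forall>z0\<in>domAd. z0 \<noteq> 0 \<longrightarrow> (\<forall>z1. cauchy_solution domAc Ac z0 z1 \<longrightarrow>
          integral {0..T} (\<lambda>s. (norm (Dsu (z1 s)))\<^sup>2) \<ge> c * (norm (j2 z0))\<^sup>2)"
  shows "\<exists>K>0. \<forall>z0\<in>domAd. \<forall>z. cauchy_solution domAd Ad z0 z \<longrightarrow> (\<forall>t\<ge>0.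
          (norm (z t))\<^sup>2 / 2 \<le> K / (1 + t) powr (\<theta> / (1 - \<theta>)) * (graph_norm Ad z0)\<^sup>2)"
proof -
  \<comment> \<open>The weak-norm hypothesis is written with the quotient so that it has the shape
    required by \<open>energy_recursion\<close>.\<close>
  obtain T c where obs: "0 < T" "0 < c" "\<And>z0 z1. z0 \<in> domAd \<Longrightarrow> z0 \<noteq> 0 \<Longrightarrow> cauchy_solution domAc Ac z0 z1 \<Longrightarrow>
      c * (norm z0)\<^sup>2 * ((norm (j2 z0))\<^sup>2 / (norm z0)\<^sup>2)
        \<le> integral {0..T} (\<lambda>s. (norm (Dsu (z1 s)))\<^sup>2)"
    using assms(6) by auto
  have id_mono: "mono_on {0..} (\<lambda>x::real. x)" by (simp add: monotone_on_def)
  obtain Q R c' where "0 < Q" "0 < R" "0 < c'" and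
    \<delta>: "\<And>z0 z. z0 \<in> domAd \<Longrightarrow> z0 \<noteq> 0 \<Longrightarrow> cauchy_solution domAd Ad z0 z \<Longrightarrow>
      \<exists>\<delta>. (\<forall>k. 0 \<le> \<delta> k \<and> \<delta> k < 1 \<and> \<delta> (Suc k) \<le> \<delta> k * (1 - c' * \<delta> k powr ((1 - \<theta>) / \<theta>))) \<and>
        (\<forall>t\<ge>0. (norm (z t))\<^sup>2 \<le> Q * (graph_norm Ad z0)\<^sup>2 * \<delta> (nat \<lfloor>t / R\<rfloor>))"
    by (rule energy_recursion[OF damping assms(2-4) _ id_mono obs(1,2)])
      (erule interp, erule (2) obs(3), rule that)
  define p where "p = \<theta> / (1 - \<theta>)"
  have p: "0 < p" "(1 - \<theta>) / \<theta> = 1 / p" using assms(2,3) by (simp_all add: p_def)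
  define A where "A = max 1 (1 / (min 1 (1 / p) * c'))"
  define a where "a = A * (1 + R)"
  have "0 < A" by (simp add: A_def less_max_iff_disj)
  then have "0 < a" using \<open>0 < R\<close> by (simp add: a_def)
  show ?thesis
    unfolding p_def[symmetric]
  \<comment> \<open>The recursion bounds \<open>\<delta> k powr (1 / p)\<close> by a / (1 + t);
    raising this to the power p produces \<open>a powr p\<close>.\<close>
  proof (intro exI[of _ "Q * a powr p / 2"] conjI ballI allI impI)
    show "0 < Q * a powr p / 2" using \<open>0 < Q\<close> \<open>0 < a\<close> by simp
    fix z0 z and t :: real assume z0: "z0 \<in> domAd" and sol: "cauchy_solution domAd Ad z0 z" and "0 \<le> t"
    show "(norm (z t))\<^sup>2 / 2 \<le> Q * a powr p / 2 / (1 + t) powr p * (graph_norm Ad z0)\<^sup>2"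
    proof (cases "z0 = 0")
      case True
      then have "z t = 0" using damped_graph_norm_le(1)[OF sol \<open>0 \<le> t\<close> z0] by simp
      then show ?thesis using \<open>0 < Q\<close> by simp
    next
      case False
      from \<delta>[OF z0 this sol] obtain \<delta> where \<delta>: "\<And>k. 0 \<le> \<delta> k" "\<And>k. \<delta> k < 1"
          "\<And>k. \<delta> (Suc k) \<le> \<delta> k * (1 - c' * \<delta> k powr (1 / p))"
        and le: "\<And>t. 0 \<le> t \<Longrightarrow> (norm (z t))\<^sup>2 \<le> Q * (graph_norm Ad z0)\<^sup>2 * \<delta> (nat \<lfloor>t / R\<rfloor>)"
        unfolding p(2) by auto
      define k where "k = nat \<lfloor>t / R\<rfloor>"
      have "\<delta> k powr (1 / p) \<le> A / (1 + real k)"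
        unfolding A_def by (rule power_recursion_le[where \<delta> = \<delta>, OF \<open>0 < c'\<close> p(1) \<delta>])
      also have "\<dots> \<le> A * ((1 + R) * (1 / (1 + t)))"
        using mult_left_mono[OF inverse_floor_le[OF \<open>0 < R\<close> \<open>0 \<le> t\<close>] less_imp_le[OF \<open>0 < A\<close>]]
        by (simp add: k_def)
      finally have "\<delta> k powr (1 / p) \<le> a / (1 + t)" by (simp add: a_def)
      then have "(\<delta> k powr (1 / p)) powr p \<le> (a / (1 + t)) powr p" using p(1) by (intro powr_mono2) simp_all
      then have "\<delta> k \<le> a powr p / (1 + t) powr p"
        using p(1) \<delta>(1)[of k] \<open>0 < a\<close> \<open>0 \<le> t\<close> by (simp add: powr_powr powr_divide)
      then have "Q * (graph_norm Ad z0)\<^sup>2 * \<delta> k \<le> Q * (graph_norm Ad z0)\<^sup>2 * (a powr p / (1 + t) powr p)"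
        using \<open>0 < Q\<close> by (intro mult_left_mono) simp_all
      with le[OF \<open>0 \<le> t\<close>] show ?thesis by (simp add: k_def mult_ac)
    qed
  qed
qed

end

theorem theorem5p1:
  fixes iV :: "'v::complex_hilbert \<Rightarrow> 'x::complex_hilbert"
    and B :: "'u::complex_hilbert \<Rightarrow> 'v \<Rightarrow> complex"
    and Bs :: "'v \<Rightarrow> 'u"
    and domC domChat :: "'u set"
    and C Chat :: "'u \<Rightarrow> 'u"
    and iW :: "'w::complex_hilbert \<Rightarrow> 'u"
    and D :: "'w \<Rightarrow> 'u \<Rightarrow> complex"
    and Ds :: "'u \<Rightarrow> 'w"
    and domAd domAc :: "('v \<times> 'x \<times> 'u) set"
    and Ad Ac :: "'v \<times> 'x \<times> 'u \<Rightarrow> 'v \<times> 'x \<times> 'u"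
    and j1 :: "'h1::complex_banach \<Rightarrow> 'v \<times> 'x \<times> 'u"
    and j2 :: "'v \<times> 'x \<times> 'u \<Rightarrow> 'h2::complex_banach"
    and \<theta> :: real
    and G :: "real \<Rightarrow> real"
  assumes system: "coupled_system iV B Bs domC C domChat Chat iW D Ds"
    and domAd_def: "domAd = coupled_dom iV B domChat"
    and Ad_def: "Ad = coupled_op iV B Bs Chat"
    and domAc_def: "domAc = coupled_dom iV B domC"
    and Ac_def: "Ac = coupled_op iV B Bs (\<lambda>u. - C u)"
    and theta: "0 < \<theta>" "\<theta> < 1"
    and H1_H: "inclusion j1"
    and H_H2: "inclusion j2"
    and domAd_H1: "domAd \<subseteq> range j1"
    and norm_H1: "equivalent_norms_on domAd (graph_norm Ad) (\<lambda>z. norm (inv j1 z))"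
    and interpolation: "interpolation_space (j2 \<circ> j1) \<theta> = range j2"
    and interpolation_equiv: "equivalent_norms_on UNIV norm (\<lambda>z. interpolation_norm (j2 \<circ> j1) \<theta> (j2 z))"
    and G_continuous: "continuous_on {0..} G"
    and G_invertible: "bij_betw G {0..} {0..}"
    and G_increasing: "mono_on {0..} G"
    and G_growth: "mono_on {0<..<1} (\<lambda>x. x powr (- (\<theta> / (1 - \<theta>))) * G x)"
    and damping: "transfer_bounded_on_line iV B Bs domC C D Ds \<or> damping_bounded domC iW D"
  shows
    "((\<exists>T>0. \<exists>c>0. \<forall>z0\<in>domAd. z0 \<noteq> 0 \<longrightarrow> (\<forall>z1. cauchy_solution domAc Ac z0 z1 \<longrightarrow>
          integral {0..T} (\<lambda>s. (norm (Ds (snd (snd (z1 s)))))\<^sup>2)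
            \<ge> c * (norm z0)\<^sup>2 * G ((norm (j2 z0))\<^sup>2 / (norm z0)\<^sup>2))) \<longrightarrow>
      (\<exists>K>0. \<forall>z0\<in>domAd. \<forall>z. cauchy_solution domAd Ad z0 z \<longrightarrow> (\<forall>t\<ge>0.
          (norm (z t))\<^sup>2 / 2
            \<le> K * inv_into {0..} G (1 / (1 + t)) powr (\<theta> / (1 - \<theta>)) * (graph_norm Ad z0)\<^sup>2)))
     \<and>
     ((\<exists>T>0. \<exists>c>0. \<forall>z0\<in>domAd. z0 \<noteq> 0 \<longrightarrow> (\<forall>z1. cauchy_solution domAc Ac z0 z1 \<longrightarrow>
          integral {0..T} (\<lambda>s. (norm (Ds (snd (snd (z1 s)))))\<^sup>2) \<ge> c * (norm (j2 z0))\<^sup>2)) \<longrightarrow>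
      (\<exists>K>0. \<forall>z0\<in>domAd. \<forall>z. cauchy_solution domAd Ad z0 z \<longrightarrow> (\<forall>t\<ge>0.
          (norm (z t))\<^sup>2 / 2
            \<le> K / (1 + t) powr (\<theta> / (1 - \<theta>)) * (graph_norm Ad z0)\<^sup>2)))"
proof -
  obtain \<kappa> where \<kappa>: "0 < \<kappa>"
    "\<And>x. x \<in> coupled_dom iV B domChat \<Longrightarrow>
      norm x \<le> \<kappa> * graph_norm (coupled_op iV B Bs Chat) x powr (1 - \<theta>) * norm (j2 x) powr \<theta>"
    by (rule coupled_system.interpolation_inequality[OF system theta H1_H H_H2
        domAd_H1[unfolded domAd_def] norm_H1[unfolded domAd_def Ad_def] interpolation_equiv]) (rule that)
  have G: "growth_function G (\<theta> / (1 - \<theta>))"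
    using theta G_invertible G_increasing G_growth by unfold_locales simp_all
  show ?thesis
    unfolding domAd_def Ad_def domAc_def Ac_def
    by (intro conjI impI; (rule coupled_system.energy_decay[OF system damping theta \<kappa>(1) _ G]
        coupled_system.energy_decay_power[OF system damping theta \<kappa>(1)]))
      (simp_all only: \<kappa>(2))
qed

end
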